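(* Let $(M,\alpha,\mathcal X)$ be a complete pre-isotropic structure of the Reeb type, related to a proper submersion $\pi:M\to W$. Then the associated foliation $\mathcal F=\ker\pi_*$ is $\alpha$-complete.
   Context: All objects are smooth. A contact form on a connected manifold $M^{2n+1}$ is a 1-form $\alpha$ with $\alpha\wedge(d\alpha)^n\ne0$; $\mathcal H=\ker\alpha$. The Reeb field $Z$ is given by $i_Z\alpha=1$, $i_Zd\alpha=0$. For a function $f$, $X_f$ is the unique vector field whose flow preserves $\mathcal H$ and with $i_{X_f}\alpha=f$; the Jacobi bracket is $[f,g]=i_{[X_f,X_g]}\alpha$. Let $\pi:M\to W$ be a proper submersion onto a $p$-dimensional manifold, $p\ge n$. $(M,\alpha,\mathcal X)$ is a complete pre-isotropic structure of the Reeb type if: $\mathcal F=\ker\pi_*$ is transversal to $\mathcal H$ and $\mathcal F\cap\mathcal H$ is an isotropic subbundle of $\mathcal H$ ($d\alpha$ vanishes on it); $\mathcal X$ is an Abelian Lie algebra of infinitesimal automorphisms of $\alpha$ ($\mathcal L_Y\alpha=0$ for $Y\in\mathcal X$) which has the fibers of $\pi$ as orbits (orbits being the connected components if fibers are not connected); and the Reeb field $Z$ is a section of $\mathcal F$. A foliation $\mathcal F$ is $\alpha$-complete if for any pair $f_1,f_2$ of (local) first integrals of $\mathcal F$ (functions with differential vanishing on $\mathcal F$; $f_i$ may be constant), $[f_1,f_2]$ is also a first integral of $\mathcal F$ (possibly a constant). *)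

theory Defs
  imports "HOL-Analysis.Analysis"
begin

section \<open>Smooth functions on open subsets of normed spaces\<close>

text \<open>\<open>Ck_on k S f\<close> is the usual notion of class \<open>C\<^sup>k\<close> only for open \<open>S\<close> and a
  finite-dimensional domain, which is the only case used below.\<close>

primrec Ck_on :: "nat \<Rightarrow> 'a::real_normed_vector set \<Rightarrow> ('a \<Rightarrow> 'b::real_normed_vector) \<Rightarrow> bool" where
  "Ck_on 0 S f \<longleftrightarrow> continuous_on S f"
| "Ck_on (Suc k) S f \<longleftrightarrow> (\<forall>x\<in>S. f differentiable (at x)) \<and>
     (\<forall>v. Ck_on k S (\<lambda>x. frechet_derivative f (at x) v))"

definition smooth_on :: "'a::real_normed_vector set \<Rightarrow> ('a \<Rightarrow> 'b::real_normed_vector) \<Rightarrow> bool" where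
  "smooth_on S f \<longleftrightarrow> (\<forall>k. Ck_on k S f)"


section \<open>Smooth manifolds\<close>

text \<open>A manifold is a whole type \<open>'m\<close> with its topology (Hausdorff and second countable by class
  constraints) and an atlas of charts in the Euclidean space \<open>'e\<close>; its dimension is \<open>DIM('e)\<close>.
  A chart is a pair of its domain and its coordinate map.\<close>

type_synonym ('m, 'e) chart = "'m set \<times> ('m \<Rightarrow> 'e)"

definition chart_inv :: "('m, 'e) chart \<Rightarrow> 'e \<Rightarrow> 'm" where
  "chart_inv c = inv_into (fst c) (snd c)"

definition smooth_manifold ::
  "('m::{t2_space,second_countable_topology}, 'e::euclidean_space) chart set \<Rightarrow> bool" where
  "smooth_manifold A \<longleftrightarrow>
     (\<Union>c\<in>A. fst c) = UNIV \<and>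
     (\<forall>c\<in>A. open (fst c) \<and> open (snd c ` fst c) \<and>
        homeomorphism (fst c) (snd c ` fst c) (snd c) (chart_inv c)) \<and>
     (\<forall>c\<in>A. \<forall>d\<in>A. smooth_on (snd c ` (fst c \<inter> fst d)) (snd d \<circ> chart_inv c))"

definition std_atlas :: "('e, 'e) chart set" where
  "std_atlas = {(UNIV, \<lambda>x. x)}"

definition prod_atlas :: "('m, 'e) chart set \<Rightarrow> ('n, 'f) chart set \<Rightarrow> ('m \<times> 'n, 'e \<times> 'f) chart set" where
  "prod_atlas A B = {(fst c \<times> fst d, map_prod (snd c) (snd d)) | c d. c \<in> A \<and> d \<in> B}"

definition smooth_map ::
  "('m::topological_space, 'e::euclidean_space) chart set \<Rightarrow>
   ('n::topological_space, 'f::euclidean_space) chart set \<Rightarrow> 'm set \<Rightarrow> ('m \<Rightarrow> 'n) \<Rightarrow> bool" where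
  "smooth_map A B U f \<longleftrightarrow> open U \<and> continuous_on U f \<and>
     (\<forall>c\<in>A. \<forall>d\<in>B. smooth_on (snd c ` (U \<inter> fst c \<inter> f -` fst d)) (snd d \<circ> f \<circ> chart_inv c))"


section \<open>Tangent vectors, vector fields and differential forms\<close>

text \<open>A chart \<open>chart_at A x\<close> around each point \<open>x\<close> is fixed once and for all, and the tangent space
  at \<open>x\<close> is identified with \<open>'e\<close> through it. So a vector field is a map \<open>'m \<Rightarrow> 'e\<close> whose value at \<open>x\<close>
  is given in the coordinates of \<open>chart_at A x\<close>. The preferred chart jumps with \<open>x\<close>; regularity is
  therefore always expressed through the components in one fixed chart \<open>c\<close> (\<open>vec_rep\<close> and
  \<open>form_rep\<close>).\<close>

definition chart_at :: "('m, 'e) chart set \<Rightarrow> 'm \<Rightarrow> ('m, 'e) chart" where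
  "chart_at A x = (SOME c. c \<in> A \<and> x \<in> fst c)"

definition mderiv ::
  "('m, 'e::euclidean_space) chart set \<Rightarrow> ('n, 'f::euclidean_space) chart set \<Rightarrow>
   ('m \<Rightarrow> 'n) \<Rightarrow> 'm \<Rightarrow> 'e \<Rightarrow> 'f" where
  "mderiv A B f x =
     frechet_derivative (snd (chart_at B (f x)) \<circ> f \<circ> chart_inv (chart_at A x))
       (at (snd (chart_at A x) x))"

definition vec_rep ::
  "('m, 'e::euclidean_space) chart set \<Rightarrow> ('m, 'e) chart \<Rightarrow> ('m \<Rightarrow> 'e) \<Rightarrow> 'e \<Rightarrow> 'e" where
  "vec_rep A c X y = (let x = chart_inv c y; b = chart_at A x in
     frechet_derivative (snd c \<circ> chart_inv b) (at (snd b x)) (X x))"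

definition form_rep ::
  "('m, 'e::euclidean_space) chart set \<Rightarrow> ('m, 'e) chart \<Rightarrow> ('m \<Rightarrow> 'e \<Rightarrow> real) \<Rightarrow> 'e \<Rightarrow> 'e \<Rightarrow> real" where
  "form_rep A c \<alpha> y w = (let x = chart_inv c y; b = chart_at A x in
     \<alpha> x (frechet_derivative (snd b \<circ> chart_inv c) (at y) w))"

definition smooth_vector_field ::
  "('m::topological_space, 'e::euclidean_space) chart set \<Rightarrow> 'm set \<Rightarrow> ('m \<Rightarrow> 'e) \<Rightarrow> bool" where
  "smooth_vector_field A U X \<longleftrightarrow> open U \<and>
     (\<forall>c\<in>A. smooth_on (snd c ` (U \<inter> fst c)) (vec_rep A c X))"

definition smooth_one_form ::
  "('m::topological_space, 'e::euclidean_space) chart set \<Rightarrow> ('m \<Rightarrow> 'e \<Rightarrow> real) \<Rightarrow> bool" where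
  "smooth_one_form A \<alpha> \<longleftrightarrow> (\<forall>x. linear (\<alpha> x)) \<and>
     (\<forall>c\<in>A. \<forall>w. smooth_on (snd c ` fst c) (\<lambda>y. form_rep A c \<alpha> y w))"

text \<open>In coordinates, \<open>[X,Y] = DY(X) - DX(Y)\<close> and
  \<open>d\<alpha>(u,v) = \<partial>\<^sub>u (\<alpha>(v)) - \<partial>\<^sub>v (\<alpha>(u))\<close> for constant \<open>u\<close>, \<open>v\<close>. In the chart
  \<open>chart_at A x\<close> the components of a tangent vector at \<open>x\<close> are the vector itself.\<close>

definition lie_bracket ::
  "('m, 'e::euclidean_space) chart set \<Rightarrow> ('m \<Rightarrow> 'e) \<Rightarrow> ('m \<Rightarrow> 'e) \<Rightarrow> 'm \<Rightarrow> 'e" where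
  "lie_bracket A X Y x = (let c = chart_at A x; y = snd c x in
     frechet_derivative (vec_rep A c Y) (at y) (X x) -
     frechet_derivative (vec_rep A c X) (at y) (Y x))"

definition ext_deriv ::
  "('m, 'e::euclidean_space) chart set \<Rightarrow> ('m \<Rightarrow> 'e \<Rightarrow> real) \<Rightarrow> 'm \<Rightarrow> 'e \<Rightarrow> 'e \<Rightarrow> real" where
  "ext_deriv A \<alpha> x u v = (let c = chart_at A x; y = snd c x in
     frechet_derivative (\<lambda>z. form_rep A c \<alpha> z v) (at y) u -
     frechet_derivative (\<lambda>z. form_rep A c \<alpha> z u) (at y) v)"

text \<open>Cartan's formula: \<open>\<L>\<^sub>Y \<alpha> = d (i\<^sub>Y \<alpha>) + i\<^sub>Y d\<alpha>\<close>.\<close>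

definition lie_deriv ::
  "('m, 'e::euclidean_space) chart set \<Rightarrow> ('m \<Rightarrow> 'e) \<Rightarrow> ('m \<Rightarrow> 'e \<Rightarrow> real) \<Rightarrow> 'm \<Rightarrow> 'e \<Rightarrow> real" where
  "lie_deriv A Y \<alpha> x v = mderiv A std_atlas (\<lambda>z. \<alpha> z (Y z)) x v + ext_deriv A \<alpha> x (Y x) v"

text \<open>An alternating \<open>k\<close>-form on a vector space is a function of sequences of vectors of which only
  the entries with index below \<open>k\<close> matter.\<close>

definition wedge ::
  "nat \<Rightarrow> nat \<Rightarrow> ((nat \<Rightarrow> 'e) \<Rightarrow> real) \<Rightarrow> ((nat \<Rightarrow> 'e) \<Rightarrow> real) \<Rightarrow> (nat \<Rightarrow> 'e) \<Rightarrow> real" where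
  "wedge k l \<omega> \<eta> v =
     (\<Sum>\<sigma> | \<sigma> permutes {..<k + l}.
        of_int (sign \<sigma>) * \<omega> (\<lambda>i. v (\<sigma> i)) * \<eta> (\<lambda>i. v (\<sigma> (k + i)))) / (fact k * fact l)"

primrec wedge_power :: "nat \<Rightarrow> ((nat \<Rightarrow> 'e) \<Rightarrow> real) \<Rightarrow> nat \<Rightarrow> (nat \<Rightarrow> 'e) \<Rightarrow> real" where
  "wedge_power k \<omega> 0 = (\<lambda>_. 1)"
| "wedge_power k \<omega> (Suc j) = wedge k (k * j) \<omega> (wedge_power k \<omega> j)"


section \<open>Integral curves, flows and orbits\<close>

definition integral_curve ::
  "('m::topological_space, 'e::euclidean_space) chart set \<Rightarrow> ('m \<Rightarrow> 'e) \<Rightarrow> (real \<Rightarrow> 'm) \<Rightarrow>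
   real \<Rightarrow> real \<Rightarrow> bool" where
  "integral_curve A X c a b \<longleftrightarrow> smooth_map std_atlas A {a<..<b} c \<and>
     (\<forall>t\<in>{a<..<b}. mderiv std_atlas A c t 1 = X (c t))"

definition local_flow ::
  "('m::topological_space, 'e::euclidean_space) chart set \<Rightarrow> 'm set \<Rightarrow> ('m \<Rightarrow> 'e) \<Rightarrow>
   'm set \<Rightarrow> real \<Rightarrow> (real \<Rightarrow> 'm \<Rightarrow> 'm) \<Rightarrow> bool" where
  "local_flow A U X V \<epsilon> \<phi> \<longleftrightarrow> open V \<and> V \<subseteq> U \<and> \<epsilon> > 0 \<and>
     smooth_map (prod_atlas std_atlas A) A ({-\<epsilon><..<\<epsilon>} \<times> V) (\<lambda>(t, y). \<phi> t y) \<and>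
     (\<forall>y\<in>V. \<phi> 0 y = y \<and> (\<forall>t\<in>{-\<epsilon><..<\<epsilon>}. \<phi> t y \<in> U) \<and>
        integral_curve A X (\<lambda>t. \<phi> t y) (-\<epsilon>) \<epsilon>)"

definition flow_preserves ::
  "('m::topological_space, 'e::euclidean_space) chart set \<Rightarrow> 'm set \<Rightarrow> ('m \<Rightarrow> 'e) \<Rightarrow>
   ('m \<Rightarrow> 'e set) \<Rightarrow> bool" where
  "flow_preserves A U X D \<longleftrightarrow>
     (\<forall>x\<in>U. \<exists>V \<epsilon> \<phi>. x \<in> V \<and> local_flow A U X V \<epsilon> \<phi> \<and>
        (\<forall>t\<in>{-\<epsilon><..<\<epsilon>}. \<forall>y\<in>V. mderiv A A (\<phi> t) y ` D y = D (\<phi> t y)))"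

text \<open>The orbit of a point under a family of vector fields: all points reached by finitely many
  successive arcs of integral curves.\<close>

definition orbit_step ::
  "('m::topological_space, 'e::euclidean_space) chart set \<Rightarrow> ('m \<Rightarrow> 'e) set \<Rightarrow> ('m \<times> 'm) set" where
  "orbit_step A \<X> = {(x, y). \<exists>Y\<in>\<X>. \<exists>c a b. \<exists>s\<in>{a<..<b}. \<exists>t\<in>{a<..<b}.
     integral_curve A Y c a b \<and> c s = x \<and> c t = y}"

definition orbit_of ::
  "('m::topological_space, 'e::euclidean_space) chart set \<Rightarrow> ('m \<Rightarrow> 'e) set \<Rightarrow> 'm \<Rightarrow> 'm set" where
  "orbit_of A \<X> x = {y. (x, y) \<in> (orbit_step A \<X>)\<^sup>*}"


section \<open>Contact geometry\<close>

definition contact_form ::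
  "('m::topological_space, 'e::euclidean_space) chart set \<Rightarrow> nat \<Rightarrow> ('m \<Rightarrow> 'e \<Rightarrow> real) \<Rightarrow> bool" where
  "contact_form A n \<alpha> \<longleftrightarrow> DIM('e) = 2 * n + 1 \<and> smooth_one_form A \<alpha> \<and>
     (\<forall>x. \<exists>v. wedge 1 (2 * n) (\<lambda>w. \<alpha> x (w 0))
        (wedge_power 2 (\<lambda>w. ext_deriv A \<alpha> x (w 0) (w 1)) n) v \<noteq> 0)"

definition contact_dist :: "('m \<Rightarrow> 'e \<Rightarrow> real) \<Rightarrow> 'm \<Rightarrow> 'e set" where
  "contact_dist \<alpha> x = {v. \<alpha> x v = 0}"

definition reeb_field ::
  "('m::topological_space, 'e::euclidean_space) chart set \<Rightarrow> ('m \<Rightarrow> 'e \<Rightarrow> real) \<Rightarrow> ('m \<Rightarrow> 'e) \<Rightarrow> bool" where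
  "reeb_field A \<alpha> Z \<longleftrightarrow> smooth_vector_field A UNIV Z \<and>
     (\<forall>x. \<alpha> x (Z x) = 1 \<and> (\<forall>v. ext_deriv A \<alpha> x (Z x) v = 0))"

text \<open>\<open>contact_field A \<alpha> U f X\<close>: on the open set \<open>U\<close>, \<open>X\<close> is the vector field \<open>X\<^sub>f\<close>. By the
  classical existence and uniqueness of \<open>X\<^sub>f\<close>, every smooth \<open>f\<close> on \<open>U\<close> has exactly one such field
  (up to irrelevant values outside \<open>U\<close>), so \<open>jacobi_bracket A \<alpha> U f g h\<close> is the
  graph of the operation \<open>h = [f,g]\<close> on \<open>U\<close>.\<close>

definition contact_field ::
  "('m::topological_space, 'e::euclidean_space) chart set \<Rightarrow> ('m \<Rightarrow> 'e \<Rightarrow> real) \<Rightarrow> 'm set \<Rightarrow>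
   ('m \<Rightarrow> real) \<Rightarrow> ('m \<Rightarrow> 'e) \<Rightarrow> bool" where
  "contact_field A \<alpha> U f X \<longleftrightarrow> smooth_vector_field A U X \<and>
     flow_preserves A U X (contact_dist \<alpha>) \<and> (\<forall>x\<in>U. \<alpha> x (X x) = f x)"

definition jacobi_bracket ::
  "('m::topological_space, 'e::euclidean_space) chart set \<Rightarrow> ('m \<Rightarrow> 'e \<Rightarrow> real) \<Rightarrow> 'm set \<Rightarrow>
   ('m \<Rightarrow> real) \<Rightarrow> ('m \<Rightarrow> real) \<Rightarrow> ('m \<Rightarrow> real) \<Rightarrow> bool" where
  "jacobi_bracket A \<alpha> U f g h \<longleftrightarrow>
     (\<exists>X Y. contact_field A \<alpha> U f X \<and> contact_field A \<alpha> U g Y \<and>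
        (\<forall>x\<in>U. h x = \<alpha> x (lie_bracket A X Y x)))"


section \<open>Complete pre-isotropic structures and complete foliations\<close>

definition proper_submersion_onto ::
  "('m::topological_space, 'e::euclidean_space) chart set \<Rightarrow>
   ('w::topological_space, 'f::euclidean_space) chart set \<Rightarrow> ('m \<Rightarrow> 'w) \<Rightarrow> bool" where
  "proper_submersion_onto A B \<pi> \<longleftrightarrow> smooth_map A B UNIV \<pi> \<and> surj \<pi> \<and>
     (\<forall>x. surj (mderiv A B \<pi> x)) \<and> (\<forall>K. compact K \<longrightarrow> compact (\<pi> -` K))"

definition ker_dist ::
  "('m, 'e::euclidean_space) chart set \<Rightarrow> ('w, 'f::euclidean_space) chart set \<Rightarrow> ('m \<Rightarrow> 'w) \<Rightarrow>
   'm \<Rightarrow> 'e set" where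
  "ker_dist A B \<pi> x = {v. mderiv A B \<pi> x v = 0}"

definition transversal :: "('m \<Rightarrow> 'e::real_vector set) \<Rightarrow> ('m \<Rightarrow> 'e set) \<Rightarrow> bool" where
  "transversal F H \<longleftrightarrow> (\<forall>x. {u + v | u v. u \<in> F x \<and> v \<in> H x} = UNIV)"

text \<open>Used for \<open>D = ker \<pi>\<^sub>* \<inter> ker \<alpha>\<close> only: the kernel of a smooth bundle map is a subbundle
  iff its dimension is constant.\<close>

definition isotropic_subbundle ::
  "('m, 'e::euclidean_space) chart set \<Rightarrow> ('m \<Rightarrow> 'e \<Rightarrow> real) \<Rightarrow> ('m \<Rightarrow> 'e set) \<Rightarrow> bool" where
  "isotropic_subbundle A \<alpha> D \<longleftrightarrow> (\<exists>k. \<forall>x. dim (D x) = k) \<and>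
     (\<forall>x. D x \<subseteq> contact_dist \<alpha> x) \<and> (\<forall>x. \<forall>u\<in>D x. \<forall>v\<in>D x. ext_deriv A \<alpha> x u v = 0)"

definition abelian_lie_algebra ::
  "('m::topological_space, 'e::euclidean_space) chart set \<Rightarrow> ('m \<Rightarrow> 'e) set \<Rightarrow> bool" where
  "abelian_lie_algebra A \<X> \<longleftrightarrow>
     (\<forall>Y\<in>\<X>. smooth_vector_field A UNIV Y) \<and>
     (\<lambda>x. 0) \<in> \<X> \<and>
     (\<forall>Y\<in>\<X>. \<forall>Y'\<in>\<X>. (\<lambda>x. Y x + Y' x) \<in> \<X>) \<and>
     (\<forall>r. \<forall>Y\<in>\<X>. (\<lambda>x. r *\<^sub>R Y x) \<in> \<X>) \<and>
     (\<forall>Y\<in>\<X>. \<forall>Y'\<in>\<X>. \<forall>x. lie_bracket A Y Y' x = 0)"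

definition complete_pre_isotropic_reeb ::
  "('m::topological_space, 'e::euclidean_space) chart set \<Rightarrow>
   ('w::topological_space, 'f::euclidean_space) chart set \<Rightarrow> ('m \<Rightarrow> 'w) \<Rightarrow>
   ('m \<Rightarrow> 'e \<Rightarrow> real) \<Rightarrow> ('m \<Rightarrow> 'e) set \<Rightarrow> bool" where
  "complete_pre_isotropic_reeb A B \<pi> \<alpha> \<X> \<longleftrightarrow>
     transversal (ker_dist A B \<pi>) (contact_dist \<alpha>) \<and>
     isotropic_subbundle A \<alpha> (\<lambda>x. ker_dist A B \<pi> x \<inter> contact_dist \<alpha> x) \<and>
     abelian_lie_algebra A \<X> \<and>
     (\<forall>Y\<in>\<X>. \<forall>x v. lie_deriv A Y \<alpha> x v = 0) \<and>
     (\<forall>x. orbit_of A \<X> x = connected_component_set (\<pi> -` {\<pi> x}) x) \<and>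
     (\<exists>Z. reeb_field A \<alpha> Z \<and> (\<forall>x. Z x \<in> ker_dist A B \<pi> x))"

definition first_integral ::
  "('m::topological_space, 'e::euclidean_space) chart set \<Rightarrow> ('m \<Rightarrow> 'e set) \<Rightarrow> 'm set \<Rightarrow>
   ('m \<Rightarrow> real) \<Rightarrow> bool" where
  "first_integral A F U f \<longleftrightarrow> smooth_map A std_atlas U f \<and>
     (\<forall>x\<in>U. \<forall>v\<in>F x. mderiv A std_atlas f x v = 0)"

definition alpha_complete ::
  "('m::topological_space, 'e::euclidean_space) chart set \<Rightarrow> ('m \<Rightarrow> 'e \<Rightarrow> real) \<Rightarrow>
   ('m \<Rightarrow> 'e set) \<Rightarrow> bool" where
  "alpha_complete A \<alpha> F \<longleftrightarrow>
     (\<forall>U f\<^sub>1 f\<^sub>2 h. first_integral A F U f\<^sub>1 \<longrightarrow> first_integral A F U f\<^sub>2 \<longrightarrow>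
        jacobi_bracket A \<alpha> U f\<^sub>1 f\<^sub>2 h \<longrightarrow> first_integral A F U h)"

end

theory Submission
  imports Defs
begin

text \<open>Let \<open>f\<^sub>1\<close>, \<open>f\<^sub>2\<close> be first integrals with contact fields \<open>X\<^sub>1\<close>, \<open>X\<^sub>2\<close>. Since the Reeb field is tangent to
  the fibres, \<open>X\<^sub>i\<close> preserves \<open>\<alpha>\<close> itself, so that \<open>df\<^sub>i = - d\<alpha>(X\<^sub>i, -)\<close> and \<open>[f\<^sub>1, f\<^sub>2] = d\<alpha>(X\<^sub>1, X\<^sub>2)\<close>. Hence
  the bracket at \<open>x\<close> depends only on the covectors \<open>l\<^sub>i\<close> on the base with \<open>df\<^sub>i = l\<^sub>i \<circ> d\<pi>\<close>, and these are
  locally constant along a fibre. For fixed \<open>l\<^sub>i\<close> the value \<open>d\<alpha>(v\<^sub>1, v\<^sub>2)\<close>, where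
  \<open>d\<alpha>(v\<^sub>i, -) = - l\<^sub>i \<circ> d\<pi>\<close>, makes sense on the whole fibre and is invariant along integral curves of
  \<open>\<X>\<close>, which preserve \<open>\<alpha>\<close> and \<open>\<pi>\<close>. As the orbits of \<open>\<X>\<close> are the components of the fibres, it is constant
  on these components. This transport around the orbits avoids showing that \<open>\<X>\<close> spans \<open>ker \<pi>\<^sub>*\<close>. That
  the fields in \<open>\<X>\<close> are tangent to the fibres needs the existence of their integral curves.\<close>

section \<open>Calculus of smooth functions\<close>

text \<open>That \<open>X_i\<close> preserves \<alpha> comes from L_X \<alpha> = df + d\<alpha>(X,
  -): preservation of ker \<alpha> makes it vanish on ker \<alpha>, and it vanishes on the Reeb
  field Z because df(Z) = 0 and d\<alpha>(-, Z) = 0. In [f_1, f_2] = X_1(f_2) - X_2(f_1) -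
  d\<alpha>(X_1, X_2) each of the first two summands contributes d\<alpha>(X_1, X_2), so one copy
  remains. The pairing is extended to whole fibres because the functions live only on an open set U,
  while the arcs of orbits that join two nearby points of a fibre may leave U; there only the
  covectors l_i survive. The vectors v_i exist since l_i o d\<pi> kills Z, which is tangent to the
  fibres, and their ambiguity lies in ker d\<alpha>, which the pairing does not see. The orbit
  condition speaks of sets, not of tangent spaces. Constancy is therefore used on a curve in the
  fibre with prescribed velocity v, built from the submersion alone: the bracket is constant along
  it, so its differential kills v.\<close>

lemma Ck_on_cong:
  assumes "open S" "\<And>x. x \<in> S \<Longrightarrow> f x = g x" "Ck_on k S f"
  shows "Ck_on k S g"
  using assms(2,3)
proof (induction k arbitrary: f g)
  case 0
  then show ?case by (metis (no_types, lifting) Ck_on.simps(1) continuous_on_cong)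
next
  case (Suc k)
  have "g differentiable (at x)" if "x \<in> S" for x
    using Suc.prems that has_derivative_transform_within_open[OF _ \<open>open S\<close> that, of f _ UNIV g]
    by (metis Ck_on.simps(2) differentiable_def)
  moreover have "Ck_on k S (\<lambda>x. frechet_derivative g (at x) v)" for v
  proof (rule Suc.IH)
    show "Ck_on k S (\<lambda>x. frechet_derivative f (at x) v)" using Suc.prems by simp
    fix x assume "x \<in> S"
    then show "frechet_derivative f (at x) v = frechet_derivative g (at x) v"
      using frechet_derivative_transform_within_open[OF _ \<open>open S\<close>, of f x g] Suc.prems by simp
  qed
  ultimately show ?case by simp
qed

lemma Ck_on_SucD: "Ck_on (Suc k) S f \<Longrightarrow> Ck_on k S f"
proof (induction k arbitrary: f)
  case 0
  then show ?case
    by (simp add: continuous_at_imp_continuous_on differentiable_imp_continuous_within)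
qed auto

lemma Ck_on_subset: "Ck_on k T f \<Longrightarrow> S \<subseteq> T \<Longrightarrow> Ck_on k S f"
  by (induction k arbitrary: f) (auto intro: continuous_on_subset)

lemma Ck_on_const: "Ck_on k S (\<lambda>x. c)"
  by (induction k arbitrary: c) auto

lemma Ck_on_add:
  assumes "open S" "Ck_on k S f" "Ck_on k S g"
  shows "Ck_on k S (\<lambda>x. f x + g x)"
  using assms(2,3)
proof (induction k arbitrary: f g)
  case 0
  then show ?case by (auto intro: continuous_intros)
next
  case (Suc k)
  have D: "((\<lambda>x. f x + g x) has_derivative
      (\<lambda>v. frechet_derivative f (at x) v + frechet_derivative g (at x) v)) (at x)" if "x \<in> S" for x
    using Suc.prems that by (auto intro!: has_derivative_add simp: frechet_derivative_works)
  have "Ck_on k S (\<lambda>x. frechet_derivative (\<lambda>x. f x + g x) (at x) v)" for v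
  proof (rule Ck_on_cong[OF \<open>open S\<close>])
    show "Ck_on k S (\<lambda>x. frechet_derivative f (at x) v + frechet_derivative g (at x) v)"
      using Suc.prems by (intro Suc.IH) auto
  qed (simp add: frechet_derivative_at[OF D, symmetric])
  then show ?case using D by (auto simp: differentiable_def)
qed

lemma Ck_on_scaleR:
  fixes g :: "'a::real_normed_vector \<Rightarrow> real"
  assumes "open S" "Ck_on k S g" "Ck_on k S f"
  shows "Ck_on k S (\<lambda>x. g x *\<^sub>R f x)"
  using assms(2,3)
proof (induction k arbitrary: f g)
  case 0
  then show ?case by (auto intro: continuous_intros)
next
  case (Suc k)
  have D: "((\<lambda>x. g x *\<^sub>R f x) has_derivative
      (\<lambda>v. g x *\<^sub>R frechet_derivative f (at x) v + frechet_derivative g (at x) v *\<^sub>R f x)) (at x)" if "x \<in> S" for x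
    using Suc.prems that by (auto intro!: has_derivative_scaleR simp: frechet_derivative_works)
  have "Ck_on k S (\<lambda>x. frechet_derivative (\<lambda>x. g x *\<^sub>R f x) (at x) v)" for v
  proof (rule Ck_on_cong[OF \<open>open S\<close>])
    show "Ck_on k S (\<lambda>x. g x *\<^sub>R frechet_derivative f (at x) v + frechet_derivative g (at x) v *\<^sub>R f x)"
      using Suc.prems Ck_on_SucD[OF Suc.prems(1)] Ck_on_SucD[OF Suc.prems(2)]
      by (intro Ck_on_add \<open>open S\<close> Suc.IH) auto
  qed (simp add: frechet_derivative_at[OF D, symmetric])
  then show ?case using D by (auto simp: differentiable_def)
qed

lemma Ck_on_sum:
  assumes "open S" "finite I" "\<And>i. i \<in> I \<Longrightarrow> Ck_on k S (f i)"
  shows "Ck_on k S (\<lambda>x. \<Sum>i\<in>I. f i x)"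
  using assms(2,3) by (induction I rule: finite_induct) (auto intro: Ck_on_const Ck_on_add[OF \<open>open S\<close>])

lemma Ck_on_bounded_linear:
  assumes L: "bounded_linear L" and "open S" and f: "Ck_on k S f"
  shows "Ck_on k S (\<lambda>x. L (f x))"
  using f
proof (induction k arbitrary: f)
  case 0
  then show ?case by (auto intro: bounded_linear.continuous_on[OF L])
next
  case (Suc k)
  have D: "((\<lambda>x. L (f x)) has_derivative (\<lambda>v. L (frechet_derivative f (at x) v))) (at x)" if "x \<in> S" for x
    using Suc.prems that by (auto intro!: bounded_linear.has_derivative[OF L] simp: frechet_derivative_works)
  have "Ck_on k S (\<lambda>x. frechet_derivative (\<lambda>x. L (f x)) (at x) v)" for v
  proof (rule Ck_on_cong[OF \<open>open S\<close>])
    show "Ck_on k S (\<lambda>x. L (frechet_derivative f (at x) v))"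
      using Suc.prems by (intro Suc.IH) auto
  qed (simp add: frechet_derivative_at[OF D, symmetric])
  then show ?case using D by (auto simp: differentiable_def)
qed

lemma linear_basis_expansion:
  fixes L :: "'a::euclidean_space \<Rightarrow> 'b::real_vector"
  assumes "linear L"
  shows "L w = (\<Sum>b\<in>Basis. (w \<bullet> b) *\<^sub>R L b)"
proof -
  have "L (\<Sum>b\<in>Basis. (w \<bullet> b) *\<^sub>R b) = (\<Sum>b\<in>Basis. (w \<bullet> b) *\<^sub>R L b)"
    by (simp add: linear_sum[OF assms] linear_cmul[OF assms])
  then show ?thesis by (simp add: euclidean_representation)
qed

text \<open>\<open>Ck_on\<close> tests derivatives only against fixed vectors, but in Dg(f x)(Df(x)
  v) the inner vector moves with x. Expanding it over the basis leaves scalar coefficients times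
  derivatives of g at fixed vectors, to which the induction hypothesis and the product rule
  apply.\<close>

lemma Ck_on_compose:
  fixes f :: "'a::real_normed_vector \<Rightarrow> 'b::euclidean_space"
  assumes "open S" "open T" "f ` S \<subseteq> T" "Ck_on k T g" "Ck_on k S f"
  shows "Ck_on k S (\<lambda>x. g (f x))"
  using assms(4,5)
proof (induction k arbitrary: g)
  case 0
  then show ?case
    using continuous_on_compose2[of T g S f] assms(3) by (auto)
next
  case (Suc k)
  have D: "((\<lambda>x. g (f x)) has_derivative
      (\<lambda>v. frechet_derivative g (at (f x)) (frechet_derivative f (at x) v))) (at x)" if "x \<in> S" for x
    using Suc.prems that assms(3) has_derivative_compose[of f "frechet_derivative f (at x)" x UNIV g "frechet_derivative g (at (f x))"]
    by (auto simp: frechet_derivative_works)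
  have lin: "linear (frechet_derivative g (at (f x)))" if "x \<in> S" for x
    using Suc.prems that assms(3) by (auto intro!: linear_frechet_derivative)
  have "Ck_on k S (\<lambda>x. frechet_derivative (\<lambda>x. g (f x)) (at x) v)" for v
  proof (rule Ck_on_cong[OF \<open>open S\<close>])
    show "Ck_on k S (\<lambda>x. \<Sum>b\<in>Basis. (frechet_derivative f (at x) v \<bullet> b) *\<^sub>R frechet_derivative g (at (f x)) b)"
      using Suc.prems Ck_on_SucD[OF Suc.prems(2)]
      by (intro Ck_on_sum Ck_on_scaleR \<open>open S\<close> Suc.IH Ck_on_bounded_linear[OF bounded_linear_inner_left]) auto
    fix x assume "x \<in> S"
    show "(\<Sum>b\<in>Basis. (frechet_derivative f (at x) v \<bullet> b) *\<^sub>R frechet_derivative g (at (f x)) b) =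
        frechet_derivative (\<lambda>x. g (f x)) (at x) v"
      using frechet_derivative_at[OF D[OF \<open>x \<in> S\<close>]] linear_basis_expansion[OF lin[OF \<open>x \<in> S\<close>]] by metis
  qed
  then show ?case using D by (auto simp: differentiable_def)
qed

lemma smooth_on_cong:
  "smooth_on S f \<Longrightarrow> open S \<Longrightarrow> (\<And>x. x \<in> S \<Longrightarrow> f x = g x) \<Longrightarrow> smooth_on S g"
  unfolding smooth_on_def by (metis Ck_on_cong)

lemma smooth_on_subset: "smooth_on T f \<Longrightarrow> S \<subseteq> T \<Longrightarrow> smooth_on S f"
  unfolding smooth_on_def using Ck_on_subset by blast

lemma smooth_on_compose:
  fixes f :: "'a::real_normed_vector \<Rightarrow> 'b::euclidean_space"
  assumes "smooth_on T g" "smooth_on S f" "open S" "open T" "f ` S \<subseteq> T"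
  shows "smooth_on S (\<lambda>x. g (f x))"
  using assms Ck_on_compose unfolding smooth_on_def by blast

lemma smooth_on_continuous_on: "smooth_on S f \<Longrightarrow> continuous_on S f"
  unfolding smooth_on_def by (metis Ck_on.simps(1))

lemma smooth_on_differentiable: "smooth_on S f \<Longrightarrow> x \<in> S \<Longrightarrow> f differentiable (at x)"
  unfolding smooth_on_def by (metis Ck_on.simps(2))

lemma smooth_on_has_derivative:
  "smooth_on S f \<Longrightarrow> x \<in> S \<Longrightarrow> (f has_derivative frechet_derivative f (at x)) (at x)"
  using smooth_on_differentiable frechet_derivative_works by blast

lemma smooth_on_linear_derivative:
  "smooth_on S f \<Longrightarrow> x \<in> S \<Longrightarrow> linear (frechet_derivative f (at x))"
  using smooth_on_differentiable linear_frechet_derivative by blast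

lemma smooth_on_derivative: "smooth_on S f \<Longrightarrow> smooth_on S (\<lambda>x. frechet_derivative f (at x) v)"
  unfolding smooth_on_def by (metis Ck_on.simps(2))

lemma smooth_on_linear_field:
  fixes A :: "'a::real_normed_vector \<Rightarrow> 'b::euclidean_space \<Rightarrow> 'c::real_normed_vector"
  assumes "open S" "\<And>x. x \<in> S \<Longrightarrow> linear (A x)" "\<And>v. smooth_on S (\<lambda>x. A x v)" "smooth_on S w"
  shows "smooth_on S (\<lambda>x. A x (w x))"
proof (rule smooth_on_cong[OF _ \<open>open S\<close>])
  show "smooth_on S (\<lambda>x. \<Sum>b\<in>Basis. (w x \<bullet> b) *\<^sub>R A x b)"
    using assms unfolding smooth_on_def
    by (auto intro!: Ck_on_sum Ck_on_scaleR Ck_on_bounded_linear[OF bounded_linear_inner_left])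
qed (use linear_basis_expansion[OF assms(2)] in metis)

text \<open>A product rule for an operator field known only through its values at fixed vectors; no
  derivative in a space of operators is formed. The first summand freezes the vector at
  \<open>w x\<close>, which is how exterior and Lie derivatives look in coordinates.\<close>

lemma has_derivative_linear_field:
  fixes A :: "'a::real_normed_vector \<Rightarrow> 'b::euclidean_space \<Rightarrow> 'c::real_normed_vector"
  assumes "open S" "x \<in> S" and lin: "\<And>x. x \<in> S \<Longrightarrow> linear (A x)"
    and A: "\<And>v. (\<lambda>z. A z v) differentiable (at x)"
    and w: "(w has_derivative w') (at x)"
  shows "((\<lambda>z. A z (w z)) has_derivative
    (\<lambda>u. frechet_derivative (\<lambda>z. A z (w x)) (at x) u + A x (w' u))) (at x)"
proof -
  note DA = A[THEN iffD1[OF frechet_derivative_works]]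
  have D1: "((\<lambda>z. \<Sum>b\<in>Basis. (w z \<bullet> b) *\<^sub>R A z b) has_derivative
     (\<lambda>u. \<Sum>b\<in>Basis. (w x \<bullet> b) *\<^sub>R frechet_derivative (\<lambda>z. A z b) (at x) u + (w' u \<bullet> b) *\<^sub>R A x b)) (at x)"
    by (intro has_derivative_sum has_derivative_scaleR has_derivative_inner_left w DA)
  have D2: "((\<lambda>z. \<Sum>b\<in>Basis. (w x \<bullet> b) *\<^sub>R A z b) has_derivative
     (\<lambda>u. \<Sum>b\<in>Basis. (w x \<bullet> b) *\<^sub>R frechet_derivative (\<lambda>z. A z b) (at x) u)) (at x)"
    by (intro has_derivative_sum has_derivative_scaleR_right DA)
  have "((\<lambda>z. A z (w x)) has_derivative
     (\<lambda>u. \<Sum>b\<in>Basis. (w x \<bullet> b) *\<^sub>R frechet_derivative (\<lambda>z. A z b) (at x) u)) (at x)"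
    by (rule has_derivative_transform_within_open[OF D2 \<open>open S\<close> \<open>x \<in> S\<close>])
      (use linear_basis_expansion[OF lin] in metis)
  from frechet_derivative_at[OF this]
  have eq: "(\<lambda>u. \<Sum>b\<in>Basis. (w x \<bullet> b) *\<^sub>R frechet_derivative (\<lambda>z. A z b) (at x) u + (w' u \<bullet> b) *\<^sub>R A x b)
     = (\<lambda>u. frechet_derivative (\<lambda>z. A z (w x)) (at x) u + A x (w' u))"
    by (simp add: sum.distrib linear_basis_expansion[OF lin[OF \<open>x \<in> S\<close>], symmetric] fun_eq_iff)
  show ?thesis
    by (rule has_derivative_transform_within_open[OF D1[unfolded eq] \<open>open S\<close> \<open>x \<in> S\<close>])
      (use linear_basis_expansion[OF lin] in metis)
qed

section \<open>Symmetry of second derivatives\<close>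

text \<open>Two applications of the mean value theorem: to s -> f(x + su + hv) - f(x + su), and
  then, at the s so found, to the u-derivative of f along v. The bound on \<open>h\<close> keeps all
  points in the ball.\<close>

lemma second_difference_mean_value:
  fixes f :: "'a::real_normed_vector \<Rightarrow> real"
  assumes f: "smooth_on S f" and S: "ball x r \<subseteq> S" and h: "0 < h" "h * (norm u + norm v) < r"
  shows "\<exists>p\<in>ball x r. f (x + h *\<^sub>R u + h *\<^sub>R v) - f (x + h *\<^sub>R u) - f (x + h *\<^sub>R v) + f x =
      h\<^sup>2 * frechet_derivative (\<lambda>z. frechet_derivative f (at z) u) (at p) v"
proof -
  have inb: "x + s *\<^sub>R u + t *\<^sub>R v \<in> ball x r" if "0 \<le> s" "s \<le> h" "0 \<le> t" "t \<le> h" for s t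
  proof -
    have "norm (s *\<^sub>R u + t *\<^sub>R v) \<le> s * norm u + t * norm v"
      by (rule order_trans[OF norm_triangle_ineq]) (use that in auto)
    also have "\<dots> \<le> h * norm u + h * norm v"
      using that by (intro add_mono mult_right_mono) auto
    finally have "norm (s *\<^sub>R u + t *\<^sub>R v) < r" using h by (simp add: algebra_simps)
    then show ?thesis by (metis add.assoc dist_add_cancel dist_0_norm add.right_neutral mem_ball)
  qed
  have der: "(f has_derivative frechet_derivative f (at z)) (at z)" if "z \<in> ball x r" for z
    using smooth_on_has_derivative[OF f] that S by blast
  have der2: "((\<lambda>z. frechet_derivative f (at z) u) has_derivative
     frechet_derivative (\<lambda>z. frechet_derivative f (at z) u) (at z)) (at z)" if "z \<in> ball x r" for z
    using smooth_on_has_derivative[OF smooth_on_derivative[OF f]] that S by blast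
  \<comment> \<open>The vanishing summand \<open>0 *\<^sub>R v\<close> gives both terms the shape x
    + su + tv, so that \<open>inb\<close> covers them and the difference becomes
    \<open>?k h - ?k 0\<close>.\<close>
  let ?g = "\<lambda>s. f (x + s *\<^sub>R u + h *\<^sub>R v) - f (x + s *\<^sub>R u + 0 *\<^sub>R v)"
  have "\<exists>s\<in>{0<..<h}. ?g h - ?g 0 =
     (\<lambda>d. frechet_derivative f (at (x + s *\<^sub>R u + h *\<^sub>R v)) (d *\<^sub>R u) - frechet_derivative f (at (x + s *\<^sub>R u + 0 *\<^sub>R v)) (d *\<^sub>R u)) (h - 0)"
  proof (rule mvt_simple[OF h(1)])
    fix s assume s: "0 \<le> s" "s \<le> h"
    show "(?g has_derivative (\<lambda>d. frechet_derivative f (at (x + s *\<^sub>R u + h *\<^sub>R v)) (d *\<^sub>R u) - frechet_derivative f (at (x + s *\<^sub>R u + 0 *\<^sub>R v)) (d *\<^sub>R u))) (at s within {0..h})"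
      using h s by (intro has_derivative_diff
          has_derivative_compose[where f = "\<lambda>s. x + s *\<^sub>R u + h *\<^sub>R v" and f' = "\<lambda>d. d *\<^sub>R u", OF _ der[OF inb]]
          has_derivative_compose[where f = "\<lambda>s. x + s *\<^sub>R u + 0 *\<^sub>R v" and f' = "\<lambda>d. d *\<^sub>R u", OF _ der[OF inb]])
        (auto intro!: derivative_eq_intros)
  qed
  then obtain s where s: "0 < s" "s < h" and gs: "?g h - ?g 0 =
     frechet_derivative f (at (x + s *\<^sub>R u + h *\<^sub>R v)) (h *\<^sub>R u) - frechet_derivative f (at (x + s *\<^sub>R u + 0 *\<^sub>R v)) (h *\<^sub>R u)"
    by auto
  have hom: "frechet_derivative f (at z) (h *\<^sub>R u) = h * frechet_derivative f (at z) u" if "z \<in> ball x r" for z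
    using linear_cmul[OF has_derivative_linear[OF der[OF that]]] by simp
  let ?k = "\<lambda>t. frechet_derivative f (at (x + s *\<^sub>R u + t *\<^sub>R v)) u"
  have "\<exists>t\<in>{0<..<h}. ?k h - ?k 0 =
     (\<lambda>d. frechet_derivative (\<lambda>z. frechet_derivative f (at z) u) (at (x + s *\<^sub>R u + t *\<^sub>R v)) (d *\<^sub>R v)) (h - 0)"
  proof (rule mvt_simple[OF h(1)])
    fix t assume t: "0 \<le> t" "t \<le> h"
    show "(?k has_derivative (\<lambda>d. frechet_derivative (\<lambda>z. frechet_derivative f (at z) u) (at (x + s *\<^sub>R u + t *\<^sub>R v)) (d *\<^sub>R v))) (at t within {0..h})"
      using s t by (intro has_derivative_compose[where f = "\<lambda>t. x + s *\<^sub>R u + t *\<^sub>R v" and f' = "\<lambda>d. d *\<^sub>R v", OF _ der2[OF inb]])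
        (auto intro!: derivative_eq_intros)
  qed
  then obtain t where t: "0 < t" "t < h" and kt: "?k h - ?k 0 =
     frechet_derivative (\<lambda>z. frechet_derivative f (at z) u) (at (x + s *\<^sub>R u + t *\<^sub>R v)) (h *\<^sub>R v)"
    by auto
  let ?p = "x + s *\<^sub>R u + t *\<^sub>R v"
  have p: "?p \<in> ball x r" using s t by (intro inb) auto
  have "?g h - ?g 0 = h * (?k h - ?k 0)"
    unfolding gs using s h hom[OF inb[of s h]] hom[OF inb[of s 0]] by (simp only: right_diff_distrib)
  also have "\<dots> = h * (h * frechet_derivative (\<lambda>z. frechet_derivative f (at z) u) (at ?p) v)"
    unfolding kt using linear_cmul[OF has_derivative_linear[OF der2[OF p]]] by simp
  finally show ?thesis using p by (intro bexI[of _ ?p]) (auto simp: power2_eq_square)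
qed

text \<open>The second difference is symmetric in u and v, so it is h^2 times one mixed derivative
  at some p and h^2 times the other at some q. By continuity both are within e of their values at x;
  with e half of the supposed gap this is a contradiction.\<close>

lemma second_derivative_symmetric_real:
  fixes f :: "'a::real_normed_vector \<Rightarrow> real"
  assumes "open S" "smooth_on S f" "x \<in> S"
  shows "frechet_derivative (\<lambda>z. frechet_derivative f (at z) u) (at x) v =
    frechet_derivative (\<lambda>z. frechet_derivative f (at z) v) (at x) u"
proof (rule ccontr)
  let ?a = "\<lambda>x. frechet_derivative (\<lambda>z. frechet_derivative f (at z) u) (at x) v"
  let ?b = "\<lambda>x. frechet_derivative (\<lambda>z. frechet_derivative f (at z) v) (at x) u"
  assume ne: "?a x \<noteq> ?b x"
  define e where "e = \<bar>?a x - ?b x\<bar> / 2"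
  have "e > 0" using ne by (simp add: e_def)
  have "continuous_on S ?a" "continuous_on S ?b"
    by (intro smooth_on_continuous_on smooth_on_derivative assms)+
  then have "isCont ?a x" "isCont ?b x"
    using assms by (auto simp: continuous_on_eq_continuous_at)
  then obtain r1 r2 where r: "r1 > 0" "r2 > 0" "\<And>z. dist z x < r1 \<Longrightarrow> dist (?a z) (?a x) < e"
    "\<And>z. dist z x < r2 \<Longrightarrow> dist (?b z) (?b x) < e"
    using \<open>e > 0\<close> unfolding continuous_at_eps_delta by metis
  obtain r3 where r3: "r3 > 0" "ball x r3 \<subseteq> S" using assms openE by blast
  define r where "r = min (min r1 r2) r3"
  have "r > 0" "ball x r \<subseteq> S" using r r3 by (auto simp: r_def)
  \<comment> \<open>The 1 keeps the denominator positive when u = v = 0; the 2 makes h(|u| + |v|)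
    strictly smaller than r.\<close>
  define h where "h = r / (2 * (norm u + norm v + 1))"
  have pos: "norm u + norm v + 1 > 0" by (smt (verit) norm_ge_zero)
  have "h > 0" using \<open>r > 0\<close> pos by (simp add: h_def)
  moreover have "h * (norm u + norm v) < r"
  proof -
    have "h * (norm u + norm v) \<le> h * (norm u + norm v + 1)" using \<open>h > 0\<close> by simp
    also have "\<dots> = r / 2" using pos by (simp add: h_def field_simps)
    finally show ?thesis using \<open>r > 0\<close> by simp
  qed
  ultimately obtain p q where pq: "p \<in> ball x r" "q \<in> ball x r"
    "f (x + h *\<^sub>R u + h *\<^sub>R v) - f (x + h *\<^sub>R u) - f (x + h *\<^sub>R v) + f x = h\<^sup>2 * ?a p"
    "f (x + h *\<^sub>R v + h *\<^sub>R u) - f (x + h *\<^sub>R v) - f (x + h *\<^sub>R u) + f x = h\<^sup>2 * ?b q"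
    using second_difference_mean_value[OF assms(2) \<open>ball x r \<subseteq> S\<close>, of h u v]
      second_difference_mean_value[OF assms(2) \<open>ball x r \<subseteq> S\<close>, of h v u] by (auto simp: add.commute)
  have "x + h *\<^sub>R v + h *\<^sub>R u = x + h *\<^sub>R u + h *\<^sub>R v" by simp
  then have "h\<^sup>2 * ?a p = h\<^sup>2 * ?b q" using pq(3,4) by (smt (verit))
  then have "?a p = ?b q" using \<open>h > 0\<close> by simp
  moreover have "dist (?a p) (?a x) < e" "dist (?b q) (?b x) < e"
    using r pq by (auto simp: r_def dist_commute)
  ultimately show False unfolding e_def dist_real_def by argo
qed

lemma second_derivative_symmetric:
  fixes f :: "'a::real_normed_vector \<Rightarrow> 'b::euclidean_space"
  assumes "open S" "smooth_on S f" "x \<in> S"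
  shows "frechet_derivative (\<lambda>z. frechet_derivative f (at z) u) (at x) v =
    frechet_derivative (\<lambda>z. frechet_derivative f (at z) v) (at x) u"
proof (rule euclidean_eqI)
  fix b :: 'b assume "b \<in> Basis"
  let ?g = "\<lambda>z. f z \<bullet> b"
  have g: "smooth_on S ?g"
    using assms unfolding smooth_on_def by (auto intro: Ck_on_bounded_linear[OF bounded_linear_inner_left])
  have 1: "frechet_derivative ?g (at z) w = frechet_derivative f (at z) w \<bullet> b" if "z \<in> S" for z w
    using frechet_derivative_at[OF has_derivative_inner_left[OF smooth_on_has_derivative[OF assms(2) that], of b]] by metis
  have 2: "frechet_derivative (\<lambda>z. frechet_derivative ?g (at z) u) (at x) v =
     frechet_derivative (\<lambda>z. frechet_derivative f (at z) u) (at x) v \<bullet> b" for u v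
  proof -
    have "((\<lambda>z. frechet_derivative ?g (at z) u) has_derivative
       (\<lambda>v. frechet_derivative (\<lambda>z. frechet_derivative f (at z) u) (at x) v \<bullet> b)) (at x)"
      by (rule has_derivative_transform_within_open[OF has_derivative_inner_left[OF
              smooth_on_has_derivative[OF smooth_on_derivative[OF assms(2)] assms(3)]] assms(1,3)])
         (simp add: 1)
    from frechet_derivative_at[OF this] show ?thesis by metis
  qed
  show "frechet_derivative (\<lambda>z. frechet_derivative f (at z) u) (at x) v \<bullet> b =
    frechet_derivative (\<lambda>z. frechet_derivative f (at z) v) (at x) u \<bullet> b"
    using second_derivative_symmetric_real[OF assms(1) g assms(3)] unfolding 2 .
qed

section \<open>Integral curves and submersions\<close>

lemma has_vector_derivative_bound:
  fixes G :: "real \<Rightarrow> 'a::real_normed_vector"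
  assumes "\<And>t. t \<in> {a..b} \<Longrightarrow> (G has_vector_derivative g t) (at t within {a..b})"
    and "\<And>t. t \<in> {a..b} \<Longrightarrow> norm (g t) \<le> C" and "s \<in> {a..b}" "t \<in> {a..b}"
  shows "norm (G t - G s) \<le> C * \<bar>t - s\<bar>"
proof -
  have "norm (G t - G s) \<le> C * norm (t - s)"
  proof (rule differentiable_bound[of "{a..b}" G "\<lambda>t d. d *\<^sub>R g t"])
    show "onorm (\<lambda>d. d *\<^sub>R g t) \<le> C" if "t \<in> {a..b}" for t
    proof (rule onorm_le)
      fix d show "norm (d *\<^sub>R g t) \<le> C * norm d"
        using mult_right_mono[OF assms(2)[OF that], of "norm d"] by (simp add: mult.commute)
    qed
  qed (use assms in \<open>auto simp: has_vector_derivative_def\<close>)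
  then show ?thesis by simp
qed

text \<open>The sum of the norms of the partial derivatives is continuous, hence bounded on the
  compact ball, and it dominates the operator norm; convexity of the ball then gives the Lipschitz
  bound.\<close>

lemma smooth_on_lipschitz_cball:
  fixes Y :: "'a::euclidean_space \<Rightarrow> 'b::real_normed_vector"
  assumes "smooth_on S Y" "cball y r \<subseteq> S"
  obtains L where "L > 0"
    "\<And>u v. u \<in> cball y r \<Longrightarrow> v \<in> cball y r \<Longrightarrow> norm (Y u - Y v) \<le> L * norm (u - v)"
proof -
  let ?N = "\<lambda>z. \<Sum>b\<in>Basis. norm (frechet_derivative Y (at z) b)"
  have "continuous_on (cball y r) ?N"
    using assms by (intro continuous_intros smooth_on_continuous_on smooth_on_derivative)
      (auto intro: smooth_on_subset)
  then have "bounded (?N ` cball y r)"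
    by (intro compact_imp_bounded compact_continuous_image compact_cball)
  then obtain B where B: "B > 0" "\<And>z. z \<in> cball y r \<Longrightarrow> norm (?N z) \<le> B"
    unfolding bounded_pos by auto
  have "norm (Y u - Y v) \<le> B * norm (u - v)" if "u \<in> cball y r" "v \<in> cball y r" for u v
  proof (rule differentiable_bound[OF convex_cball _ _ that])
    fix z assume z: "z \<in> cball y r"
    then have D: "(Y has_derivative frechet_derivative Y (at z)) (at z)"
      using smooth_on_has_derivative assms by blast
    then show "(Y has_derivative frechet_derivative Y (at z)) (at z within cball y r)"
      by (rule has_derivative_at_withinI)
    show "onorm (frechet_derivative Y (at z)) \<le> B"
    proof (rule onorm_le)
      fix w
      have "norm (frechet_derivative Y (at z) w) =
          norm (\<Sum>b\<in>Basis. (w \<bullet> b) *\<^sub>R frechet_derivative Y (at z) b)"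
        using linear_basis_expansion[OF has_derivative_linear[OF D], of w] by simp
      also have "\<dots> \<le> (\<Sum>b\<in>Basis. norm w * norm (frechet_derivative Y (at z) b))"
        by (rule sum_norm_le) (auto intro!: mult_right_mono Basis_le_norm)
      also have "\<dots> \<le> B * norm w"
        using B(2)[OF z] mult_left_mono[of "?N z" B "norm w"]
        by (simp add: sum_distrib_left sum_nonneg mult.commute)
      finally show "norm (frechet_derivative Y (at z) w) \<le> B * norm w" .
    qed
  qed
  then show thesis using that B(1) by blast
qed

text \<open>Picard iteration as a contraction on bounded continuous functions of the whole real line
  with values in a closed ball. The operator reads its integral at the time clamped to
  [-\<epsilon>, \<epsilon>], so the complete space of bounded continuous functions can be used;
  inside the open interval the clamp is the identity and the fixed point solves the
  equation.\<close>

lemma picard_local_existence: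
  fixes Y :: "'a::euclidean_space \<Rightarrow> 'a"
  assumes "open S" "smooth_on S Y" "y \<in> S"
  obtains \<epsilon> u where "\<epsilon> > 0" "u 0 = y"
    "\<And>t. t \<in> {-\<epsilon><..<\<epsilon>} \<Longrightarrow> u t \<in> S \<and> (u has_vector_derivative Y (u t)) (at t)"
proof -
  obtain r where r: "r > 0" "cball y r \<subseteq> S" using assms open_contains_cball by blast
  obtain L where L: "L > 0"
    "\<And>u v. u \<in> cball y r \<Longrightarrow> v \<in> cball y r \<Longrightarrow> norm (Y u - Y v) \<le> L * norm (u - v)"
    using smooth_on_lipschitz_cball[OF assms(2) r(2)] by blast
  have contY: "continuous_on (cball y r) Y"
    using assms r smooth_on_continuous_on continuous_on_subset by blast
  then have "bounded (Y ` cball y r)"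
    by (intro compact_imp_bounded compact_continuous_image compact_cball)
  then obtain K where K: "K > 0" "\<And>z. z \<in> cball y r \<Longrightarrow> norm (Y z) \<le> K"
    unfolding bounded_pos by auto
  \<comment> \<open>The bound r/K keeps the iterates in the ball, where |Y| \<le> K; the bound
    1/(2L) makes the operator contract by the factor 1/2.\<close>
  define \<epsilon> where "\<epsilon> = min (r / K) (1 / (2 * L))"
  have eps: "\<epsilon> > 0" "K * \<epsilon> \<le> r" "L * \<epsilon> \<le> 1/2"
    using r L(1) K(1) by (auto simp: \<epsilon>_def min_def field_simps)
  define C where "C = (\<lambda>t. max (-\<epsilon>) (min \<epsilon> t))"
  have C: "C t \<in> {-\<epsilon>..\<epsilon>}" for t using eps by (auto simp: C_def)
  have contC: "continuous_on UNIV C" unfolding C_def by (intro continuous_intros)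
  \<comment> \<open>The oriented integral from 0 to \<tau>, written as a difference of integrals
    from -\<epsilon> because the integral over \<open>{0..\<tau>}\<close> would be 0 for negative
    \<tau>.\<close>
  define G where "G = (\<lambda>(f :: real \<Rightarrow>\<^sub>C 'a) \<tau>. integral {-\<epsilon>..\<tau>} (\<lambda>t. Y (f t)) - integral {-\<epsilon>..0} (\<lambda>t. Y (f t)))"
  define X where "X = {f :: real \<Rightarrow>\<^sub>C 'a. \<forall>t. f t \<in> cball y r}"
  have G: "(G f has_vector_derivative Y (f t)) (at t within {-\<epsilon>..\<epsilon>})"
    if "f \<in> X" "t \<in> {-\<epsilon>..\<epsilon>}" for f t
  proof -
    have "continuous_on {-\<epsilon>..\<epsilon>} (\<lambda>t. Y (f t))"
      using that by (intro continuous_on_compose2[OF contY]) (auto simp: X_def intro: continuous_on_apply_bcontfun)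
    from integral_has_vector_derivative[OF this that(2)]
    show ?thesis unfolding G_def by (auto intro!: derivative_eq_intros)
  qed
  have G0: "G f 0 = 0" for f by (simp add: G_def)
  have Gb: "norm (G f \<tau>) \<le> r" if "f \<in> X" "\<tau> \<in> {-\<epsilon>..\<epsilon>}" for f \<tau>
  proof -
    have "norm (G f \<tau> - G f 0) \<le> K * \<bar>\<tau> - 0\<bar>"
      by (rule has_vector_derivative_bound[OF G[OF that(1)]]) (use that K eps in \<open>auto simp: X_def\<close>)
    also have "\<dots> \<le> K * \<epsilon>" using that K by (intro mult_left_mono) auto
    finally show ?thesis using eps G0 by simp
  qed
  define T where "T = (\<lambda>f. Bcontfun (\<lambda>t. y + G f (C t)))"
  have T: "apply_bcontfun (T f) = (\<lambda>t. y + G f (C t))" if "f \<in> X" for f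
    unfolding T_def
  proof (rule Bcontfun_inverse)
    have "continuous_on {-\<epsilon>..\<epsilon>} (G f)"
      using G[OF that] has_vector_derivative_continuous continuous_on_eq_continuous_within by blast
    then have "continuous_on UNIV (\<lambda>t. y + G f (C t))"
      by (intro continuous_intros continuous_on_compose2[OF _ contC]) (use C in auto)
    moreover have "range (\<lambda>t. y + G f (C t)) \<subseteq> cball y r"
      using Gb[OF that C] by (auto simp: dist_norm)
    ultimately show "(\<lambda>t. y + G f (C t)) \<in> bcontfun"
      using bounded_subset[OF bounded_cball] by (auto simp: bcontfun_def)
  qed
  have "\<exists>!f\<in>X. T f = f"
  proof (rule Banach_fix[of X "1/2" T])
    have "closed X"
    proof -
      have "X = (PiC UNIV (\<lambda>_. cball y r))" by (auto simp: X_def mem_PiC_iff Pi_iff)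
      then show ?thesis using closed_PiC[of UNIV "\<lambda>_. cball y r"] by simp
    qed
    then show "complete X" by (simp add: complete_eq_closed)
    have "const_bcontfun y \<in> X" using r by (auto simp: X_def)
    then show "X \<noteq> {}" by blast
    show "T ` X \<subseteq> X"
    proof
      fix g assume "g \<in> T ` X"
      then obtain f where f: "f \<in> X" "g = T f" by blast
      then show "g \<in> X" using Gb[OF f(1) C] T[OF f(1)] unfolding X_def by (auto simp: dist_norm)
    qed
    fix f g assume fg: "f \<in> X" "g \<in> X"
    show "dist (T f) (T g) \<le> 1 / 2 * dist f g"
    proof (rule dist_bound)
      fix t
      have "norm ((G f (C t) - G g (C t)) - (G f 0 - G g 0)) \<le> L * dist f g * \<bar>C t - 0\<bar>"
      proof (rule has_vector_derivative_bound[where a="-\<epsilon>" and b=\<epsilon>])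
        fix t assume t: "t \<in> {-\<epsilon>..\<epsilon>}"
        show "((\<lambda>t. G f t - G g t) has_vector_derivative Y (f t) - Y (g t)) (at t within {-\<epsilon>..\<epsilon>})"
          using G[OF fg(1) t] G[OF fg(2) t] by (intro derivative_intros)
        have "norm (Y (f t) - Y (g t)) \<le> L * norm (f t - g t)"
          using fg by (intro L) (auto simp: X_def)
        also have "\<dots> \<le> L * dist f g"
          using dist_bounded[of f t g] L(1) by (intro mult_left_mono) (auto simp: dist_norm)
        finally show "norm (Y (f t) - Y (g t)) \<le> L * dist f g" .
      qed (use C eps in auto)
      also have "\<dots> \<le> L * dist f g * \<epsilon>" using C[of t] L(1) by (intro mult_left_mono) auto
      also have "\<dots> \<le> 1/2 * dist f g"
        using mult_right_mono[OF eps(3), of "dist f g"] by (simp add: algebra_simps)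
      finally show "dist (T f t) (T g t) \<le> 1/2 * dist f g"
        using T fg G0 by (simp add: dist_norm)
    qed
  qed auto
  then obtain f where f: "f \<in> X" "T f = f" by blast
  then have feq: "f t = y + G f (C t)" for t using T by metis
  show thesis
  proof (rule that[OF eps(1), of f])
    show "f 0 = y" using feq[of 0] eps G0 by (simp add: C_def)
    fix t assume t: "t \<in> {-\<epsilon><..<\<epsilon>}"
    have "(G f has_vector_derivative Y (f t)) (at t)"
      using G[OF f(1), of t] t at_within_Icc_at[of "-\<epsilon>" t \<epsilon>] by auto
    then have "((\<lambda>t. y + G f t) has_vector_derivative Y (f t)) (at t)"
      by (auto intro!: derivative_eq_intros)
    then have "(f has_vector_derivative Y (f t)) (at t)"
      by (rule has_vector_derivative_transform_within_open[OF _ open_greaterThanLessThan t])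
        (use feq in \<open>simp add: C_def\<close>)
    then show "f t \<in> S \<and> (f has_vector_derivative Y (f t)) (at t)"
      using f(1) r(2) by (auto simp: X_def)
  qed
qed

text \<open>Bootstrapping: u' = Y(u) is as regular as u, so class C^k of u yields class
  C^(k+1).\<close>

lemma smooth_on_integral_curve:
  fixes Y :: "'a::euclidean_space \<Rightarrow> 'a"
  assumes "open S" "smooth_on S Y" "open I"
    and u: "\<And>t. t \<in> I \<Longrightarrow> u t \<in> S \<and> (u has_vector_derivative Y (u t)) (at t)"
  shows "smooth_on I u"
proof -
  have "Ck_on k I u" for k
  proof (induction k)
    case 0
    then show ?case
      using u by (metis Ck_on.simps(1) continuous_at_imp_continuous_on has_vector_derivative_continuous)
  next
    case (Suc k)
    have D: "(u has_derivative (\<lambda>h. h *\<^sub>R Y (u t))) (at t)" if "t \<in> I" for t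
      using u[OF that] by (simp add: has_vector_derivative_def)
    have "Ck_on k I (\<lambda>t. frechet_derivative u (at t) h)" for h
    proof (rule Ck_on_cong[OF \<open>open I\<close>])
      show "Ck_on k I (\<lambda>t. h *\<^sub>R Y (u t))"
      proof (rule Ck_on_scaleR[OF \<open>open I\<close> Ck_on_const])
        show "Ck_on k I (\<lambda>t. Y (u t))"
          by (rule Ck_on_compose[OF \<open>open I\<close> \<open>open S\<close>]) (use assms(2) u Suc in \<open>auto simp: smooth_on_def\<close>)
      qed
    qed (simp add: frechet_derivative_at[OF D, symmetric])
    then show ?case using D by (auto simp: differentiable_def)
  qed
  then show ?thesis by (simp add: smooth_on_def)
qed

section \<open>Straightening a submersion\<close>

lemma has_derivative_along_line:
  assumes g: "(g has_derivative g') (at (p + s *\<^sub>R v))"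
  shows "((\<lambda>s. g (p + s *\<^sub>R v)) has_derivative (\<lambda>d. g' (d *\<^sub>R v))) (at s within T)"
proof -
  have "((\<lambda>s. p + s *\<^sub>R v) has_derivative (\<lambda>d. d *\<^sub>R v)) (at s within T)"
    by (auto intro!: derivative_eq_intros)
  from has_derivative_compose[OF this, of g g'] g show ?thesis by simp
qed

text \<open>With R a right inverse of DP(x), the map \<Phi>(y) = R(P y) + (y - R(DP(x) y)) is a
  local diffeomorphism that turns P into the linear map DP(x). The curve is the preimage of the line
  \<Phi>(x) + sv, which stays in the fibre as v is in the kernel. For the last clause: in these
  coordinates a function whose differential kills ker DP is invariant under translations by ker
  DP(x), so one covector serves along the whole curve. The curve is fixed before the function, hence
  shared by several functions.\<close>

lemma submersion_fibre_curve:
  fixes P :: "'a::euclidean_space \<Rightarrow> 'b::euclidean_space"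
  assumes "open S" "smooth_on S P" "x \<in> S" and surj: "surj (frechet_derivative P (at x))"
    and v: "frechet_derivative P (at x) v = 0"
  obtains \<epsilon> \<gamma> where "\<epsilon> > 0" "\<gamma> 0 = x" "continuous_on {-\<epsilon><..<\<epsilon>} \<gamma>"
    "\<And>s. s \<in> {-\<epsilon><..<\<epsilon>} \<Longrightarrow> \<gamma> s \<in> S \<and> P (\<gamma> s) = P x"
    "(\<gamma> has_vector_derivative v) (at 0)"
    "\<And>f :: 'a \<Rightarrow> real. (\<And>y. y \<in> S \<Longrightarrow> f differentiable (at y)) \<Longrightarrow>
       (\<And>y w. y \<in> S \<Longrightarrow> frechet_derivative P (at y) w = 0 \<Longrightarrow> frechet_derivative f (at y) w = 0) \<Longrightarrow>
       \<exists>l. linear l \<and> (\<forall>s\<in>{-\<epsilon><..<\<epsilon>}. \<forall>w.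
          frechet_derivative f (at (\<gamma> s)) w = l (frechet_derivative P (at (\<gamma> s)) w))"
proof -
  define D where "D = (\<lambda>y. frechet_derivative P (at y))"
  have DP: "(P has_derivative D y) (at y)" if "y \<in> S" for y
    unfolding D_def using smooth_on_has_derivative[OF assms(2) that] .
  have linD: "linear (D y)" if "y \<in> S" for y using has_derivative_linear[OF DP[OF that]] .
  note linx = linD[OF \<open>x \<in> S\<close>]
  obtain R where R: "linear R" "\<And>q. D x (R q) = q"
    using linear_surjective_right_inverse[OF linx] surj unfolding D_def by (metis comp_apply id_apply)
  define \<Phi> where "\<Phi> = (\<lambda>y. R (P y) + (y - R (D x y)))"
  define \<Phi>' where "\<Phi>' = (\<lambda>y w. R (D y w) + (w - R (D x w)))"
  have blR: "bounded_linear R" and blDx: "bounded_linear (D x)"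
    using R(1) linx by (simp_all add: linear_conv_bounded_linear)
  have D\<Phi>: "(\<Phi> has_derivative \<Phi>' y) (at y)" if "y \<in> S" for y
    unfolding \<Phi>_def \<Phi>'_def
    by (intro derivative_intros bounded_linear.has_derivative[OF blR] DP that
        bounded_linear.has_derivative[OF blDx])
  have bl: "bounded_linear (\<Phi>' y)" if "y \<in> S" for y
    using D\<Phi>[OF that] has_derivative_bounded_linear by blast
  have \<Phi>'x: "\<Phi>' x w = w" for w by (simp add: \<Phi>'_def)
  have Dx\<Phi>: "D x (\<Phi> y) = P y" for y
    by (simp add: \<Phi>_def linear_add[OF linx] linear_diff[OF linx] R(2))
  have Dx\<Phi>': "D x (\<Phi>' y w) = D y w" for y w
    by (simp add: \<Phi>'_def linear_add[OF linx] linear_diff[OF linx] R(2))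
  have contD: "continuous_on S (\<lambda>y. Blinfun (\<Phi>' y))"
  proof (rule continuous_on_blinfun_componentwise)
    fix i :: 'a assume "i \<in> Basis"
    have "continuous_on S (\<lambda>y. \<Phi>' y i)"
      unfolding \<Phi>'_def D_def
      by (intro continuous_intros bounded_linear.continuous_on[OF blR] smooth_on_continuous_on
          smooth_on_derivative[OF assms(2)])
    then show "continuous_on S (\<lambda>y. blinfun_apply (Blinfun (\<Phi>' y)) i)"
      by (rule continuous_on_eq) (simp add: bounded_linear_Blinfun_apply[OF bl])
  qed
  \<comment> \<open>The derivative of \<Phi> at x is the identity, which is therefore the inverse
    that the inverse function theorem asks for.\<close>
  have inv1: "id_blinfun o\<^sub>L Blinfun (\<Phi>' x) = id_blinfun"
    by (rule blinfun_eqI) (simp add: bounded_linear_Blinfun_apply[OF bl[OF \<open>x \<in> S\<close>]] \<Phi>'x)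
  obtain U' V g g' where UV: "open U'" "U' \<subseteq> S" "x \<in> U'" "open V" "\<Phi> x \<in> V" "homeomorphism U' V \<Phi> g"
    and g: "\<And>y. y \<in> V \<Longrightarrow> (g has_derivative (g' y)) (at y)"
    and g': "\<And>y. y \<in> V \<Longrightarrow> g' y = inv (blinfun_apply (Blinfun (\<Phi>' (g y))))"
    and bij: "\<And>y. y \<in> V \<Longrightarrow> bij (blinfun_apply (Blinfun (\<Phi>' (g y))))"
  proof (rule inverse_function_theorem[OF \<open>open S\<close> _ contD \<open>x \<in> S\<close> inv1, of \<Phi>])
    show "(\<Phi> has_derivative blinfun_apply (Blinfun (\<Phi>' y))) (at y)" if "y \<in> S" for y
      using D\<Phi>[OF that] bl[OF that] by (simp add: bounded_linear_Blinfun_apply)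
  qed (use that in blast)
  have gU: "g z \<in> U'" "\<Phi> (g z) = z" if "z \<in> V" for z
    using UV(6) that unfolding homeomorphism_def by auto
  have gS: "g z \<in> S" if "z \<in> V" for z using gU[OF that] UV by auto
  have gl: "g' z (\<Phi>' (g z) w) = w" "\<Phi>' (g z) (g' z w) = w" if "z \<in> V" for z w
    using bij[OF that] g'[OF that] bounded_linear_Blinfun_apply[OF bl[OF gS[OF that]]]
    by (simp_all add: inv_f_f[OF bij_is_inj] surj_f_inv_f[OF bij_is_surj])
  have gx: "g (\<Phi> x) = x" using UV unfolding homeomorphism_def by auto
  have Pg: "P (g z) = D x z" if "z \<in> V" for z using Dx\<Phi>[of "g z"] gU[OF that] by simp
  obtain \<rho> where \<rho>: "\<rho> > 0" "ball (\<Phi> x) \<rho> \<subseteq> V" using UV openE by blast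
  \<comment> \<open>The line has distance |s||v| from \<Phi>(x), which is below \<rho> for |s| <
    \<epsilon>; the 1 covers v = 0.\<close>
  define \<epsilon> where "\<epsilon> = \<rho> / (norm v + 1)"
  have nv: "norm v + 1 > 0" by (smt (verit) norm_ge_zero)
  have eps: "\<epsilon> > 0" using \<rho> nv by (simp add: \<epsilon>_def)
  have inb: "\<Phi> x + s *\<^sub>R v \<in> ball (\<Phi> x) \<rho>" if "s \<in> {-\<epsilon><..<\<epsilon>}" for s
  proof -
    have "\<bar>s\<bar> * norm v \<le> \<bar>s\<bar> * (norm v + 1)" by (simp add: mult_left_mono)
    also have "\<dots> < \<epsilon> * (norm v + 1)" using that nv by (intro mult_strict_right_mono) auto
    also have "\<dots> = \<rho>" using nv by (simp add: \<epsilon>_def)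
    finally show ?thesis by (simp add: dist_norm)
  qed
  then have inV: "\<Phi> x + s *\<^sub>R v \<in> V" if "s \<in> {-\<epsilon><..<\<epsilon>}" for s using that \<rho> by blast
  define \<gamma> where "\<gamma> = (\<lambda>s. g (\<Phi> x + s *\<^sub>R v))"
  have vD: "D x v = 0" using v by (simp add: D_def)
  have g'x: "g' (\<Phi> x) w = w" for w using gl(1)[OF UV(5), of w] \<Phi>'x gx by simp
  show thesis
  proof (rule that[OF eps, of \<gamma>])
    show "\<gamma> 0 = x" by (simp add: \<gamma>_def gx)
    show "continuous_on {-\<epsilon><..<\<epsilon>} \<gamma>" unfolding \<gamma>_def
    proof (rule continuous_on_compose2[of V g])
      show "continuous_on V g" using UV unfolding homeomorphism_def by auto
    qed (use inV in \<open>auto intro!: continuous_intros\<close>)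
    show "\<gamma> s \<in> S \<and> P (\<gamma> s) = P x" if "s \<in> {-\<epsilon><..<\<epsilon>}" for s
      using gS[OF inV[OF that]] Pg[OF inV[OF that]] Dx\<Phi>[of x]
      by (simp add: \<gamma>_def linear_add[OF linx] linear_cmul[OF linx] vD)
    have "((\<lambda>s. g (\<Phi> x + s *\<^sub>R v)) has_derivative (\<lambda>d. g' (\<Phi> x) (d *\<^sub>R v))) (at 0)"
      using g[OF UV(5)] by (intro has_derivative_along_line) simp
    then show "(\<gamma> has_vector_derivative v) (at 0)"
      by (simp add: has_vector_derivative_def \<gamma>_def g'x)
    fix f :: "'a \<Rightarrow> real"
    assume f: "\<And>y. y \<in> S \<Longrightarrow> f differentiable (at y)"
      and fP: "\<And>y w. y \<in> S \<Longrightarrow> frechet_derivative P (at y) w = 0 \<Longrightarrow> frechet_derivative f (at y) w = 0"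
    let ?Df = "\<lambda>y. frechet_derivative f (at y)"
    have Df: "(f has_derivative ?Df y) (at y)" if "y \<in> S" for y using f[OF that] frechet_derivative_works by blast
    have F: "((\<lambda>z. f (g z)) has_derivative (\<lambda>w. ?Df (g z) (g' z w))) (at z)" if "z \<in> V" for z
      using has_derivative_compose[OF g[OF that] Df[OF gS[OF that]]] .
    have F0: "?Df (g z) (g' z w) = 0" if "z \<in> V" "D x w = 0" for z w
      using Dx\<Phi>'[of "g z" "g' z w"] gl(2)[OF that(1)] that(2) fP[OF gS[OF that(1)]] by (simp add: D_def)
    have const: "f (g (z + w)) = f (g z)"
      if z: "z \<in> ball (\<Phi> x) \<rho>" "z + w \<in> ball (\<Phi> x) \<rho>" and w: "D x w = 0" for z w
    proof -
      have seg: "z + t *\<^sub>R w \<in> V" if "t \<in> {0..1}" for t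
      proof -
        have "(1 - t) *\<^sub>R z + t *\<^sub>R (z + w) \<in> ball (\<Phi> x) \<rho>"
          using that z by (intro convexD[OF convex_ball]) auto
        then show ?thesis using \<rho> by (auto simp: algebra_simps)
      qed
      have "\<exists>c. \<forall>t\<in>{0..1}. f (g (z + t *\<^sub>R w)) = c"
      proof (rule has_derivative_zero_constant[OF convex_real_interval(5)])
        fix t :: real assume t: "t \<in> {0..1}"
        have "((\<lambda>t. f (g (z + t *\<^sub>R w))) has_derivative (\<lambda>d. ?Df (g (z + t *\<^sub>R w)) (g' (z + t *\<^sub>R w) (d *\<^sub>R w)))) (at t within {0..1})"
          by (rule has_derivative_along_line[OF F[OF seg[OF t]]])
        then show "((\<lambda>t. f (g (z + t *\<^sub>R w))) has_derivative (\<lambda>d. 0)) (at t within {0..1})"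
          using F0[OF seg[OF t]] by (simp add: linear_cmul[OF linx] w)
      qed
      then obtain c where c: "\<And>t. t \<in> {0..1} \<Longrightarrow> f (g (z + t *\<^sub>R w)) = c" by blast
      show ?thesis using c[of 0] c[of 1] by simp
    qed
    have eq: "?Df (\<gamma> s) w = ?Df x (R (D (\<gamma> s) w))" if s: "s \<in> {-\<epsilon><..<\<epsilon>}" for s w
    proof -
      let ?z = "\<Phi> x + s *\<^sub>R v"
      \<comment> \<open>Points z such that z and z - sv both lie in the ball, and with them the
        segment in between, along which \<open>const\<close> is proved.\<close>
      let ?N = "(\<lambda>z. z - s *\<^sub>R v) -` ball (\<Phi> x) \<rho> \<inter> ball (\<Phi> x) \<rho>"
      have Dz: "((\<lambda>z. z - s *\<^sub>R v) has_derivative (\<lambda>w. w)) (at ?z)"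
        by (auto intro!: derivative_eq_intros)
      have "((\<lambda>z. f (g (z - s *\<^sub>R v))) has_derivative ?Df x) (at ?z)"
        using has_derivative_compose[OF Dz, of "\<lambda>z. f (g z)" "?Df x"] F[OF UV(5)] by (simp add: gx g'x)
      then have "((\<lambda>z. f (g z)) has_derivative ?Df x) (at ?z)"
      proof (rule has_derivative_transform_within_open)
        show "open ?N" by (intro open_Int open_vimage continuous_intros open_ball)
        show "?z \<in> ?N" using inb[OF s] \<rho> by auto
        show "f (g (z - s *\<^sub>R v)) = f (g z)" if "z \<in> ?N" for z
          using const[of "z - s *\<^sub>R v" "s *\<^sub>R v"] that by (simp add: linear_cmul[OF linx] vD)
      qed
      from has_derivative_unique[OF this F[OF inV[OF s]]]
      have "?Df x w = ?Df (\<gamma> s) (g' ?z w)" for w by (simp add: \<gamma>_def fun_eq_iff)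
      then have "?Df (\<gamma> s) w = ?Df x (\<Phi>' (\<gamma> s) w)"
        using gl(1)[OF inV[OF s], of w] by (simp add: \<gamma>_def)
      \<comment> \<open>The second summand vanishes because w - R(DP(x) w) lies in ker DP(x); what
        remains depends on w only through DP at \<gamma> s, so the covector is Df(x) o R.\<close>
      also have "\<dots> = ?Df x (R (D (\<gamma> s) w)) + ?Df x (w - R (D x w))"
        by (simp add: \<Phi>'_def linear_add[OF has_derivative_linear[OF Df[OF \<open>x \<in> S\<close>]]])
      also have "?Df x (w - R (D x w)) = 0"
      proof (rule fP[OF \<open>x \<in> S\<close>])
        have "D x (w - R (D x w)) = 0" by (simp add: linear_diff[OF linx] R(2))
        then show "frechet_derivative P (at x) (w - R (D x w)) = 0" by (simp add: D_def)
      qed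
      finally show ?thesis by simp
    qed
    have lin: "linear (\<lambda>q. ?Df x (R q))"
      using linear_compose[OF R(1) has_derivative_linear[OF Df[OF \<open>x \<in> S\<close>]]] by (simp add: o_def)
    show "\<exists>l. linear l \<and> (\<forall>s\<in>{-\<epsilon><..<\<epsilon>}. \<forall>w.
          ?Df (\<gamma> s) w = l (frechet_derivative P (at (\<gamma> s)) w))"
      by (intro exI[of _ "\<lambda>q. ?Df x (R q)"] conjI ballI allI lin) (rule eq[unfolded D_def])
  qed
qed

section \<open>Transported pairings and contact nondegeneracy\<close>

text \<open>Finite dimension makes pointwise limits enough: |M s u| is at least m|u| with m > 0 by
  compactness of the unit sphere, and the norm of M t - M s is dominated by a sum over the basis
  that tends to 0. It serves for vectors picked by choice along a curve, which have no regularity of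
  their own.\<close>

lemma linear_solution_tendsto:
  fixes M :: "real \<Rightarrow> 'a::euclidean_space \<Rightarrow> 'b::real_normed_vector"
  assumes lin: "\<And>t. linear (M t)" and inj: "\<And>u. M s u = 0 \<Longrightarrow> u = 0"
    and cont: "\<And>u. ((\<lambda>t. M t u) \<longlongrightarrow> M s u) (at s)"
    and V: "\<forall>\<^sub>F t in at s. M t (V t) = c t" "M s (V s) = c s" and c: "(c \<longlongrightarrow> c s) (at s)"
  shows "(V \<longlongrightarrow> V s) (at s)"
proof -
  obtain m where m: "m > 0" "\<And>u. m * norm u \<le> norm (M s u)"
  proof -
    have "\<exists>B>0. \<forall>u. B * norm u \<le> norm (M s u)"
    proof (cases "\<exists>b::'a. norm b = 1")
      case True
      have contM: "continuous_on (sphere 0 1) (\<lambda>u. norm (M s u))"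
        using lin linear_continuous_on linear_conv_bounded_linear by (intro continuous_intros) blast
      have "sphere (0::'a) 1 \<noteq> {}" using True by auto
      then obtain u0 where u0: "u0 \<in> sphere 0 1" "\<And>u. u \<in> sphere 0 1 \<Longrightarrow> norm (M s u0) \<le> norm (M s u)"
        using continuous_attains_inf[OF compact_sphere _ contM] by blast
      have "norm (M s u0) * norm u \<le> norm (M s u)" for u
      proof (cases "u = 0")
        case False
        have "norm (M s u0) \<le> norm (M s ((1 / norm u) *\<^sub>R u))" using False by (intro u0) auto
        also have "\<dots> = norm (M s u) / norm u" by (simp add: linear_cmul[OF lin])
        finally show ?thesis using False by (simp add: field_simps)
      qed simp
      moreover have "norm (M s u0) > 0" using u0(1) inj[of u0] by auto
      ultimately show ?thesis by blast
    next
      case False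
      then show ?thesis by (metis norm_Basis nonempty_Basis ex_in_conv)
    qed
    then show ?thesis using that by blast
  qed
  define e where "e = (\<lambda>t. \<Sum>b\<in>Basis. norm (M t b - M s b))"
  have e0: "e t \<ge> 0" for t by (simp add: e_def sum_nonneg)
  have "(e \<longlongrightarrow> (\<Sum>b\<in>(Basis::'a set). norm (M s b - M s b))) (at s)"
    unfolding e_def by (intro tendsto_intros cont)
  then have e: "(e \<longlongrightarrow> 0) (at s)" by simp
  have diff: "norm (M t u - M s u) \<le> e t * norm u" for t u
  proof -
    have "M t u - M s u = (\<Sum>b\<in>Basis. (u \<bullet> b) *\<^sub>R (M t b - M s b))"
      using linear_basis_expansion[OF lin, of t u] linear_basis_expansion[OF lin, of s u]
      by (simp add: scaleR_diff_right sum_subtractf)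
    also have "norm \<dots> \<le> (\<Sum>b\<in>Basis. norm u * norm (M t b - M s b))"
      by (rule sum_norm_le) (auto intro!: mult_right_mono Basis_le_norm)
    finally show ?thesis by (simp add: e_def sum_distrib_left mult.commute)
  qed
  have "\<forall>\<^sub>F t in at s. e t < m / 2" using e m(1) by (intro order_tendstoD) auto
  \<comment> \<open>Once e t < m/2, the perturbation is absorbed and |V t| is at most 2|c t|/m; this
    bound then enters the estimate of V t - V s.\<close>
  then have "\<forall>\<^sub>F t in at s. norm (V t - V s) \<le> (norm (c t - c s) + e t * (2 * norm (c t) / m)) / m"
    using V(1)
  proof eventually_elim
    case (elim t)
    have "m * norm (V t) \<le> norm (M s (V t))" by (rule m)
    also have "\<dots> \<le> norm (c t) + e t * norm (V t)"
      using norm_triangle_ineq4[of "M t (V t)" "M t (V t) - M s (V t)"] diff[of t "V t"] elim by simp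
    also have "\<dots> \<le> norm (c t) + m / 2 * norm (V t)" using elim by (intro add_left_mono mult_right_mono) auto
    finally have b: "norm (V t) \<le> 2 * norm (c t) / m" using m(1) by (simp add: field_simps)
    have "m * norm (V t - V s) \<le> norm (M s (V t - V s))" by (rule m)
    also have "M s (V t - V s) = (c t - c s) - (M t (V t) - M s (V t))"
      using elim V(2) by (simp add: linear_diff[OF lin])
    also have "norm \<dots> \<le> norm (c t - c s) + e t * norm (V t)"
      by (rule order_trans[OF norm_triangle_ineq4]) (intro add_left_mono diff)
    also have "\<dots> \<le> norm (c t - c s) + e t * (2 * norm (c t) / m)"
      using b e0 by (intro add_left_mono mult_left_mono) auto
    finally show ?case using m(1) by (simp add: field_simps)
  qed
  moreover have "((\<lambda>t. (norm (c t - c s) + e t * (2 * norm (c t) / m)) / m) \<longlongrightarrow>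
      (norm (c s - c s) + 0 * (2 * norm (c s) / m)) / m) (at s)"
    using m(1) by (intro tendsto_intros c e) auto
  then have "((\<lambda>t. (norm (c t - c s) + e t * (2 * norm (c t) / m)) / m) \<longlongrightarrow> 0) (at s)" by simp
  ultimately have "((\<lambda>t. V t - V s) \<longlongrightarrow> 0) (at s)" by (rule Lim_null_comparison)
  then show ?thesis by (rule LIM_zero_cancel)
qed

text \<open>After expansion over the basis each term is a coordinate of V t, which converges, times
  a difference quotient of g at a fixed vector. So the limit of V, rather than its derivative,
  decides.\<close>

lemma linear_difference_quotient_tendsto:
  fixes g :: "real \<Rightarrow> 'a::euclidean_space \<Rightarrow> real"
  assumes lin: "\<forall>\<^sub>F t in at s. linear (g t)" "linear (g s)" "linear g'"
    and g: "\<And>u. ((\<lambda>t. g t u) has_real_derivative g' u) (at s)"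
    and V: "(V \<longlongrightarrow> v) (at s)"
  shows "((\<lambda>t. (g t (V t) - g s (V t)) / (t - s)) \<longlongrightarrow> g' v) (at s)"
proof -
  have "((\<lambda>t. \<Sum>b\<in>Basis. (V t \<bullet> b) * ((g t b - g s b) / (t - s))) \<longlongrightarrow> (\<Sum>b\<in>Basis. (v \<bullet> b) * g' b)) (at s)"
    using g by (intro tendsto_intros V) (simp add: has_field_derivative_iff)
  moreover have "(\<Sum>b\<in>Basis. (v \<bullet> b) * g' b) = g' v"
    using linear_basis_expansion[OF lin(3), of v] by simp
  moreover have "\<forall>\<^sub>F t in at s. (\<Sum>b\<in>Basis. (V t \<bullet> b) * ((g t b - g s b) / (t - s))) = (g t (V t) - g s (V t)) / (t - s)"
    using lin(1)
  proof eventually_elim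
    case (elim t)
    have "g t (V t) - g s (V t) = (\<Sum>b\<in>Basis. (V t \<bullet> b) * (g t b - g s b))"
      using linear_basis_expansion[OF elim, of "V t"] linear_basis_expansion[OF lin(2), of "V t"]
      by (simp add: right_diff_distrib sum_subtractf)
    then show ?case by (simp add: sum_divide_distrib)
  qed
  ultimately show ?thesis using Lim_transform_eventually by fastforce
qed

text \<open>The pairing \<open>\<omega>\<^sub>t(V\<^sub>1, V\<^sub>2)\<close> is Lie-transported; expanding its increment with mixed
  times \<open>\<omega>\<^sub>t(V\<^sub>1(t), V\<^sub>2(s))\<close> leaves only increments of \<open>\<omega>\<close>, \<open>\<beta>\<^sub>1\<close>, \<open>\<beta>\<^sub>2\<close>, so that continuity
  of \<open>V\<^sub>1\<close> is enough.\<close>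
lemma pairing_derivative_zero:
  fixes \<omega> :: "real \<Rightarrow> 'a::euclidean_space \<Rightarrow> 'a \<Rightarrow> real"
  assumes I: "open I" "s \<in> I"
    and lin: "\<And>t v. t \<in> I \<Longrightarrow> linear (\<lambda>u. \<omega> t u v)" "\<And>t. t \<in> I \<Longrightarrow> linear (\<beta>2 t)" "linear D"
    and anti: "\<And>t u v. t \<in> I \<Longrightarrow> \<omega> t u v = - \<omega> t v u"
    and V1: "\<And>t w. t \<in> I \<Longrightarrow> \<omega> t (V1 t) w = - \<beta>1 t w"
    and V2: "\<And>t w. t \<in> I \<Longrightarrow> \<omega> t (V2 t) w = - \<beta>2 t w"
    and d\<omega>: "\<And>u v. ((\<lambda>t. \<omega> t u v) has_real_derivative - \<omega> s (D u) v - \<omega> s u (D v)) (at s)"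
    and d\<beta>1: "\<And>w. ((\<lambda>t. \<beta>1 t w) has_real_derivative - \<beta>1 s (D w)) (at s)"
    and d\<beta>2: "\<And>w. ((\<lambda>t. \<beta>2 t w) has_real_derivative - \<beta>2 s (D w)) (at s)"
    and V: "(V1 \<longlongrightarrow> V1 s) (at s)"
  shows "((\<lambda>t. \<omega> t (V1 t) (V2 t)) has_real_derivative 0) (at s)"
proof -
  let ?v = "V2 s"
  \<comment> \<open>\<open>g s\<close> vanishes identically, and \<open>g t (V1 t)\<close> is the
    pairing at t plus \<open>\<beta>1 t (V2 s)\<close>. The increment of the pairing is thus that of
    g at the vector V1 t minus that of \<beta>1 at the vector V2 s; no increment of V1 or V2 is
    divided by t - s.\<close>
  define g where "g = (\<lambda>t u. \<beta>2 t u - \<omega> t u ?v)"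
  have ev: "\<forall>\<^sub>F t in at s. t \<in> I" using I eventually_at_in_open' by blast
  have ling: "linear (g t)" if "t \<in> I" for t
    unfolding g_def using lin that by (intro linear_compose_sub) auto
  have dg: "((\<lambda>t. g t u) has_real_derivative \<omega> s u (D ?v)) (at s)" for u
  proof -
    have "- \<beta>2 s (D u) - (- \<omega> s (D u) ?v - \<omega> s u (D ?v)) = \<omega> s u (D ?v)"
      using V2[OF I(2), of "D u"] anti[OF I(2), of ?v "D u"] by simp
    then show ?thesis unfolding g_def using DERIV_diff[OF d\<beta>2 d\<omega>, of u u ?v] by simp
  qed
  have "((\<lambda>t. (g t (V1 t) - g s (V1 t)) / (t - s) - (\<beta>1 t ?v - \<beta>1 s ?v) / (t - s))
      \<longlongrightarrow> \<omega> s (V1 s) (D ?v) - (- \<beta>1 s (D ?v))) (at s)"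
  proof (rule tendsto_diff)
    show "((\<lambda>t. (g t (V1 t) - g s (V1 t)) / (t - s)) \<longlongrightarrow> \<omega> s (V1 s) (D ?v)) (at s)"
    proof (rule linear_difference_quotient_tendsto[OF _ ling[OF I(2)] lin(1)[OF I(2)] dg V])
      show "\<forall>\<^sub>F t in at s. linear (g t)" using ev by eventually_elim (rule ling)
    qed
    show "((\<lambda>t. (\<beta>1 t ?v - \<beta>1 s ?v) / (t - s)) \<longlongrightarrow> - \<beta>1 s (D ?v)) (at s)"
      using d\<beta>1[of ?v] by (simp add: has_field_derivative_iff)
  qed
  moreover have "\<omega> s (V1 s) (D ?v) - (- \<beta>1 s (D ?v)) = 0" using V1[OF I(2)] by simp
  moreover have "\<forall>\<^sub>F t in at s. (g t (V1 t) - g s (V1 t)) / (t - s) - (\<beta>1 t ?v - \<beta>1 s ?v) / (t - s) =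
     (\<omega> t (V1 t) (V2 t) - \<omega> s (V1 s) (V2 s)) / (t - s)"
    using ev
  proof eventually_elim
    case (elim t)
    have "g s (V1 t) = 0" using V2[OF I(2), of "V1 t"] anti[OF I(2), of ?v "V1 t"] by (simp add: g_def)
    moreover have "\<omega> t (V1 t) (V2 t) = \<beta>2 t (V1 t)"
      using V2[OF elim, of "V1 t"] anti[OF elim, of "V2 t" "V1 t"] by simp
    ultimately show ?case using V1[OF elim, of ?v] V1[OF I(2), of ?v]
      by (simp add: g_def flip: diff_divide_distrib)
  qed
  ultimately show ?thesis
    unfolding has_field_derivative_iff using Lim_transform_eventually by fastforce
qed

section \<open>Exterior algebra and contact forms on a vector space\<close>

text \<open>The second clause fits the encoding by infinite sequences, where a form may read its
  first k entries only. Antisymmetry is left to \<open>wedge\<close>, whose sum over permutations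
  produces it.\<close>

definition multilinear_form :: "nat \<Rightarrow> ((nat \<Rightarrow> 'a::real_vector) \<Rightarrow> real) \<Rightarrow> bool" where
  "multilinear_form k \<omega> \<longleftrightarrow> (\<forall>v i. i < k \<longrightarrow> linear (\<lambda>x. \<omega> (v(i := x)))) \<and>
     (\<forall>v w. (\<forall>i<k. v i = w i) \<longrightarrow> \<omega> v = \<omega> w)"

lemma multilinear_form_cong: "multilinear_form k \<omega> \<Longrightarrow> (\<And>i. i < k \<Longrightarrow> v i = w i) \<Longrightarrow> \<omega> v = \<omega> w"
  unfolding multilinear_form_def by blast

lemma multilinear_form_linear: "multilinear_form k \<omega> \<Longrightarrow> i < k \<Longrightarrow> linear (\<lambda>x. \<omega> (v(i := x)))"
  unfolding multilinear_form_def by blast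

text \<open>For each permutation, slot j is read through exactly one index m with \<sigma> m = j. If
  m < k, it is a slot of the first factor and the second factor is constant in x; otherwise the
  roles are exchanged.\<close>

lemma multilinear_wedge:
  assumes \<omega>: "multilinear_form k \<omega>" and \<eta>: "multilinear_form l \<eta>"
  shows "multilinear_form (k + l) (wedge k l \<omega> \<eta>)"
  unfolding multilinear_form_def
proof (intro conjI allI impI)
  fix v :: "nat \<Rightarrow> 'a" and j assume j: "j < k + l"
  have "linear (\<lambda>x. of_int (sign \<sigma>) * \<omega> (\<lambda>i. (v(j := x)) (\<sigma> i)) * \<eta> (\<lambda>i. (v(j := x)) (\<sigma> (k + i))))"
    if \<sigma>: "\<sigma> permutes {..<k + l}" for \<sigma>
  proof -
    obtain m where m: "m < k + l" "\<sigma> m = j" using permutes_surj[OF \<sigma>] permutes_in_image[OF \<sigma>] j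
      by (metis lessThan_iff surjD)
    have inj: "\<sigma> i = j \<longleftrightarrow> i = m" for i using m permutes_inj[OF \<sigma>] by (auto dest: injD)
    show ?thesis
    proof (cases "m < k")
      case True
      have "(\<lambda>x. \<eta> (\<lambda>i. (v(j := x)) (\<sigma> (k + i)))) = (\<lambda>x. \<eta> (\<lambda>i. v (\<sigma> (k + i))))"
        using True by (auto simp: inj fun_upd_apply)
      moreover have "(\<lambda>x. \<omega> (\<lambda>i. (v(j := x)) (\<sigma> i))) = (\<lambda>x. \<omega> ((\<lambda>i. v (\<sigma> i))(m := x)))"
        by (auto simp: inj fun_upd_def)
      ultimately show ?thesis
        using multilinear_form_linear[OF \<omega> True, of "\<lambda>i. v (\<sigma> i)"]
        by (auto simp: linear_iff fun_eq_iff algebra_simps)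
    next
      case False
      then obtain m' where m': "m = k + m'" "m' < l" using m by (metis add_less_cancel_left le_Suc_ex not_less)
      have "\<omega> (\<lambda>i. (v(j := x)) (\<sigma> i)) = \<omega> (\<lambda>i. v (\<sigma> i))" for x
        using False by (intro multilinear_form_cong[OF \<omega>]) (auto simp: inj fun_upd_apply)
      moreover have "(\<lambda>x. \<eta> (\<lambda>i. (v(j := x)) (\<sigma> (k + i)))) = (\<lambda>x. \<eta> ((\<lambda>i. v (\<sigma> (k + i)))(m' := x)))"
        using m' by (auto simp: inj fun_upd_def)
      ultimately show ?thesis
        using multilinear_form_linear[OF \<eta> m'(2), of "\<lambda>i. v (\<sigma> (k + i))"]
        by (auto simp: linear_iff fun_eq_iff algebra_simps)
    qed
  qed
  then have "linear (\<lambda>x. \<Sum>\<sigma> | \<sigma> permutes {..<k + l}.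
      of_int (sign \<sigma>) * \<omega> (\<lambda>i. (v(j := x)) (\<sigma> i)) * \<eta> (\<lambda>i. (v(j := x)) (\<sigma> (k + i))))"
    by (intro linear_compose_sum) auto
  from linear_compose[OF this linear_times[of "1 / (fact k * fact l)"]]
  show "linear (\<lambda>x. wedge k l \<omega> \<eta> (v(j := x)))"
    by (simp add: wedge_def o_def)
next
  fix v w :: "nat \<Rightarrow> 'a" assume vw: "\<forall>i<k + l. v i = w i"
  have "\<omega> (\<lambda>i. v (\<sigma> i)) = \<omega> (\<lambda>i. w (\<sigma> i)) \<and> \<eta> (\<lambda>i. v (\<sigma> (k + i))) = \<eta> (\<lambda>i. w (\<sigma> (k + i)))"
    if \<sigma>: "\<sigma> permutes {..<k + l}" for \<sigma>
    using vw permutes_in_image[OF \<sigma>]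
    by (intro conjI multilinear_form_cong[OF \<omega>] multilinear_form_cong[OF \<eta>]) auto
  then show "wedge k l \<omega> \<eta> v = wedge k l \<omega> \<eta> w"
    unfolding wedge_def by (intro arg_cong2[where f="(/)"] sum.cong) auto
qed

lemma multilinear_wedge_power:
  assumes "multilinear_form k \<omega>"
  shows "multilinear_form (k * j) (wedge_power k \<omega> j)"
proof (induction j)
  case 0
  then show ?case by (simp add: multilinear_form_def)
next
  case (Suc j)
  then show ?case using multilinear_wedge[OF assms Suc] by simp
qed

text \<open>Reindexing the sum by \<sigma> -> \<tau> o \<sigma>: a sum over all permutations
  antisymmetrises arbitrary factors.\<close>

lemma wedge_permute:
  assumes \<tau>: "\<tau> permutes {..<k + l}"
  shows "wedge k l \<omega> \<eta> (\<lambda>i. v (\<tau> i)) = of_int (sign \<tau>) * wedge k l \<omega> \<eta> v"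
proof -
  let ?S = "{\<sigma>. \<sigma> permutes {..<k + l}}"
  let ?f = "\<lambda>\<sigma>. of_int (sign \<sigma>) * \<omega> (\<lambda>i. v (\<sigma> i)) * \<eta> (\<lambda>i. v (\<sigma> (k + i)))"
  have perm: "permutation \<sigma>" if "\<sigma> permutes {..<k + l}" for \<sigma>
    using that permutation_permutes by blast
  have bij: "bij_betw (\<lambda>\<sigma>. \<tau> \<circ> \<sigma>) ?S ?S"
  proof (rule bij_betw_byWitness[where f' = "\<lambda>\<sigma>. inv \<tau> \<circ> \<sigma>"])
    show "\<forall>\<sigma>\<in>?S. inv \<tau> \<circ> (\<tau> \<circ> \<sigma>) = \<sigma>" "\<forall>\<sigma>\<in>?S. \<tau> \<circ> (inv \<tau> \<circ> \<sigma>) = \<sigma>"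
      using permutes_inv_o[OF \<tau>] by (auto simp flip: comp_assoc)
  qed (use permutes_compose[OF _ \<tau>] permutes_compose[OF _ permutes_inv[OF \<tau>]] in auto)
  have "of_int (sign \<sigma>) * \<omega> (\<lambda>i. v (\<tau> (\<sigma> i))) * \<eta> (\<lambda>i. v (\<tau> (\<sigma> (k + i)))) =
      of_int (sign \<tau>) * ?f (\<tau> \<circ> \<sigma>)" if "\<sigma> permutes {..<k + l}" for \<sigma>
  proof -
    have "sign (\<tau> \<circ> \<sigma>) = sign \<tau> * sign \<sigma>" using sign_compose perm \<tau> that by blast
    moreover have "sign \<tau> * sign \<tau> = 1" by (rule sign_idempotent)
    ultimately have "of_int (sign \<sigma>) = of_int (sign \<tau>) * (of_int (sign (\<tau> \<circ> \<sigma>)) :: real)"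
      by (metis mult.assoc mult_1 of_int_mult)
    then show ?thesis by (simp add: mult.assoc)
  qed
  then have "(\<Sum>\<sigma>\<in>?S. of_int (sign \<sigma>) * \<omega> (\<lambda>i. v (\<tau> (\<sigma> i))) * \<eta> (\<lambda>i. v (\<tau> (\<sigma> (k + i))))) =
      (\<Sum>\<sigma>\<in>?S. of_int (sign \<tau>) * ?f (\<tau> \<circ> \<sigma>))"
    by (intro sum.cong) auto
  also have "\<dots> = of_int (sign \<tau>) * (\<Sum>\<sigma>\<in>?S. ?f (\<tau> \<circ> \<sigma>))" by (simp only: sum_distrib_left)
  also have "(\<Sum>\<sigma>\<in>?S. ?f (\<tau> \<circ> \<sigma>)) = (\<Sum>\<sigma>\<in>?S. ?f \<sigma>)"
    using sum.reindex_bij_betw[OF bij, of ?f] .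
  finally show ?thesis by (simp add: wedge_def)
qed

lemma wedge_repeated_zero:
  assumes ij: "i < k + l" "j < k + l" "i \<noteq> j" "v i = v j"
  shows "wedge k l \<omega> \<eta> v = 0"
proof -
  let ?\<tau> = "Transposition.transpose i j"
  have "?\<tau> permutes {..<k + l}" using ij by (intro permutes_swap_id) auto
  from wedge_permute[OF this, of \<omega> \<eta> v]
  have "wedge k l \<omega> \<eta> (\<lambda>n. v (?\<tau> n)) = - wedge k l \<omega> \<eta> v"
    using ij by (simp add: sign_swap_id)
  moreover have "(\<lambda>n. v (?\<tau> n)) = v" using ij(4) by (auto simp: Transposition.transpose_def)
  ultimately show ?thesis by simp
qed

text \<open>In slot j the wedge is linear and vanishes on each of the other entries, hence on their
  span.\<close>

lemma wedge_dependent_zero: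
  fixes v :: "nat \<Rightarrow> 'a::real_vector"
  assumes ml: "multilinear_form k \<omega>" "multilinear_form l \<eta>"
    and j: "j < k + l" and span: "v j \<in> span (v ` ({..<k + l} - {j}))"
  shows "wedge k l \<omega> \<eta> v = 0"
proof -
  note lin = multilinear_form_linear[OF multilinear_wedge[OF ml] j, of v]
  have "wedge k l \<omega> \<eta> (v(j := x)) = 0" if "x \<in> span (v ` ({..<k + l} - {j}))" for x
    using that
  proof (induction rule: span_induct)
    show "subspace {x. wedge k l \<omega> \<eta> (v(j := x)) = 0}"
      by (rule linear_subspace_kernel[OF lin])
    fix x assume "x \<in> v ` ({..<k + l} - {j})"
    then obtain i where "i < k + l" "i \<noteq> j" "x = v i" by auto
    then show "wedge k l \<omega> \<eta> (v(j := x)) = 0" using j by (intro wedge_repeated_zero[of i _ _ j]) auto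
  qed
  from this[OF span] show ?thesis by simp
qed

lemma wedge_cong:
  assumes "\<And>\<sigma>. \<omega> (\<lambda>i. v (\<sigma> i)) = \<omega> (\<lambda>i. w (\<sigma> i))" "\<And>\<sigma>. \<eta> (\<lambda>i. v (\<sigma> i)) = \<eta> (\<lambda>i. w (\<sigma> i))"
  shows "wedge k l \<omega> \<eta> v = wedge k l \<omega> \<eta> w"
  unfolding wedge_def by (simp only: assms)

text \<open>Agreement is demanded along all index maps \<sigma> because a wedge evaluates its
  factors at permuted and shifted entries. The condition is stable under composition of index maps,
  which drives the induction.\<close>

lemma wedge_power_cong:
  assumes "\<And>\<sigma>. \<omega> (\<lambda>i. v (\<sigma> i)) = \<omega> (\<lambda>i. w (\<sigma> i))"
  shows "wedge_power k \<omega> j v = wedge_power k \<omega> j w"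
  using assms
proof (induction j arbitrary: v w)
  case (Suc j)
  have "wedge_power k \<omega> j (\<lambda>i. v (\<sigma> i)) = wedge_power k \<omega> j (\<lambda>i. w (\<sigma> i))" for \<sigma>
    using Suc.prems[of "\<lambda>i. \<sigma> (_ i)"] by (intro Suc.IH) 
  then show ?case using Suc.prems by (auto intro!: wedge_cong)
qed simp

text \<open>Replacing every argument by its projection along a common kernel vector \<open>u\<close> does not
  change \<open>\<alpha> \<and> \<omega>\<^sup>n\<close>, but makes \<open>2n + 1\<close> arguments lie in a space of dimension \<open>2n\<close>.\<close>
lemma contact_nondegenerate:
  fixes a :: "'a::euclidean_space \<Rightarrow> real" and \<omega> :: "'a \<Rightarrow> 'a \<Rightarrow> real"
  assumes dim: "DIM('a) = 2 * n + 1"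
    and a: "linear a" and \<omega>: "\<And>v. linear (\<lambda>u. \<omega> u v)" "\<And>u. linear (\<omega> u)" "\<And>u v. \<omega> u v = - \<omega> v u"
    and nz: "wedge 1 (2 * n) (\<lambda>w. a (w 0)) (wedge_power 2 (\<lambda>w. \<omega> (w 0) (w 1)) n) v \<noteq> 0"
    and u: "a u = 0" "\<And>w. \<omega> u w = 0"
  shows "u = 0"
proof (rule ccontr)
  assume "u \<noteq> 0"
  define q where "q = (\<lambda>w. w - (w \<bullet> u / (u \<bullet> u)) *\<^sub>R u)"
  have q: "q w \<bullet> u = 0" for w using \<open>u \<noteq> 0\<close> by (simp add: q_def inner_diff_left)
  have aq: "a (q w) = a w" for w by (simp add: q_def linear_diff[OF a] linear_cmul[OF a] u)
  have "\<omega> w u = 0" for w using \<omega>(3)[of w u] u(2)[of w] by simp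
  then have \<omega>q: "\<omega> (q w) (q w') = \<omega> w w'" for w w'
    by (simp add: q_def linear_diff[OF \<omega>(1)] linear_cmul[OF \<omega>(1)] linear_diff[OF \<omega>(2)] linear_cmul[OF \<omega>(2)] u)
  let ?W = "wedge_power 2 (\<lambda>w. \<omega> (w 0) (w 1)) n"
  have ml1: "multilinear_form 1 (\<lambda>w. a (w 0))"
    using a by (auto simp: multilinear_form_def)
  have "multilinear_form 2 (\<lambda>w. \<omega> (w 0) (w 1))"
    using \<omega>(1,2) by (auto simp: multilinear_form_def less_2_cases_iff)
  from multilinear_wedge_power[OF this] have ml2: "multilinear_form (2 * n) ?W" .
  have "wedge 1 (2 * n) (\<lambda>w. a (w 0)) ?W v = wedge 1 (2 * n) (\<lambda>w. a (w 0)) ?W (\<lambda>i. q (v i))"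
    by (rule wedge_cong; (rule wedge_power_cong)?) (simp_all add: aq \<omega>q)
  also have "\<dots> = 0"
  proof -
    have "\<exists>j<2 * n + 1. q (v j) \<in> span ((\<lambda>i. q (v i)) ` ({..<2 * n + 1} - {j}))"
    proof (rule ccontr)
      let ?f = "\<lambda>i. q (v i)"
      assume "\<not> ?thesis"
      then have neg: "?f j \<notin> span (?f ` ({..<2 * n + 1} - {j}))" if "j < 2 * n + 1" for j
        using that by blast
      \<comment> \<open>Dependence is stated by index, so equal vectors at two indices already
        count. Excluding them leaves 2n + 1 distinct vectors to compare with a hyperplane of
        dimension 2n.\<close>
      have inj: "inj_on ?f {..<2 * n + 1}"
      proof (rule inj_onI, rule ccontr)
        fix i j assume ij: "i \<in> {..<2 * n + 1}" "j \<in> {..<2 * n + 1}" "?f i = ?f j" "i \<noteq> j"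
        then have "?f j \<in> ?f ` ({..<2 * n + 1} - {i})" by (intro imageI) auto
        then have "?f i \<in> span (?f ` ({..<2 * n + 1} - {i}))" unfolding ij(3) by (rule span_base)
        then show False using neg ij(1) by simp
      qed
      have "independent (?f ` {..<2 * n + 1})"
      proof
        assume "dependent (?f ` {..<2 * n + 1})"
          then obtain j where j: "j < 2 * n + 1" "?f j \<in> span (?f ` {..<2 * n + 1} - {?f j})"
            unfolding dependent_def by blast
          have "?f ` {..<2 * n + 1} - {?f j} \<subseteq> ?f ` ({..<2 * n + 1} - {j})" by auto
          from span_mono[OF this] show False using neg[OF j(1)] j(2) by blast
      qed
      moreover have "?f ` {..<2 * n + 1} \<subseteq> {w. w \<bullet> u = 0}" using q by auto
      ultimately have "card (?f ` {..<2 * n + 1}) \<le> dim {w. w \<bullet> u = 0}"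
        using independent_card_le_dim by blast
      moreover have "dim {w. w \<bullet> u = 0} = DIM('a) - 1"
        using dim_hyperplane[OF \<open>u \<noteq> 0\<close>] by (simp add: inner_commute)
      ultimately show False using card_image[OF inj] dim by simp
    qed
    then obtain j where "j < 1 + 2 * n" "q (v j) \<in> span ((\<lambda>i. q (v i)) ` ({..<1 + 2 * n} - {j}))"
      by (auto simp only: add.commute[of 1])
    then show ?thesis by (rule wedge_dependent_zero[OF ml1 ml2])
  qed
  finally show False using nz by simp
qed

text \<open>M is the map u -> i_u \<omega> + a(u) a, with covectors identified with vectors by the
  inner product. It is injective: the value at Z gives a(u) = 0, then nondegeneracy applies. So it
  is onto, and b(Z) = 0 forces a(v) = 0 for the solution of M v = b.\<close>

lemma contact_solve:
  fixes a :: "'a::euclidean_space \<Rightarrow> real" and \<omega> :: "'a \<Rightarrow> 'a \<Rightarrow> real"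
  assumes a: "linear a" and \<omega>: "\<And>v. linear (\<lambda>u. \<omega> u v)" "\<And>u. linear (\<omega> u)" "\<And>u v. \<omega> u v = - \<omega> v u"
    and nd: "\<And>u. a u = 0 \<Longrightarrow> (\<And>w. \<omega> u w = 0) \<Longrightarrow> u = 0"
    and Z: "a Z = 1" "\<And>w. \<omega> Z w = 0" and b: "linear b" "b Z = 0"
  obtains v where "a v = 0" "\<And>w. \<omega> v w = b w"
proof -
  define M where "M = (\<lambda>u. \<Sum>i\<in>Basis. (\<omega> u i + a u * a i) *\<^sub>R i)"
  have Mw: "M u \<bullet> w = \<omega> u w + a u * a w" for u w
  proof -
    have "M u \<bullet> w = (\<Sum>i\<in>Basis. (\<omega> u i + a u * a i) * (w \<bullet> i))"
      by (simp add: M_def inner_sum_left inner_commute[of w])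
    also have "\<dots> = (\<Sum>i\<in>Basis. (w \<bullet> i) * \<omega> u i) + a u * (\<Sum>i\<in>Basis. (w \<bullet> i) * a i)"
      by (simp add: sum_distrib_left sum.distrib algebra_simps)
    finally show ?thesis
      using linear_basis_expansion[OF \<omega>(2), of u w] linear_basis_expansion[OF a, of w] by simp
  qed
  have linM: "linear M"
    by (rule linearI; rule vector_eq_rdot[THEN iffD1])
      (simp_all add: Mw inner_add_left linear_add[OF \<omega>(1)] linear_cmul[OF \<omega>(1)] linear_add[OF a] linear_cmul[OF a] algebra_simps)
  have \<omega>Z: "\<omega> u Z = 0" for u using \<omega>(3)[of u Z] Z by simp
  have "inj M"
    unfolding linear_injective_0[OF linM]
  proof (intro allI impI)
    fix u assume "M u = 0"
    then have eq: "\<omega> u w + a u * a w = 0" for w using Mw[of u w] by simp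
    from eq[of Z] have "a u = 0" using Z \<omega>Z by simp
    with eq show "u = 0" by (intro nd) auto
  qed
  then have "surj M" using linM linear_injective_imp_surjective by blast
  then obtain v where v: "M v = (\<Sum>i\<in>Basis. b i *\<^sub>R i)" by (metis surjD)
  have eq: "\<omega> v w + a v * a w = b w" for w
  proof -
    have "M v \<bullet> w = (\<Sum>i\<in>Basis. (w \<bullet> i) *\<^sub>R b i)" by (simp add: v inner_sum_left inner_commute[of w] mult.commute)
    then show ?thesis using Mw linear_basis_expansion[OF b(1)] by metis
  qed
  from eq[of Z] have "a v = 0" using Z \<omega>Z b by simp
  with eq show thesis using that by simp
qed

section \<open>One-forms on open sets\<close>

text \<open>The exterior derivative in coordinates, in the convention of \<open>ext_deriv\<close>: u
  and v stand for constant vector fields.\<close>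

definition form_deriv :: "('a::real_normed_vector \<Rightarrow> 'a \<Rightarrow> real) \<Rightarrow> 'a \<Rightarrow> 'a \<Rightarrow> 'a \<Rightarrow> real" where
  "form_deriv a z u v =
     frechet_derivative (\<lambda>z. a z v) (at z) u - frechet_derivative (\<lambda>z. a z u) (at z) v"

definition smooth_form_on :: "'a::real_normed_vector set \<Rightarrow> ('a \<Rightarrow> 'a \<Rightarrow> real) \<Rightarrow> bool" where
  "smooth_form_on S a \<longleftrightarrow> open S \<and> (\<forall>z\<in>S. linear (a z)) \<and> (\<forall>w. smooth_on S (\<lambda>z. a z w))"

lemma smooth_form_onD:
  assumes "smooth_form_on S a"
  shows "open S" "z \<in> S \<Longrightarrow> linear (a z)" "smooth_on S (\<lambda>z. a z w)"
  using assms unfolding smooth_form_on_def by blast+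

lemma smooth_form_on_derivative:
  assumes a: "smooth_form_on S a" and z: "z \<in> S"
  shows "((\<lambda>z. a z w) has_derivative frechet_derivative (\<lambda>z. a z w) (at z)) (at z)"
    "linear (frechet_derivative (\<lambda>z. a z w) (at z))"
  using smooth_on_has_derivative[OF smooth_form_onD(3)[OF a] z] has_derivative_linear by blast+

lemma form_deriv_antisym: "form_deriv a z u v = - form_deriv a z v u"
  by (simp add: form_deriv_def)

lemma linear_derivative_of_form:
  assumes a: "smooth_form_on S a" and z: "z \<in> S"
  shows "linear (\<lambda>v. frechet_derivative (\<lambda>z. a z v) (at z) u)"
proof (rule linearI)
  note D = smooth_form_on_derivative(1)[OF a z] and lin = smooth_form_onD(2)[OF a] and op = smooth_form_onD(1)[OF a]
  fix v w
  have "((\<lambda>z. a z (v + w)) has_derivative (\<lambda>u. frechet_derivative (\<lambda>z. a z v) (at z) u +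
      frechet_derivative (\<lambda>z. a z w) (at z) u)) (at z)"
    by (rule has_derivative_transform_within_open[OF has_derivative_add[OF D D] op z])
      (simp add: linear_add[OF lin])
  from frechet_derivative_at[OF this]
  show "frechet_derivative (\<lambda>z. a z (v + w)) (at z) u =
      frechet_derivative (\<lambda>z. a z v) (at z) u + frechet_derivative (\<lambda>z. a z w) (at z) u" by metis
next
  note D = smooth_form_on_derivative(1)[OF a z] and lin = smooth_form_onD(2)[OF a] and op = smooth_form_onD(1)[OF a]
  fix r v
  have "((\<lambda>z. a z (r *\<^sub>R v)) has_derivative (\<lambda>u. r *\<^sub>R frechet_derivative (\<lambda>z. a z v) (at z) u)) (at z)"
    by (rule has_derivative_transform_within_open[OF has_derivative_scaleR_right[OF D] op z])
      (simp add: linear_cmul[OF lin])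
  from frechet_derivative_at[OF this]
  show "frechet_derivative (\<lambda>z. a z (r *\<^sub>R v)) (at z) u = r *\<^sub>R frechet_derivative (\<lambda>z. a z v) (at z) u" by metis
qed

lemma form_deriv_linear:
  assumes "smooth_form_on S a" "z \<in> S"
  shows "linear (form_deriv a z u)" "linear (\<lambda>u. form_deriv a z u v)"
proof -
  have "linear (\<lambda>v. form_deriv a z u v)"
    unfolding form_deriv_def
    by (rule linear_compose_sub[OF linear_derivative_of_form[OF assms] smooth_form_on_derivative(2)[OF assms]])
  then show "linear (form_deriv a z u)" .
  show "linear (\<lambda>u. form_deriv a z u v)"
    unfolding form_deriv_def
    by (rule linear_compose_sub[OF smooth_form_on_derivative(2)[OF assms] linear_derivative_of_form[OF assms]])
qed

lemma smooth_on_form_deriv: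
  assumes "smooth_form_on S a"
  shows "smooth_on S (\<lambda>z. form_deriv a z u v)"
proof -
  have "Ck_on k S (\<lambda>z. frechet_derivative (\<lambda>z. a z v) (at z) u + (-1) *\<^sub>R frechet_derivative (\<lambda>z. a z u) (at z) v)" for k
    using smooth_on_derivative[OF smooth_form_onD(3)[OF assms]]
    by (intro Ck_on_add[OF smooth_form_onD(1)[OF assms]]
        Ck_on_scaleR[OF smooth_form_onD(1)[OF assms] Ck_on_const]) (auto simp: smooth_on_def)
  then show ?thesis by (simp add: smooth_on_def form_deriv_def)
qed

lemma has_derivative_form_field:
  fixes a :: "'a::euclidean_space \<Rightarrow> 'a \<Rightarrow> real"
  assumes a: "smooth_form_on S a" and z: "z \<in> S" and X: "(X has_derivative X') (at z)"
  shows "((\<lambda>z. a z (X z)) has_derivative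
    (\<lambda>u. frechet_derivative (\<lambda>y. a y (X z)) (at z) u + a z (X' u))) (at z)"
  by (rule has_derivative_linear_field[OF smooth_form_onD(1)[OF a] z smooth_form_onD(2)[OF a]
        differentiableI[OF smooth_form_on_derivative(1)[OF a z]] X])

text \<open>Naturality of d. The product rule produces second derivatives of \<tau>, which are
  symmetric and so cancel in the antisymmetric difference. Applied to chart transitions, it frees
  \<open>ext_deriv\<close> from the preferred chart.\<close>

lemma form_deriv_pullback:
  fixes \<tau> :: "'a::euclidean_space \<Rightarrow> 'b::euclidean_space"
  assumes "open S" "smooth_on S \<tau>" "\<tau> ` S \<subseteq> T" and a: "smooth_form_on T a" and z: "z \<in> S"
    and b: "\<And>z w. z \<in> S \<Longrightarrow> b z w = a (\<tau> z) (frechet_derivative \<tau> (at z) w)"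
  shows "form_deriv b z u v =
    form_deriv a (\<tau> z) (frechet_derivative \<tau> (at z) u) (frechet_derivative \<tau> (at z) v)"
proof -
  let ?D = "\<lambda>z. frechet_derivative \<tau> (at z)"
  have \<tau>: "(\<tau> has_derivative ?D z) (at z)" using smooth_on_has_derivative[OF assms(2) z] .
  have ac: "((\<lambda>z. a (\<tau> z) w) has_derivative
      (\<lambda>u. frechet_derivative (\<lambda>y. a y w) (at (\<tau> z)) (?D z u))) (at z)" for w
    using has_derivative_compose[OF \<tau> smooth_form_on_derivative(1)[OF a]] assms(3) z by blast
  have *: "frechet_derivative (\<lambda>z. b z v) (at z) u =
      frechet_derivative (\<lambda>y. a y (?D z v)) (at (\<tau> z)) (?D z u) +
      a (\<tau> z) (frechet_derivative (\<lambda>z. ?D z v) (at z) u)" for u v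
  proof -
    have "((\<lambda>z. a (\<tau> z) (?D z v)) has_derivative
       (\<lambda>u. frechet_derivative (\<lambda>y. a (\<tau> y) (?D z v)) (at z) u +
          a (\<tau> z) (frechet_derivative (\<lambda>z. ?D z v) (at z) u))) (at z)"
    proof (rule has_derivative_linear_field[OF \<open>open S\<close> z])
      show "linear (a (\<tau> z))" if "z \<in> S" for z using assms(3) that by (intro smooth_form_onD(2)[OF a]) auto
      show "((\<lambda>z. ?D z v) has_derivative frechet_derivative (\<lambda>z. ?D z v) (at z)) (at z)"
        by (rule smooth_on_has_derivative[OF smooth_on_derivative[OF assms(2)] z])
    qed (rule differentiableI[OF ac])
    then have "((\<lambda>z. b z v) has_derivative
       (\<lambda>u. frechet_derivative (\<lambda>y. a (\<tau> y) (?D z v)) (at z) u +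
          a (\<tau> z) (frechet_derivative (\<lambda>z. ?D z v) (at z) u))) (at z)"
      by (rule has_derivative_transform_within_open[OF _ \<open>open S\<close> z]) (simp add: b)
    from frechet_derivative_at[OF this, symmetric] frechet_derivative_at[OF ac, symmetric]
    show ?thesis by simp
  qed
  show ?thesis
    unfolding form_deriv_def * second_derivative_symmetric[OF \<open>open S\<close> assms(2) z, of u v] by simp
qed

text \<open>Differentiate \<open>a(G\<^sub>t(p))(DG\<^sub>t v) = 0\<close> at \<open>t = 0\<close>.\<close>
lemma flow_preserves_kernel_infinitesimal:
  fixes G :: "real \<times> 'a::euclidean_space \<Rightarrow> 'a"
  assumes N: "open N" "(0, p) \<in> N" and G: "smooth_on N G"
    and a: "smooth_form_on S a" and GS: "G ` N \<subseteq> S"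
    and X: "(X has_derivative X') (at p)"
    and G0: "\<And>y. (0, y) \<in> N \<Longrightarrow> G (0, y) = y"
    and flow: "\<And>t y. (t, y) \<in> N \<Longrightarrow> frechet_derivative G (at (t, y)) (1, 0) = X (G (t, y))"
    and ker: "\<And>t. (t, p) \<in> N \<Longrightarrow> a (G (t, p)) (frechet_derivative G (at (t, p)) (0, v)) = 0"
  shows "frechet_derivative (\<lambda>z. a z v) (at p) (X p) + a p (X' v) = 0"
proof -
  let ?D = "\<lambda>q. frechet_derivative G (at q)"
  have p: "G (0, p) = p" "p \<in> S" using G0[OF N(2)] GS N by force+
  have DG: "(G has_derivative ?D q) (at q)" if "q \<in> N" for q
    using smooth_on_has_derivative[OF G that] .
  have DDG: "((\<lambda>q. ?D q w) has_derivative frechet_derivative (\<lambda>q. ?D q w) (at (0, p))) (at (0, p))" for w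
    using smooth_on_has_derivative[OF smooth_on_derivative[OF G] N(2)] .
  have line1: "((\<lambda>t. (t, p)) has_derivative (\<lambda>d. (d, 0))) (at (0::real))"
    by (auto intro!: derivative_eq_intros)
  have line2: "((\<lambda>y. (0::real, y)) has_derivative (\<lambda>d. (0, d))) (at p)"
    by (auto intro!: derivative_eq_intros)
  have open2: "open {y. (0, y) \<in> N}" "open {t. (t, p) \<in> N}"
    using N(1) by (auto intro!: open_vimage[of N, unfolded vimage_def] continuous_intros)
  have w0: "?D (0, p) (0, d) = d" for d
  proof -
    have "((\<lambda>y. G (0, y)) has_derivative (\<lambda>d. ?D (0, p) (0, d))) (at p)"
      using has_derivative_compose[OF line2 DG[OF N(2)]] .
    then have "((\<lambda>y. y) has_derivative (\<lambda>d. ?D (0, p) (0, d))) (at p)"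
      by (rule has_derivative_transform_within_open[OF _ open2(1)]) (use N G0 in auto)
    from has_derivative_unique[OF this has_derivative_ident] show ?thesis by metis
  qed
  \<comment> \<open>Mixed derivatives commute: the t-derivative at t = 0 of the space derivative of
    G is the space derivative of the velocity, and that velocity is X at t = 0.\<close>
  have w': "frechet_derivative (\<lambda>q. ?D q (0, v)) (at (0, p)) (1, 0) = X' v"
  proof -
    have "((\<lambda>y. ?D (0, y) (1, 0)) has_derivative
        (\<lambda>d. frechet_derivative (\<lambda>q. ?D q (1, 0)) (at (0, p)) (0, d))) (at p)"
      using has_derivative_compose[OF line2 DDG] .
    then have "(X has_derivative
        (\<lambda>d. frechet_derivative (\<lambda>q. ?D q (1, 0)) (at (0, p)) (0, d))) (at p)"
      by (rule has_derivative_transform_within_open[OF _ open2(1)]) (use N G0 flow in auto)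
    from has_derivative_unique[OF this X]
    have "frechet_derivative (\<lambda>q. ?D q (1, 0)) (at (0, p)) (0, v) = X' v" by metis
    then show ?thesis using second_derivative_symmetric[OF N(1) G N(2)] by metis
  qed
  let ?T = "{t. (t, p) \<in> N}"
  have D1: "((\<lambda>t. a (G (t, p)) u) has_derivative
      (\<lambda>d. frechet_derivative (\<lambda>z. a z u) (at p) (?D (0, p) (d, 0)))) (at 0)" for u
    using has_derivative_compose[OF has_derivative_compose[OF line1 DG[OF N(2)]], of "\<lambda>z. a z u" "frechet_derivative (\<lambda>z. a z u) (at p)"]
      smooth_form_on_derivative(1)[OF a p(2)] p by simp
  have E1: "((\<lambda>t. a (G (t, p)) (?D (t, p) (0, v))) has_derivative
     (\<lambda>d. frechet_derivative (\<lambda>t. a (G (t, p)) (?D (0, p) (0, v))) (at 0) d +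
        a (G (0, p)) (frechet_derivative (\<lambda>q. ?D q (0, v)) (at (0, p)) (d, 0)))) (at 0)"
  proof (rule has_derivative_linear_field[OF open2(2)])
    show "linear (a (G (t, p)))" if "t \<in> ?T" for t
      using that GS by (intro smooth_form_onD(2)[OF a]) auto
    show "((\<lambda>t. ?D (t, p) (0, v)) has_derivative
        (\<lambda>d. frechet_derivative (\<lambda>q. ?D q (0, v)) (at (0, p)) (d, 0))) (at 0)"
      using has_derivative_compose[OF line1 DDG] .
  qed (use N D1 in \<open>auto simp: differentiable_def\<close>)
  have E2: "((\<lambda>t. a (G (t, p)) (?D (t, p) (0, v))) has_derivative (\<lambda>d. 0)) (at 0)"
    by (rule has_derivative_transform_within_open[OF has_derivative_const open2(2)]) (use N ker in auto)
  have "frechet_derivative (\<lambda>t. a (G (t, p)) (?D (0, p) (0, v))) (at 0) 1 +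
        a (G (0, p)) (frechet_derivative (\<lambda>q. ?D q (0, v)) (at (0, p)) (1, 0)) = 0"
    by (rule fun_cong[OF has_derivative_unique[OF E1 E2]])
  moreover have "?D (0, p) (1, 0) = X p" using flow[OF N(2)] unfolding p(1) .
  ultimately show ?thesis
    by (simp add: w0 w' p frechet_derivative_at[OF D1, symmetric])
qed

text \<open>\<open>lie\<close> is L_Y a = 0 in coordinates, and the conclusion is L_Y da = 0.
  Differentiating \<open>lie\<close> in direction u and antisymmetrising in u and v cancels the
  second derivatives of Y and collects the other terms into da.\<close>

lemma lie_transport_form_deriv:
  fixes a :: "'a::euclidean_space \<Rightarrow> 'a \<Rightarrow> real"
  assumes a: "smooth_form_on S a" and Y: "smooth_on S Y" and z: "z \<in> S"
    and lie: "\<And>z w. z \<in> S \<Longrightarrow>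
      frechet_derivative (\<lambda>y. a y w) (at z) (Y z) + a z (frechet_derivative Y (at z) w) = 0"
  shows "frechet_derivative (\<lambda>z. form_deriv a z u v) (at z) (Y z) =
    - form_deriv a z (frechet_derivative Y (at z) u) v - form_deriv a z u (frechet_derivative Y (at z) v)"
proof -
  let ?Y = "\<lambda>z. frechet_derivative Y (at z)"
  let ?a = "\<lambda>z v. frechet_derivative (\<lambda>y. a y v) (at z)"
  note op = smooth_form_onD(1)[OF a] and sm = smooth_form_onD(3)[OF a]
  have *: "frechet_derivative (\<lambda>z. ?a z v u) (at z) (Y z) =
     - ?a z v (?Y z u) - ?a z (?Y z v) u - a z (frechet_derivative (\<lambda>z. ?Y z v) (at z) u)" for u v
  proof -
    have E1: "((\<lambda>z. ?a z v (Y z)) has_derivative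
      (\<lambda>u. frechet_derivative (\<lambda>y. ?a y v (Y z)) (at z) u + ?a z v (?Y z u))) (at z)"
      by (rule has_derivative_linear_field[OF op z smooth_form_on_derivative(2)[OF a]
            smooth_on_differentiable[OF smooth_on_derivative[OF sm] z] smooth_on_has_derivative[OF Y z]])
    have E2: "((\<lambda>z. - a z (?Y z v)) has_derivative
      (\<lambda>u. - (?a z (?Y z v) u + a z (frechet_derivative (\<lambda>z. ?Y z v) (at z) u)))) (at z)"
      by (intro has_derivative_minus has_derivative_form_field[OF a z]
          smooth_on_has_derivative[OF smooth_on_derivative[OF Y] z])
    then have E2: "((\<lambda>z. ?a z v (Y z)) has_derivative
      (\<lambda>u. - (?a z (?Y z v) u + a z (frechet_derivative (\<lambda>z. ?Y z v) (at z) u)))) (at z)"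
      by (rule has_derivative_transform_within_open[OF _ op z]) (use lie in \<open>simp add: add_eq_0_iff\<close>)
    have "frechet_derivative (\<lambda>y. ?a y v (Y z)) (at z) u + ?a z v (?Y z u) =
        - (?a z (?Y z v) u + a z (frechet_derivative (\<lambda>z. ?Y z v) (at z) u))"
      by (rule fun_cong[OF has_derivative_unique[OF E1 E2]])
    then show ?thesis
      using second_derivative_symmetric[OF op sm z, of v u "Y z"] by simp
  qed
  have "((\<lambda>z. form_deriv a z u v) has_derivative (\<lambda>w. frechet_derivative (\<lambda>z. ?a z v u) (at z) w -
      frechet_derivative (\<lambda>z. ?a z u v) (at z) w)) (at z)"
    unfolding form_deriv_def
    by (intro has_derivative_diff smooth_on_has_derivative[OF smooth_on_derivative[OF sm] z])
  then have "frechet_derivative (\<lambda>z. form_deriv a z u v) (at z) (Y z) =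
      frechet_derivative (\<lambda>z. ?a z v u) (at z) (Y z) - frechet_derivative (\<lambda>z. ?a z u v) (at z) (Y z)"
    by (rule fun_cong[OF frechet_derivative_at, symmetric])
  also have "\<dots> = - form_deriv a z (?Y z u) v - form_deriv a z u (?Y z v)"
    unfolding * second_derivative_symmetric[OF op Y z, of u v] by (simp add: form_deriv_def)
  finally show ?thesis .
qed

section \<open>Charts and tangent maps\<close>

text \<open>The derivative of the change from the preferred chart at x to c: a tangent vector at x,
  stored in the coordinates of \<open>chart_at A x\<close>, goes to its components in c.\<close>

definition tangent_map :: "('m, 'e::euclidean_space) chart set \<Rightarrow> ('m, 'e) chart \<Rightarrow> 'm \<Rightarrow> 'e \<Rightarrow> 'e" where
  "tangent_map A c x = frechet_derivative (snd c \<circ> chart_inv (chart_at A x)) (at (snd (chart_at A x) x))"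

lemma vec_rep_eq: "vec_rep A c X y = tangent_map A c (chart_inv c y) (X (chart_inv c y))"
  by (simp add: vec_rep_def tangent_map_def Let_def)

lemma chart_inv_std: "chart_inv (UNIV, \<lambda>x. x) = (\<lambda>x. x)"
  by (simp add: chart_inv_def inv_into_def fun_eq_iff)

lemma chart_at_std: "chart_at std_atlas x = (UNIV, \<lambda>x. x)"
  by (auto simp: chart_at_def std_atlas_def)

locale smooth_atlas =
  fixes A :: "('m::{t2_space,second_countable_topology}, 'e::euclidean_space) chart set"
  assumes manifold: "smooth_manifold A"
begin

lemma chart_at: "chart_at A x \<in> A" "x \<in> fst (chart_at A x)"
proof -
  have "\<exists>c. c \<in> A \<and> x \<in> fst c" using manifold unfolding smooth_manifold_def by blast
  from someI_ex[OF this] show "chart_at A x \<in> A" "x \<in> fst (chart_at A x)" unfolding chart_at_def by blast+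
qed

lemma chart_homeomorphism:
  "c \<in> A \<Longrightarrow> homeomorphism (fst c) (snd c ` fst c) (snd c) (chart_inv c)"
  and open_chart: "c \<in> A \<Longrightarrow> open (fst c)" "c \<in> A \<Longrightarrow> open (snd c ` fst c)"
  using manifold unfolding smooth_manifold_def by blast+

lemma chart_inv_left: "c \<in> A \<Longrightarrow> x \<in> fst c \<Longrightarrow> chart_inv c (snd c x) = x"
  using chart_homeomorphism unfolding homeomorphism_def by blast

lemma chart_inv_right:
  assumes "c \<in> A" "y \<in> snd c ` fst c"
  shows "snd c (chart_inv c y) = y" "chart_inv c y \<in> fst c"
  using assms(2) chart_inv_left[OF assms(1)] by auto

lemma continuous_on_chart:
  "c \<in> A \<Longrightarrow> continuous_on (fst c) (snd c)"
  "c \<in> A \<Longrightarrow> continuous_on (snd c ` fst c) (chart_inv c)"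
  using chart_homeomorphism unfolding homeomorphism_def by blast+

lemma open_chart_image:
  assumes "c \<in> A" "open U"
  shows "open (snd c ` (U \<inter> fst c))"
proof -
  have "snd c ` (U \<inter> fst c) = chart_inv c -` U \<inter> snd c ` fst c"
    by (auto simp: chart_inv_left[OF assms(1)])
  then show ?thesis
    using continuous_on_open_vimage[OF open_chart(2)[OF assms(1)], of "chart_inv c"]
      continuous_on_chart(2)[OF assms(1)] assms(2) by auto
qed

lemma open_overlap: "c \<in> A \<Longrightarrow> d \<in> A \<Longrightarrow> open (snd c ` (fst c \<inter> fst d))"
  using open_chart_image[OF _ open_chart(1), of c d] by (simp add: Int_commute)

lemma smooth_transition:
  "c \<in> A \<Longrightarrow> d \<in> A \<Longrightarrow> smooth_on (snd c ` (fst c \<inter> fst d)) (snd d \<circ> chart_inv c)"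
  using manifold unfolding smooth_manifold_def by blast

lemma transition_has_derivative:
  assumes "c \<in> A" "d \<in> A" "x \<in> fst c" "x \<in> fst d"
  shows "((snd d \<circ> chart_inv c) has_derivative
    frechet_derivative (snd d \<circ> chart_inv c) (at (snd c x))) (at (snd c x))"
  by (rule smooth_on_has_derivative[OF smooth_transition]) (use assms in auto)

lemma transition_image:
  assumes "c \<in> A" "d \<in> A"
  shows "(snd d \<circ> chart_inv c) ` (snd c ` (fst c \<inter> fst d)) \<subseteq> snd d ` (fst d \<inter> fst c)"
  using chart_inv_left[OF assms(1)] by auto

lemma has_derivative_change_chart:
  assumes "c \<in> A" "d \<in> A" "x \<in> fst c" "x \<in> fst d"
    and F: "((F \<circ> chart_inv d) has_derivative D) (at (snd d x))"
  shows "((F \<circ> chart_inv c) has_derivative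
    (\<lambda>v. D (frechet_derivative (snd d \<circ> chart_inv c) (at (snd c x)) v))) (at (snd c x))"
proof -
  have "((\<lambda>z. (F \<circ> chart_inv d) ((snd d \<circ> chart_inv c) z)) has_derivative
    (\<lambda>v. D (frechet_derivative (snd d \<circ> chart_inv c) (at (snd c x)) v))) (at (snd c x))"
    by (rule has_derivative_compose[OF transition_has_derivative[OF assms(1-4)]])
      (use F chart_inv_left[OF assms(1,3)] in \<open>simp add: o_def\<close>)
  then show ?thesis
  proof (rule has_derivative_transform_within_open[OF _ open_overlap[OF assms(1,2)]])
    show "(F \<circ> chart_inv d) ((snd d \<circ> chart_inv c) z) = (F \<circ> chart_inv c) z"
      if "z \<in> snd c ` (fst c \<inter> fst d)" for z
      using that chart_inv_left[OF assms(1)] chart_inv_left[OF assms(2)] by auto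
  qed (use assms in auto)
qed

lemma transition_derivative_chain:
  assumes "b \<in> A" "c \<in> A" "d \<in> A" "x \<in> fst b" "x \<in> fst c" "x \<in> fst d"
  shows "frechet_derivative (snd d \<circ> chart_inv b) (at (snd b x)) v =
    frechet_derivative (snd d \<circ> chart_inv c) (at (snd c x))
      (frechet_derivative (snd c \<circ> chart_inv b) (at (snd b x)) v)"
  using fun_cong[OF frechet_derivative_at[OF has_derivative_change_chart[OF assms(1,2,4,5)
      transition_has_derivative[OF assms(2,3,5,6)]]], of v] by simp

lemma transition_derivative_refl:
  assumes "c \<in> A" "x \<in> fst c"
  shows "frechet_derivative (snd c \<circ> chart_inv c) (at (snd c x)) v = v"
proof -
  have "((snd c \<circ> chart_inv c) has_derivative (\<lambda>v. v)) (at (snd c x))"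
    by (rule has_derivative_transform_within_open[OF has_derivative_ident open_chart(2)[OF assms(1)]])
      (use assms chart_inv_right[OF assms(1)] in auto)
  from fun_cong[OF frechet_derivative_at[OF this]] show ?thesis by simp
qed

lemma tangent_map_transition:
  assumes "b \<in> A" "c \<in> A" "x \<in> fst b" "x \<in> fst c"
  shows "frechet_derivative (snd c \<circ> chart_inv b) (at (snd b x)) (tangent_map A b x v) = tangent_map A c x v"
  unfolding tangent_map_def
  using transition_derivative_chain[OF chart_at(1) assms(1,2) chart_at(2) assms(3,4)] by simp

lemma tangent_map_chart_at: "tangent_map A (chart_at A x) x v = v"
  unfolding tangent_map_def by (rule transition_derivative_refl[OF chart_at])

lemma tangent_map_inverse:
  assumes "c \<in> A" "x \<in> fst c"
  shows "frechet_derivative (snd (chart_at A x) \<circ> chart_inv c) (at (snd c x)) (tangent_map A c x v) = v"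
    "tangent_map A c x (frechet_derivative (snd (chart_at A x) \<circ> chart_inv c) (at (snd c x)) v) = v"
proof -
  show "frechet_derivative (snd (chart_at A x) \<circ> chart_inv c) (at (snd c x)) (tangent_map A c x v) = v"
    using tangent_map_transition[OF assms(1) chart_at(1) assms(2) chart_at(2)] tangent_map_chart_at by simp
  show "tangent_map A c x (frechet_derivative (snd (chart_at A x) \<circ> chart_inv c) (at (snd c x)) v) = v"
    unfolding tangent_map_def
    using transition_derivative_chain[OF assms(1) chart_at(1) assms(1) assms(2) chart_at(2) assms(2)]
      transition_derivative_refl[OF assms] by simp
qed

lemma linear_tangent_map: "c \<in> A \<Longrightarrow> x \<in> fst c \<Longrightarrow> linear (tangent_map A c x)"
  unfolding tangent_map_def
  using has_derivative_linear[OF transition_has_derivative[OF chart_at(1) _ chart_at(2)]] .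

lemma tangent_map_surj:
  assumes "c \<in> A" "x \<in> fst c"
  obtains v where "w = tangent_map A c x v"
  using tangent_map_inverse(2)[OF assms] by metis

lemma vec_rep_at_point:
  assumes "c \<in> A" "x \<in> fst c"
  shows "vec_rep A c X (snd c x) = tangent_map A c x (X x)"
  by (simp add: vec_rep_eq chart_inv_left[OF assms])

lemma form_rep_tangent_map:
  assumes "c \<in> A" "x \<in> fst c"
  shows "form_rep A c \<alpha> (snd c x) (tangent_map A c x v) = \<alpha> x v"
  unfolding form_rep_def by (simp add: chart_inv_left[OF assms] tangent_map_inverse(1)[OF assms] Let_def)

lemma form_rep_vec_rep:
  assumes "c \<in> A" "y \<in> snd c ` fst c"
  shows "form_rep A c \<alpha> y (vec_rep A c X y) = \<alpha> (chart_inv c y) (X (chart_inv c y))"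
  using form_rep_tangent_map[OF assms(1) chart_inv_right(2)[OF assms]] chart_inv_right(1)[OF assms]
  by (simp add: vec_rep_eq)

lemma form_rep_transition:
  assumes "b \<in> A" "c \<in> A" "z \<in> snd b ` (fst b \<inter> fst c)"
  shows "form_rep A b \<alpha> z w = form_rep A c \<alpha> ((snd c \<circ> chart_inv b) z)
    (frechet_derivative (snd c \<circ> chart_inv b) (at z) w)"
proof -
  obtain x where x: "x \<in> fst b" "x \<in> fst c" "z = snd b x" using assms(3) by auto
  obtain v where v: "w = tangent_map A b x v" using tangent_map_surj[OF assms(1) x(1)] .
  show ?thesis
    using form_rep_tangent_map[OF assms(1) x(1), of \<alpha> v] form_rep_tangent_map[OF assms(2) x(2), of \<alpha> v]
      tangent_map_transition[OF assms(1,2) x(1,2)]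
    by (simp add: x(3) v chart_inv_left[OF assms(1) x(1)])
qed

lemma smooth_form_rep:
  assumes \<alpha>: "smooth_one_form A \<alpha>" and c: "c \<in> A"
  shows "smooth_form_on (snd c ` fst c) (form_rep A c \<alpha>)"
  unfolding smooth_form_on_def
proof (intro conjI ballI allI)
  show "open (snd c ` fst c)" by (rule open_chart(2)[OF c])
  show "smooth_on (snd c ` fst c) (\<lambda>z. form_rep A c \<alpha> z w)" for w
    using \<alpha> c unfolding smooth_one_form_def by blast
  fix z assume "z \<in> snd c ` fst c"
  then obtain x where x: "x \<in> fst c" "z = snd c x" by blast
  have "linear (frechet_derivative (snd (chart_at A x) \<circ> chart_inv c) (at (snd c x)))"
    by (rule has_derivative_linear[OF transition_has_derivative[OF c chart_at(1) x(1) chart_at(2)]])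
  moreover have "linear (\<alpha> x)" using \<alpha> unfolding smooth_one_form_def by blast
  ultimately have "linear (\<lambda>w. \<alpha> x (frechet_derivative (snd (chart_at A x) \<circ> chart_inv c) (at (snd c x)) w))"
    using linear_compose by (auto simp: o_def)
  then show "linear (form_rep A c \<alpha> z)"
    by (simp add: form_rep_def[abs_def] x(2) chart_inv_left[OF c x(1)] Let_def)
qed

text \<open>\<open>ext_deriv\<close> is computed in the preferred chart, which jumps with x; here
  one chart serves for all points of its domain. Transitions pull the representatives of \<alpha>
  back to one another, and d is natural.\<close>

lemma ext_deriv_chart:
  assumes \<alpha>: "smooth_one_form A \<alpha>" and c: "c \<in> A" "x \<in> fst c"
  shows "ext_deriv A \<alpha> x u v =
    form_deriv (form_rep A c \<alpha>) (snd c x) (tangent_map A c x u) (tangent_map A c x v)"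
proof -
  let ?b = "chart_at A x"
  have "form_deriv (form_rep A ?b \<alpha>) (snd ?b x) u v = form_deriv (form_rep A c \<alpha>) ((snd c \<circ> chart_inv ?b) (snd ?b x))
    (frechet_derivative (snd c \<circ> chart_inv ?b) (at (snd ?b x)) u)
    (frechet_derivative (snd c \<circ> chart_inv ?b) (at (snd ?b x)) v)"
  proof (rule form_deriv_pullback[OF open_overlap smooth_transition _ smooth_form_rep[OF \<alpha> c(1)]])
    show "(snd c \<circ> chart_inv ?b) ` (snd ?b ` (fst ?b \<inter> fst c)) \<subseteq> snd c ` fst c"
      using transition_image[OF chart_at(1) c(1)] by blast
    show "snd ?b x \<in> snd ?b ` (fst ?b \<inter> fst c)" using chart_at c by blast
  qed (use chart_at c form_rep_transition in auto)
  then show ?thesis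
    by (simp add: ext_deriv_def form_deriv_def Let_def tangent_map_def chart_inv_left[OF chart_at])
qed

section \<open>Smooth maps, vector fields and integral curves in charts\<close>

lemma smooth_map_chart:
  fixes B :: "('w::topological_space, 'f::euclidean_space) chart set"
  assumes f: "smooth_map A B U f" and c: "c \<in> A" and d: "d \<in> B" "open (fst d)"
  shows "open (snd c ` (U \<inter> fst c \<inter> f -` fst d))"
    "smooth_on (snd c ` (U \<inter> fst c \<inter> f -` fst d)) (snd d \<circ> f \<circ> chart_inv c)"
proof -
  have "open U" "continuous_on U f" using f unfolding smooth_map_def by blast+
  then have "open (f -` fst d \<inter> U)" using d(2) by (simp add: continuous_on_open_vimage)
  from open_chart_image[OF c this] show "open (snd c ` (U \<inter> fst c \<inter> f -` fst d))"
    by (simp add: ac_simps)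
  show "smooth_on (snd c ` (U \<inter> fst c \<inter> f -` fst d)) (snd d \<circ> f \<circ> chart_inv c)"
    using f c d unfolding smooth_map_def by blast
qed

text \<open>Only the source chart is changed. The target chart stays
  \<open>chart_at B (f x)\<close>, which is common to all points with the same image, so it does not
  jump along a fibre.\<close>

lemma mderiv_chart:
  assumes c: "c \<in> A" "x \<in> fst c"
    and F: "(snd (chart_at B (f x)) \<circ> f \<circ> chart_inv c) differentiable (at (snd c x))"
  shows "mderiv A B f x v =
    frechet_derivative (snd (chart_at B (f x)) \<circ> f \<circ> chart_inv c) (at (snd c x)) (tangent_map A c x v)"
proof -
  have "((snd (chart_at B (f x)) \<circ> f \<circ> chart_inv (chart_at A x)) has_derivative
     (\<lambda>v. frechet_derivative (snd (chart_at B (f x)) \<circ> f \<circ> chart_inv c) (at (snd c x)) (tangent_map A c x v)))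
     (at (snd (chart_at A x) x))"
    unfolding tangent_map_def using F frechet_derivative_works
    by (intro has_derivative_change_chart[OF chart_at(1) c(1) chart_at(2) c(2)]) blast
  from fun_cong[OF frechet_derivative_at[OF this], of v] show ?thesis by (simp add: mderiv_def)
qed

lemma smooth_function_chart:
  assumes f: "smooth_map A std_atlas U (f :: 'm \<Rightarrow> 'k::euclidean_space)" and c: "c \<in> A"
  shows "open (snd c ` (U \<inter> fst c))" "smooth_on (snd c ` (U \<inter> fst c)) (f \<circ> chart_inv c)"
    "x \<in> U \<Longrightarrow> x \<in> fst c \<Longrightarrow>
      mderiv A std_atlas f x v = frechet_derivative (f \<circ> chart_inv c) (at (snd c x)) (tangent_map A c x v)"
proof -
  have *: "(UNIV, \<lambda>x. x) \<in> std_atlas" "open (fst (UNIV, \<lambda>x. x))" by (simp_all add: std_atlas_def)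
  have id: "(\<lambda>x. x) \<circ> f \<circ> chart_inv c = f \<circ> chart_inv c" by auto
  note sm = smooth_map_chart[OF f c *]
  show 1: "open (snd c ` (U \<inter> fst c))" using sm(1) by simp
  show 2: "smooth_on (snd c ` (U \<inter> fst c)) (f \<circ> chart_inv c)" using sm(2) by (simp add: id)
  show "mderiv A std_atlas f x v = frechet_derivative (f \<circ> chart_inv c) (at (snd c x)) (tangent_map A c x v)"
    if "x \<in> U" "x \<in> fst c"
  proof -
    have "(f \<circ> chart_inv c) differentiable (at (snd c x))"
      by (rule smooth_on_differentiable[OF 2]) (use that in auto)
    then show ?thesis using mderiv_chart[OF c that(2), of std_atlas f v] by (simp add: chart_at_std id)
  qed
qed

lemma smooth_mapI_std:
  fixes f :: "'m \<Rightarrow> 'k::euclidean_space"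
  assumes "open U" and f: "\<And>c. c \<in> A \<Longrightarrow> smooth_on (snd c ` (U \<inter> fst c)) (f \<circ> chart_inv c)"
  shows "smooth_map A std_atlas U f"
proof -
  have "continuous_on U f"
    unfolding continuous_on_eq_continuous_at[OF \<open>open U\<close>]
  proof
    fix x assume x: "x \<in> U"
    let ?c = "chart_at A x"
    have "continuous_on (U \<inter> fst ?c) (\<lambda>z. (f \<circ> chart_inv ?c) (snd ?c z))"
    proof (rule continuous_on_compose2[OF smooth_on_continuous_on[OF f[OF chart_at(1)]]])
      show "continuous_on (U \<inter> fst ?c) (snd ?c)"
        using continuous_on_subset[OF continuous_on_chart(1)[OF chart_at(1)]] by blast
    qed auto
    then have "continuous_on (U \<inter> fst ?c) f"
      by (rule continuous_on_eq) (simp add: chart_inv_left[OF chart_at(1)])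
    moreover have "open (U \<inter> fst ?c)" using assms open_chart(1)[OF chart_at(1)] by blast
    ultimately show "isCont f x"
      using x chart_at(2) continuous_on_eq_continuous_at by blast
  qed
  moreover have "(\<lambda>x. x) \<circ> f = f" by auto
  ultimately show ?thesis
    using assms by (simp add: smooth_map_def std_atlas_def)
qed

lemma smooth_vector_fieldD:
  assumes "smooth_vector_field A U X" "c \<in> A"
  shows "open U" "smooth_on (snd c ` (U \<inter> fst c)) (vec_rep A c X)" "open (snd c ` (U \<inter> fst c))"
proof -
  show "open U" "smooth_on (snd c ` (U \<inter> fst c)) (vec_rep A c X)"
    using assms unfolding smooth_vector_field_def by blast+
  then show "open (snd c ` (U \<inter> fst c))" using open_chart_image[OF assms(2)] by blast
qed

text \<open>The derivative of \<alpha> in direction v with the vector Y frozen occurs in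
  d(\<alpha>(Y)) and, with opposite sign, in d\<alpha>(Y, v). What is left of Cartan's formula is
  the expression that \<open>lie_transport_form_deriv\<close> takes as its hypothesis.\<close>

lemma lie_deriv_chart:
  assumes \<alpha>: "smooth_one_form A \<alpha>" and Y: "smooth_vector_field A UNIV Y" and c: "c \<in> A" "x \<in> fst c"
  shows "lie_deriv A Y \<alpha> x v =
    frechet_derivative (\<lambda>y. form_rep A c \<alpha> y (tangent_map A c x v)) (at (snd c x)) (vec_rep A c Y (snd c x)) +
    form_rep A c \<alpha> (snd c x) (frechet_derivative (vec_rep A c Y) (at (snd c x)) (tangent_map A c x v))"
proof -
  let ?a = "form_rep A c \<alpha>" and ?Y = "vec_rep A c Y" and ?z = "snd c x" and ?w = "tangent_map A c x v"
  let ?S = "snd c ` fst c" and ?f = "\<lambda>z. \<alpha> z (Y z)"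
  note a = smooth_form_rep[OF \<alpha> c(1)]
  have Ys: "smooth_on ?S ?Y" using smooth_vector_fieldD(2)[OF Y c(1)] by simp
  have z: "?z \<in> ?S" using c by blast
  have eq: "?a y (?Y y) = (?f \<circ> chart_inv c) y" if "y \<in> ?S" for y
    using form_rep_vec_rep[OF c(1) that] by simp
  have D: "((\<lambda>y. ?a y (?Y y)) has_derivative
      (\<lambda>u. frechet_derivative (\<lambda>y. ?a y (?Y ?z)) (at ?z) u + ?a ?z (frechet_derivative ?Y (at ?z) u))) (at ?z)"
    by (rule has_derivative_form_field[OF a z smooth_on_has_derivative[OF Ys z]])
  have D': "((?f \<circ> chart_inv c) has_derivative
      (\<lambda>u. frechet_derivative (\<lambda>y. ?a y (?Y ?z)) (at ?z) u + ?a ?z (frechet_derivative ?Y (at ?z) u))) (at ?z)"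
    by (rule has_derivative_transform_within_open[OF D smooth_form_onD(1)[OF a] z]) (rule eq)
  have id: "(\<lambda>x. x) \<circ> ?f \<circ> chart_inv c = ?f \<circ> chart_inv c" by auto
  have "mderiv A std_atlas ?f x v = frechet_derivative (?f \<circ> chart_inv c) (at ?z) ?w"
    using mderiv_chart[OF c, of std_atlas ?f v] differentiableI[OF D'] by (simp add: chart_at_std id)
  also have "\<dots> = frechet_derivative (\<lambda>y. ?a y (?Y ?z)) (at ?z) ?w + ?a ?z (frechet_derivative ?Y (at ?z) ?w)"
    by (rule fun_cong[OF frechet_derivative_at[OF D'], symmetric])
  finally show ?thesis
    by (simp add: lie_deriv_def ext_deriv_chart[OF \<alpha> c] form_deriv_def vec_rep_at_point[OF c])
qed

text \<open>\<open>integral_curve\<close> fixes the velocity in the preferred chart at the current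
  point; composition with the transition gives it in any chart around that point.\<close>

lemma integral_curve_chart:
  assumes \<gamma>: "integral_curve A Y \<gamma> a b" and t: "t \<in> {a<..<b}" and c: "c \<in> A" "\<gamma> t \<in> fst c"
  shows "((\<lambda>s. snd c (\<gamma> s)) has_vector_derivative vec_rep A c Y (snd c (\<gamma> t))) (at t)"
    "open {s \<in> {a<..<b}. \<gamma> s \<in> fst c}"
proof -
  have \<gamma>s: "smooth_map std_atlas A {a<..<b} \<gamma>" and der: "mderiv std_atlas A \<gamma> t 1 = Y (\<gamma> t)"
    using \<gamma> t unfolding integral_curve_def by blast+
  then have cont: "continuous_on {a<..<b} \<gamma>" unfolding smooth_map_def by blast
  have sm: "smooth_on ({a<..<b} \<inter> \<gamma> -` fst d) (snd d \<circ> \<gamma>)" if d: "d \<in> A" for d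
  proof -
    let ?i = "(UNIV, \<lambda>x. x) :: (real, real) chart"
    have "?i \<in> std_atlas" by (simp add: std_atlas_def)
    with \<gamma>s d have "smooth_on (snd ?i ` ({a<..<b} \<inter> fst ?i \<inter> \<gamma> -` fst d)) (snd d \<circ> \<gamma> \<circ> chart_inv ?i)"
      unfolding smooth_map_def by blast
    then show ?thesis by (simp add: chart_inv_std o_def)
  qed
  let ?p = "chart_at A (\<gamma> t)"
  have op: "open {s \<in> {a<..<b}. \<gamma> s \<in> fst d}" if "d \<in> A" for d
  proof -
    have "open (\<gamma> -` fst d \<inter> {a<..<b})"
      using cont open_chart(1)[OF that] by (simp add: continuous_on_open_vimage)
    moreover have "\<gamma> -` fst d \<inter> {a<..<b} = {s \<in> {a<..<b}. \<gamma> s \<in> fst d}" by auto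
    ultimately show ?thesis by simp
  qed
  show "open {s \<in> {a<..<b}. \<gamma> s \<in> fst c}" by (rule op[OF c(1)])
  let ?D = "frechet_derivative (snd ?p \<circ> \<gamma>) (at t)"
  have D: "((snd ?p \<circ> \<gamma>) has_derivative ?D) (at t)"
    by (rule smooth_on_has_derivative[OF sm[OF chart_at(1)]]) (use t chart_at in simp)
  have "?D 1 = Y (\<gamma> t)"
    using der by (simp add: mderiv_def chart_at_std chart_inv_std o_def)
  then have "?D h = h *\<^sub>R Y (\<gamma> t)" for h
    using linear_cmul[OF has_derivative_linear[OF D], of h 1] by simp
  then have "?D = (\<lambda>h. h *\<^sub>R Y (\<gamma> t))" by (rule ext)
  with D have 1: "((\<lambda>s. snd ?p (\<gamma> s)) has_derivative (\<lambda>h. h *\<^sub>R Y (\<gamma> t))) (at t)"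
    by (simp add: o_def)
  have "((\<lambda>s. (snd c \<circ> chart_inv ?p) (snd ?p (\<gamma> s))) has_derivative
     (\<lambda>h. frechet_derivative (snd c \<circ> chart_inv ?p) (at (snd ?p (\<gamma> t))) (h *\<^sub>R Y (\<gamma> t)))) (at t)"
    by (rule has_derivative_compose[OF 1 transition_has_derivative[OF chart_at(1) c(1) chart_at(2) c(2)]])
  then have "((\<lambda>s. snd c (\<gamma> s)) has_derivative
     (\<lambda>h. frechet_derivative (snd c \<circ> chart_inv ?p) (at (snd ?p (\<gamma> t))) (h *\<^sub>R Y (\<gamma> t)))) (at t)"
    by (rule has_derivative_transform_within_open[OF _ op[OF chart_at(1)]])
      (use t chart_at chart_inv_left[OF chart_at(1)] in auto)
  moreover have "frechet_derivative (snd c \<circ> chart_inv ?p) (at (snd ?p (\<gamma> t))) (h *\<^sub>R Y (\<gamma> t)) =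
      h *\<^sub>R vec_rep A c Y (snd c (\<gamma> t))" for h
    unfolding vec_rep_at_point[OF c]
    using linear_cmul[OF linear_tangent_map[OF c]] by (simp add: tangent_map_def)
  ultimately show "((\<lambda>s. snd c (\<gamma> s)) has_vector_derivative vec_rep A c Y (snd c (\<gamma> t))) (at t)"
    by (simp add: has_vector_derivative_def)
qed

text \<open>The equation is solved in the preferred chart at x; smoothness and velocity in all other
  charts follow through transitions.\<close>

lemma integral_curve_exists:
  assumes Y: "smooth_vector_field A UNIV Y"
  obtains \<epsilon> \<gamma> where "\<epsilon> > 0" "integral_curve A Y \<gamma> (-\<epsilon>) \<epsilon>" "\<gamma> 0 = x"
proof -
  let ?c = "chart_at A x"
  let ?S = "snd ?c ` fst ?c"
  note c = chart_at(1)[of x]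
  have Ys: "smooth_on ?S (vec_rep A ?c Y)" using smooth_vector_fieldD(2)[OF Y c] by simp
  have "snd ?c x \<in> ?S" using chart_at by blast
  then obtain \<epsilon> u where eps: "\<epsilon> > 0" and u0: "u 0 = snd ?c x"
    and u: "\<And>t. t \<in> {-\<epsilon><..<\<epsilon>} \<Longrightarrow> u t \<in> ?S \<and> (u has_vector_derivative vec_rep A ?c Y (u t)) (at t)"
    using picard_local_existence[OF open_chart(2)[OF c] Ys] by metis
  have us: "smooth_on {-\<epsilon><..<\<epsilon>} u"
    by (rule smooth_on_integral_curve[OF open_chart(2)[OF c] Ys open_greaterThanLessThan u])
  define \<gamma> where "\<gamma> = (\<lambda>t. chart_inv ?c (u t))"
  let ?I = "{-\<epsilon><..<\<epsilon>}"
  have \<gamma>c: "\<gamma> t \<in> fst ?c" "snd ?c (\<gamma> t) = u t" if "t \<in> ?I" for t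
    using chart_inv_right[OF c] u[OF that] by (auto simp: \<gamma>_def)
  have cont: "continuous_on ?I \<gamma>" unfolding \<gamma>_def
    by (rule continuous_on_compose2[OF continuous_on_chart(2)[OF c] smooth_on_continuous_on[OF us]]) (use u in auto)
  have opd: "open (?I \<inter> \<gamma> -` fst d)" if "d \<in> A" for d
    using cont open_chart(1)[OF that] by (simp add: continuous_on_open_vimage Int_commute)
  have sm: "smooth_on (?I \<inter> \<gamma> -` fst d) (snd d \<circ> \<gamma>)" if d: "d \<in> A" for d
  proof -
    have "smooth_on (?I \<inter> \<gamma> -` fst d) (\<lambda>t. (snd d \<circ> chart_inv ?c) (u t))"
    proof (rule smooth_on_compose[OF smooth_transition[OF c d] _ opd[OF d] open_overlap[OF c d]])
      show "smooth_on (?I \<inter> \<gamma> -` fst d) u" using smooth_on_subset[OF us] by blast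
      show "u ` (?I \<inter> \<gamma> -` fst d) \<subseteq> snd ?c ` (fst ?c \<inter> fst d)"
      proof
        fix y assume "y \<in> u ` (?I \<inter> \<gamma> -` fst d)"
        then obtain t where "t \<in> ?I" "\<gamma> t \<in> fst d" "y = u t" by auto
        then show "y \<in> snd ?c ` (fst ?c \<inter> fst d)" using \<gamma>c[of t] by (metis IntI imageI)
      qed
    qed
    then show ?thesis by (simp add: \<gamma>_def o_def)
  qed
  have "mderiv std_atlas A \<gamma> t 1 = Y (\<gamma> t)" if t: "t \<in> ?I" for t
  proof -
    let ?p = "chart_at A (\<gamma> t)"
    have "((\<lambda>t. (snd ?p \<circ> chart_inv ?c) (u t)) has_derivative
      (\<lambda>h. frechet_derivative (snd ?p \<circ> chart_inv ?c) (at (u t)) (h *\<^sub>R vec_rep A ?c Y (u t)))) (at t)"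
    proof (rule has_derivative_compose[where f = u and g = "snd ?p \<circ> chart_inv ?c"
          and f' = "\<lambda>h. h *\<^sub>R vec_rep A ?c Y (u t)"])
      show "(u has_derivative (\<lambda>h. h *\<^sub>R vec_rep A ?c Y (u t))) (at t)"
        using u[OF t] by (simp add: has_vector_derivative_def)
      show "((snd ?p \<circ> chart_inv ?c) has_derivative frechet_derivative (snd ?p \<circ> chart_inv ?c) (at (u t))) (at (u t))"
        using transition_has_derivative[OF c chart_at(1) \<gamma>c(1)[OF t] chart_at(2)] unfolding \<gamma>c(2)[OF t] .
    qed
    from fun_cong[OF frechet_derivative_at[OF this], of 1]
    have "frechet_derivative (\<lambda>t. (snd ?p \<circ> chart_inv ?c) (u t)) (at t) 1 =
      frechet_derivative (snd ?p \<circ> chart_inv ?c) (at (snd ?c (\<gamma> t))) (vec_rep A ?c Y (snd ?c (\<gamma> t)))"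
      unfolding \<gamma>c(2)[OF t] by simp
    also have "\<dots> = Y (\<gamma> t)"
      unfolding vec_rep_at_point[OF c \<gamma>c(1)[OF t]] by (rule tangent_map_inverse(1)[OF c \<gamma>c(1)[OF t]])
    finally have "frechet_derivative (\<lambda>t. (snd ?p \<circ> chart_inv ?c) (u t)) (at t) 1 = Y (\<gamma> t)" .
    moreover have "(\<lambda>t. (snd ?p \<circ> chart_inv ?c) (u t)) = snd ?p \<circ> \<gamma>" by (simp add: \<gamma>_def o_def)
    ultimately show ?thesis by (simp add: mderiv_def chart_at_std chart_inv_std o_def)
  qed
  then have "integral_curve A Y \<gamma> (-\<epsilon>) \<epsilon>"
    using cont sm by (simp add: integral_curve_def smooth_map_def std_atlas_def chart_inv_std o_def)
  moreover have "\<gamma> 0 = x" by (simp add: \<gamma>_def u0 chart_inv_left[OF chart_at])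
  ultimately show thesis using that eps by blast
qed

subsection \<open>Contact fields\<close>

lemma chart_inv_prod:
  assumes c: "c \<in> A" and y: "y \<in> snd c ` fst c"
  shows "chart_inv (UNIV \<times> fst c, map_prod (\<lambda>x. x) (snd c)) (t, y) = (t, chart_inv c y)"
proof -
  have "inj_on (map_prod (\<lambda>x. x) (snd c)) (UNIV \<times> fst c)"
    using inj_on_inverseI[of "fst c" "chart_inv c" "snd c"] chart_inv_left[OF c]
    by (auto simp: inj_on_def)
  then show ?thesis
    using chart_inv_right[OF c y] unfolding chart_inv_def[of "(UNIV \<times> fst c, map_prod (\<lambda>x. x) (snd c))"]
    by (intro inv_into_f_eq) auto
qed

text \<open>\<open>mderiv A A\<close> refers to the preferred charts at x and at g x, which may
  differ. Read through \<open>tangent_map\<close>, it becomes the ordinary derivative in a single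
  chart around both points.\<close>

lemma tangent_map_mderiv_self:
  assumes k: "k \<in> A" "x \<in> fst k" "g x \<in> fst k"
    and D: "((snd k \<circ> g \<circ> chart_inv k) has_derivative D) (at (snd k x))"
    and N: "open N" "snd k x \<in> N" "\<And>y. y \<in> N \<Longrightarrow> g (chart_inv k y) \<in> fst k"
  shows "tangent_map A k (g x) (mderiv A A g x v) = D (tangent_map A k x v)"
proof -
  let ?p = "chart_at A (g x)"
  let ?E = "frechet_derivative (snd ?p \<circ> chart_inv k) (at (snd k (g x)))"
  have E: "((snd ?p \<circ> chart_inv k) has_derivative ?E) (at ((snd k \<circ> g \<circ> chart_inv k) (snd k x)))"
    using transition_has_derivative[OF k(1) chart_at(1) k(3) chart_at(2)] by (simp add: chart_inv_left[OF k(1,2)])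
  have F: "((snd ?p \<circ> g \<circ> chart_inv k) has_derivative (\<lambda>w. ?E (D w))) (at (snd k x))"
    by (rule has_derivative_transform_within_open[OF has_derivative_compose[OF D E] N(1,2)])
      (use N(3) chart_inv_left[OF k(1)] in auto)
  have "mderiv A A g x v = ?E (D (tangent_map A k x v))"
    using mderiv_chart[OF k(1,2) differentiableI[OF F], of v]
    by (simp add: frechet_derivative_at[OF F, symmetric])
  then show ?thesis using tangent_map_inverse(2)[OF k(1,3)] by simp
qed

text \<open>The left-hand side is (L_X \<alpha>)(v) in the preferred chart, where v and
  \<open>X x\<close> are their own components. The local flow is transcribed to a smooth map G of
  time and coordinates, and the invariance of ker \<alpha> is differentiated at t = 0.\<close>

lemma contact_field_infinitesimal:
  assumes \<alpha>: "smooth_one_form A \<alpha>" and X: "contact_field A \<alpha> U f X" and x: "x \<in> U" and v: "\<alpha> x v = 0"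
  defines "k \<equiv> chart_at A x"
  shows "frechet_derivative (\<lambda>y. form_rep A k \<alpha> y v) (at (snd k x)) (X x) +
    \<alpha> x (frechet_derivative (vec_rep A k X) (at (snd k x)) v) = 0"
proof -
  have k: "k \<in> A" "x \<in> fst k" unfolding k_def by (rule chart_at)+
  have T: "tangent_map A k x w = w" for w unfolding k_def by (rule tangent_map_chart_at)
  have Xs: "smooth_vector_field A U X" and fp: "flow_preserves A U X (contact_dist \<alpha>)"
    using X unfolding contact_field_def by blast+
  obtain V \<epsilon> \<phi> where xV: "x \<in> V" and lf: "local_flow A U X V \<epsilon> \<phi>"
    and pres: "\<forall>t\<in>{-\<epsilon><..<\<epsilon>}. \<forall>y\<in>V.
      mderiv A A (\<phi> t) y ` contact_dist \<alpha> y = contact_dist \<alpha> (\<phi> t y)"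
    using bspec[OF fp[unfolded flow_preserves_def] x] by (elim exE conjE) (rule that)
  let ?I = "{-\<epsilon><..<\<epsilon>}" and ?\<Phi> = "\<lambda>(t, y). \<phi> t y" and ?S = "snd k ` fst k"
  have eps: "\<epsilon> > 0" and V: "open V"
    and sm: "smooth_map (prod_atlas std_atlas A) A (?I \<times> V) ?\<Phi>"
    and \<phi>0: "\<And>y. y \<in> V \<Longrightarrow> \<phi> 0 y = y"
    and ic: "\<And>y. y \<in> V \<Longrightarrow> integral_curve A X (\<lambda>t. \<phi> t y) (-\<epsilon>) \<epsilon>"
    using lf unfolding local_flow_def by blast+
  define N0 where "N0 = ?\<Phi> -` fst k \<inter> ?I \<times> V"
  have "open (?I \<times> V)" "continuous_on (?I \<times> V) ?\<Phi>" using sm unfolding smooth_map_def by blast+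
  then have "open N0"
    using continuous_on_open_vimage[of "?I \<times> V" ?\<Phi>] open_chart(1)[OF k(1)] unfolding N0_def by blast
  \<comment> \<open>The pairs (t, y), with y in coordinates, for which the flow starts in V and at
    time t lies again in the domain of k, so that both ends are read in the same chart.\<close>
  define N where "N = (\<lambda>q. (fst q, chart_inv k (snd q))) -` N0 \<inter> UNIV \<times> ?S"
  have "continuous_on (UNIV \<times> ?S) (\<lambda>q :: real \<times> 'e. (fst q, chart_inv k (snd q)))"
    by (intro continuous_intros continuous_on_compose2[OF continuous_on_chart(2)[OF k(1)]]) auto
  then have opN: "open N"
    unfolding N_def using \<open>open N0\<close> open_chart(2)[OF k(1)]
      continuous_on_open_vimage[of "UNIV \<times> ?S" "\<lambda>q :: real \<times> 'e. (fst q, chart_inv k (snd q))"]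
    by (simp add: open_Times)
  have N: "(t, y) \<in> N \<longleftrightarrow> t \<in> ?I \<and> y \<in> ?S \<and> chart_inv k y \<in> V \<and> \<phi> t (chart_inv k y) \<in> fst k" for t y
    by (auto simp: N_def N0_def)
  define G where "G = (\<lambda>q. snd k (\<phi> (fst q) (chart_inv k (snd q))))"
  have Gs: "smooth_on N G"
  proof -
    \<comment> \<open>Smoothness of the flow is stated in product charts; this is the product of the
      identity of the line with k.\<close>
    let ?kk = "(UNIV \<times> fst k, map_prod (\<lambda>x. x) (snd k)) :: (real \<times> 'm, real \<times> 'e) chart"
    have "?kk \<in> prod_atlas std_atlas A"
      unfolding prod_atlas_def std_atlas_def using k(1) by force
    then have "smooth_on (snd ?kk ` (?I \<times> V \<inter> fst ?kk \<inter> ?\<Phi> -` fst k)) (snd k \<circ> ?\<Phi> \<circ> chart_inv ?kk)"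
      using sm k(1) unfolding smooth_map_def by blast
    moreover have "N \<subseteq> snd ?kk ` (?I \<times> V \<inter> fst ?kk \<inter> ?\<Phi> -` fst k)"
    proof
      fix q assume q: "q \<in> N"
      obtain t y where ty: "q = (t, y)" by fastforce
      then have "q = snd ?kk (t, chart_inv k y)" using q chart_inv_right(1)[OF k(1)] N by simp
      moreover have "(t, chart_inv k y) \<in> ?I \<times> V \<inter> fst ?kk \<inter> ?\<Phi> -` fst k"
        using q ty chart_inv_right(2)[OF k(1)] N by simp
      ultimately show "q \<in> snd ?kk ` (?I \<times> V \<inter> fst ?kk \<inter> ?\<Phi> -` fst k)" by (rule image_eqI)
    qed
    ultimately have "smooth_on N (snd k \<circ> ?\<Phi> \<circ> chart_inv ?kk)" by (rule smooth_on_subset)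
    then show ?thesis
    proof (rule smooth_on_cong[OF _ opN])
      fix q assume q: "q \<in> N"
      obtain t y where ty: "q = (t, y)" by fastforce
      show "(snd k \<circ> ?\<Phi> \<circ> chart_inv ?kk) q = G q"
        using chart_inv_prod[OF k(1), of y t] q N by (simp add: ty G_def)
    qed
  qed
  have DG: "(G has_derivative frechet_derivative G (at q)) (at q)" if "q \<in> N" for q
    using smooth_on_has_derivative[OF Gs that] .
  have xN: "(0, snd k x) \<in> N"
    using eps k xV \<phi>0[OF xV] by (auto simp: N chart_inv_left[OF k])
  note a = smooth_form_rep[OF \<alpha> k(1)]
  have "frechet_derivative (\<lambda>y. form_rep A k \<alpha> y v) (at (snd k x)) (vec_rep A k X (snd k x)) +
    form_rep A k \<alpha> (snd k x) (frechet_derivative (vec_rep A k X) (at (snd k x)) v) = 0"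
  proof (rule flow_preserves_kernel_infinitesimal[OF opN xN Gs a])
    show "G ` N \<subseteq> ?S" using N by (auto simp: G_def)
    show "(vec_rep A k X has_derivative frechet_derivative (vec_rep A k X) (at (snd k x))) (at (snd k x))"
      by (rule smooth_on_has_derivative[OF smooth_vector_fieldD(2)[OF Xs k(1)]]) (use x k in blast)
    show "G (0, y) = y" if "(0, y) \<in> N" for y
      using that N \<phi>0 chart_inv_right(1)[OF k(1)] by (simp add: G_def)
    show "frechet_derivative G (at (t, y)) (1, 0) = vec_rep A k X (G (t, y))" if ty: "(t, y) \<in> N" for t y
    proof -
      let ?m = "chart_inv k y"
      have m: "t \<in> ?I" "?m \<in> V" "\<phi> t ?m \<in> fst k" using ty N by auto
      have line: "((\<lambda>s. (s, y)) has_derivative (\<lambda>d. (d, 0))) (at t)"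
        by (auto intro!: derivative_eq_intros)
      have E1: "((\<lambda>s. G (s, y)) has_derivative (\<lambda>d. frechet_derivative G (at (t, y)) (d, 0))) (at t)"
        by (rule has_derivative_compose[OF line DG[OF ty]])
      have E2: "((\<lambda>s. G (s, y)) has_derivative (\<lambda>d. d *\<^sub>R vec_rep A k X (G (t, y)))) (at t)"
        using integral_curve_chart(1)[OF ic[OF m(2)] m(1) k(1) m(3)]
        by (simp add: G_def has_vector_derivative_def)
      show ?thesis using fun_cong[OF has_derivative_unique[OF E1 E2], of 1] by simp
    qed
    show "form_rep A k \<alpha> (G (t, snd k x)) (frechet_derivative G (at (t, snd k x)) (0, v)) = 0"
      if t: "(t, snd k x) \<in> N" for t
    proof -
      have m: "t \<in> ?I" "\<phi> t x \<in> fst k" using t by (simp_all add: N chart_inv_left[OF k])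
      have line: "((\<lambda>y. (t, y)) has_derivative (\<lambda>d. (0, d))) (at (snd k x))"
        by (auto intro!: derivative_eq_intros)
      have "((\<lambda>y. G (t, y)) has_derivative (\<lambda>d. frechet_derivative G (at (t, snd k x)) (0, d))) (at (snd k x))"
        by (rule has_derivative_compose[OF line DG[OF t]])
      then have D: "((snd k \<circ> \<phi> t \<circ> chart_inv k) has_derivative (\<lambda>d. frechet_derivative G (at (t, snd k x)) (0, d))) (at (snd k x))"
        by (simp add: G_def o_def)
      have "open (Pair t -` N)" using opN by (intro open_vimage continuous_intros)
      then have "tangent_map A k (\<phi> t x) (mderiv A A (\<phi> t) x v) =
          frechet_derivative G (at (t, snd k x)) (0, tangent_map A k x v)"
        by (rule tangent_map_mderiv_self[OF k m(2) D]) (use t N in auto)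
      then have "tangent_map A k (\<phi> t x) (mderiv A A (\<phi> t) x v) =
          frechet_derivative G (at (t, snd k x)) (0, v)" unfolding T .
      moreover have "\<alpha> (\<phi> t x) (mderiv A A (\<phi> t) x v) = 0"
        using bspec[OF bspec[OF pres m(1)] xV] v unfolding contact_dist_def by blast
      ultimately show ?thesis
        using form_rep_tangent_map[OF k(1) m(2), of \<alpha> "mderiv A A (\<phi> t) x v"] by (simp add: G_def chart_inv_left[OF k])
    qed
  qed
  then show ?thesis
    using vec_rep_at_point[OF k, of X] form_rep_tangent_map[OF k, of \<alpha>] by (simp add: T)
qed

lemma contact_field_function_derivative:
  assumes \<alpha>: "smooth_one_form A \<alpha>" and X: "contact_field A \<alpha> U f X" and x: "x \<in> U"
    and f: "smooth_map A std_atlas U f"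
  defines "k \<equiv> chart_at A x"
  shows "mderiv A std_atlas f x v = frechet_derivative (\<lambda>y. form_rep A k \<alpha> y (X x)) (at (snd k x)) v +
    \<alpha> x (frechet_derivative (vec_rep A k X) (at (snd k x)) v)"
proof -
  have k: "k \<in> A" "x \<in> fst k" unfolding k_def by (rule chart_at)+
  have T: "tangent_map A k x w = w" for w unfolding k_def by (rule tangent_map_chart_at)
  have Xs: "smooth_vector_field A U X" and \<alpha>X: "\<And>x. x \<in> U \<Longrightarrow> \<alpha> x (X x) = f x"
    using X unfolding contact_field_def by blast+
  let ?a = "form_rep A k \<alpha>" and ?X = "vec_rep A k X" and ?z = "snd k x"
  have z: "?z \<in> snd k ` (U \<inter> fst k)" "?z \<in> snd k ` fst k" using x k by blast+
  have "((\<lambda>y. ?a y (?X y)) has_derivative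
      (\<lambda>u. frechet_derivative (\<lambda>y. ?a y (?X ?z)) (at ?z) u + ?a ?z (frechet_derivative ?X (at ?z) u))) (at ?z)"
    by (rule has_derivative_form_field[OF smooth_form_rep[OF \<alpha> k(1)] z(2)
          smooth_on_has_derivative[OF smooth_vector_fieldD(2)[OF Xs k(1)] z(1)]])
  then have "((f \<circ> chart_inv k) has_derivative
      (\<lambda>u. frechet_derivative (\<lambda>y. ?a y (?X ?z)) (at ?z) u + ?a ?z (frechet_derivative ?X (at ?z) u))) (at ?z)"
  proof (rule has_derivative_transform_within_open[OF _ smooth_vector_fieldD(3)[OF Xs k(1)] z(1)])
    fix y assume "y \<in> snd k ` (U \<inter> fst k)"
    then obtain x' where "x' \<in> U" "x' \<in> fst k" "y = snd k x'" by blast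
    then show "?a y (?X y) = (f \<circ> chart_inv k) y"
      using form_rep_vec_rep[OF k(1), of y \<alpha> X] \<alpha>X by (simp add: chart_inv_left[OF k(1)])
  qed
  from fun_cong[OF frechet_derivative_at[OF this], of v]
  show ?thesis
    using smooth_function_chart(3)[OF f k(1) x k(2), of v]
      vec_rep_at_point[OF k, of X] form_rep_tangent_map[OF k, of \<alpha>] by (simp add: T)
qed

lemma ext_deriv_linear:
  assumes "smooth_one_form A \<alpha>"
  shows "linear (ext_deriv A \<alpha> x u)" "linear (\<lambda>u. ext_deriv A \<alpha> x u v)"
    "ext_deriv A \<alpha> x u v = - ext_deriv A \<alpha> x v u"
proof -
  have eq: "ext_deriv A \<alpha> x = form_deriv (form_rep A (chart_at A x) \<alpha>) (snd (chart_at A x) x)"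
    using ext_deriv_chart[OF assms chart_at] by (intro ext) (simp add: tangent_map_chart_at)
  have z: "snd (chart_at A x) x \<in> snd (chart_at A x) ` fst (chart_at A x)" using chart_at by blast
  show "linear (ext_deriv A \<alpha> x u)" "linear (\<lambda>u. ext_deriv A \<alpha> x u v)"
    unfolding eq by (rule form_deriv_linear[OF smooth_form_rep[OF assms chart_at(1)] z])+
  show "ext_deriv A \<alpha> x u v = - ext_deriv A \<alpha> x v u" unfolding eq by (rule form_deriv_antisym)
qed

lemma smooth_function_mderiv_linear:
  assumes "smooth_map A std_atlas U (f :: 'm \<Rightarrow> 'k::euclidean_space)" "x \<in> U"
  shows "linear (mderiv A std_atlas f x)"
proof -
  let ?k = "chart_at A x"
  have "mderiv A std_atlas f x = frechet_derivative (f \<circ> chart_inv ?k) (at (snd ?k x))"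
    using smooth_function_chart(3)[OF assms(1) chart_at(1) assms(2) chart_at(2)]
    by (intro ext) (simp add: tangent_map_chart_at)
  moreover have "linear \<dots>"
    by (rule smooth_on_linear_derivative[OF smooth_function_chart(2)[OF assms(1) chart_at(1)]])
      (use assms(2) chart_at(2) in blast)
  ultimately show ?thesis by simp
qed

lemma contact_field_differential:
  assumes \<alpha>: "smooth_one_form A \<alpha>" and Z: "reeb_field A \<alpha> Z"
    and X: "contact_field A \<alpha> U f X" and x: "x \<in> U"
    and f: "smooth_map A std_atlas U f" and fZ: "mderiv A std_atlas f x (Z x) = 0"
  shows "mderiv A std_atlas f x v = - ext_deriv A \<alpha> x (X x) v"
proof -
  let ?L = "\<lambda>v. mderiv A std_atlas f x v + ext_deriv A \<alpha> x (X x) v"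
  have lin: "linear ?L"
    by (intro linear_compose_add smooth_function_mderiv_linear[OF f x] ext_deriv_linear[OF \<alpha>])
  have L0: "?L v = 0" if "\<alpha> x v = 0" for v
    using contact_field_infinitesimal[OF \<alpha> X x that] contact_field_function_derivative[OF \<alpha> X x f, of v]
    by (simp add: ext_deriv_def Let_def)
  have Zx: "\<alpha> x (Z x) = 1" "ext_deriv A \<alpha> x (Z x) w = 0" for w
    using Z unfolding reeb_field_def by blast+
  have LZ: "?L (Z x) = 0" using fZ Zx(2) ext_deriv_linear(3)[OF \<alpha>, of x "X x" "Z x"] by simp
  have lin\<alpha>: "linear (\<alpha> x)" using \<alpha> unfolding smooth_one_form_def by blast
  \<comment> \<open>v is split into a vector of ker \<alpha> and a multiple of Z; \<open>?L\<close>,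
    which is L_X \<alpha>, kills both.\<close>
  have "?L (v - \<alpha> x v *\<^sub>R Z x) = 0"
    by (rule L0) (simp add: linear_diff[OF lin\<alpha>] linear_cmul[OF lin\<alpha>] Zx)
  moreover have "?L (v - \<alpha> x v *\<^sub>R Z x) = ?L v - \<alpha> x v *\<^sub>R ?L (Z x)"
    using linear_diff[OF lin] linear_cmul[OF lin] by simp
  ultimately show ?thesis using LZ by simp
qed

lemma bracket_eq_ext_deriv:
  assumes \<alpha>: "smooth_one_form A \<alpha>" and Z: "reeb_field A \<alpha> Z" and x: "x \<in> U"
    and X: "contact_field A \<alpha> U f X" "smooth_map A std_atlas U f" "mderiv A std_atlas f x (Z x) = 0"
    and Y: "contact_field A \<alpha> U g Y" "smooth_map A std_atlas U g" "mderiv A std_atlas g x (Z x) = 0"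
  shows "\<alpha> x (lie_bracket A X Y x) = ext_deriv A \<alpha> x (X x) (Y x)"
proof -
  have lin\<alpha>: "linear (\<alpha> x)" using \<alpha> unfolding smooth_one_form_def by blast
  have "\<alpha> x (lie_bracket A X Y x) =
    mderiv A std_atlas g x (X x) - mderiv A std_atlas f x (Y x) - ext_deriv A \<alpha> x (X x) (Y x)"
    using contact_field_function_derivative[OF \<alpha> Y(1) x Y(2), of "X x"]
      contact_field_function_derivative[OF \<alpha> X(1) x X(2), of "Y x"]
    by (simp add: lie_bracket_def ext_deriv_def Let_def linear_diff[OF lin\<alpha>])
  also have "\<dots> = - ext_deriv A \<alpha> x (Y x) (X x)"
    using contact_field_differential[OF \<alpha> Z X(1) x X(2,3), of "Y x"]
      contact_field_differential[OF \<alpha> Z Y(1) x Y(2,3), of "X x"] by simp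
  finally show ?thesis using ext_deriv_linear(3)[OF \<alpha>, of x "X x" "Y x"] by simp
qed

end

section \<open>Brackets along the fibres\<close>

locale pre_isotropic_reeb = smooth_atlas A + target: smooth_atlas B
  for A :: "('m::{t2_space,second_countable_topology}, 'e::euclidean_space) chart set"
    and B :: "('w::{t2_space,second_countable_topology}, 'f::euclidean_space) chart set" +
  fixes \<alpha> :: "'m \<Rightarrow> 'e \<Rightarrow> real" and \<X> :: "('m \<Rightarrow> 'e) set" and \<pi> :: "'m \<Rightarrow> 'w" and n :: nat
  assumes contact: "contact_form A n \<alpha>"
    and submersion: "proper_submersion_onto A B \<pi>"
    and pre_isotropic: "complete_pre_isotropic_reeb A B \<pi> \<alpha> \<X>"
begin

lemma smooth_\<alpha>: "smooth_one_form A \<alpha>" and linear_\<alpha>: "linear (\<alpha> x)"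
  using contact unfolding contact_form_def smooth_one_form_def by blast+

lemma smooth_\<pi>: "smooth_map A B UNIV \<pi>" and surj_mderiv_\<pi>: "surj (mderiv A B \<pi> x)"
  using submersion unfolding proper_submersion_onto_def by blast+

lemma smooth_\<X>: "Y \<in> \<X> \<Longrightarrow> smooth_vector_field A UNIV Y"
  and lie_\<X>: "Y \<in> \<X> \<Longrightarrow> lie_deriv A Y \<alpha> x v = 0"
  and orbit_\<X>: "orbit_of A \<X> x = connected_component_set (\<pi> -` {\<pi> x}) x"
  using pre_isotropic unfolding complete_pre_isotropic_reeb_def abelian_lie_algebra_def by blast+

lemma reeb: obtains Z where "reeb_field A \<alpha> Z" "\<And>x. mderiv A B \<pi> x (Z x) = 0"
  using pre_isotropic unfolding complete_pre_isotropic_reeb_def ker_dist_def by blast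

section \<open>The submersion in charts\<close>

definition \<pi>_rep :: "('m, 'e) chart \<Rightarrow> ('w, 'f) chart \<Rightarrow> 'e \<Rightarrow> 'f" where
  "\<pi>_rep c d = snd d \<circ> \<pi> \<circ> chart_inv c"

lemma \<pi>_rep:
  assumes "c \<in> A" "d \<in> B"
  shows "open (snd c ` (fst c \<inter> \<pi> -` fst d))" "smooth_on (snd c ` (fst c \<inter> \<pi> -` fst d)) (\<pi>_rep c d)"
  using smooth_map_chart[OF smooth_\<pi> assms target.open_chart(1)[OF assms(2)]]
  unfolding \<pi>_rep_def by simp_all

lemma mderiv_\<pi>:
  assumes "c \<in> A" "x \<in> fst c"
  shows "mderiv A B \<pi> x v =
    frechet_derivative (\<pi>_rep c (chart_at B (\<pi> x))) (at (snd c x)) (tangent_map A c x v)"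
  unfolding \<pi>_rep_def
proof (rule mderiv_chart[OF assms])
  show "snd (chart_at B (\<pi> x)) \<circ> \<pi> \<circ> chart_inv c differentiable (at (snd c x))"
    using smooth_on_differentiable[OF \<pi>_rep(2)[OF assms(1) target.chart_at(1)], of "snd c x" "\<pi> x"]
      assms(2) target.chart_at(2) unfolding \<pi>_rep_def by blast
qed

lemma linear_mderiv_\<pi>: "linear (mderiv A B \<pi> x)"
proof -
  let ?c = "chart_at A x" and ?d = "chart_at B (\<pi> x)"
  have "mderiv A B \<pi> x = frechet_derivative (\<pi>_rep ?c ?d) (at (snd ?c x))"
    using mderiv_\<pi>[OF chart_at] by (intro ext) (simp add: tangent_map_chart_at)
  moreover have "linear \<dots>"
    by (rule smooth_on_linear_derivative[OF \<pi>_rep(2)[OF chart_at(1) target.chart_at(1)]])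
      (use chart_at(2) target.chart_at(2) in blast)
  ultimately show ?thesis by simp
qed

text \<open>\<open>mderiv\<close> uses the preferred chart at \<pi> x, which jumps when x moves
  across fibres. The kernel of d\<pi> does not see this, as a transition of W composes the
  derivative with a linear map.\<close>

lemma \<pi>_rep_kernel_change:
  assumes c: "c \<in> A" "x \<in> fst c" and d: "d \<in> B" "\<pi> x \<in> fst d" and d': "d' \<in> B" "\<pi> x \<in> fst d'"
    and 0: "frechet_derivative (\<pi>_rep c d) (at (snd c x)) w = 0"
  shows "frechet_derivative (\<pi>_rep c d') (at (snd c x)) w = 0"
proof -
  let ?S = "snd c ` (fst c \<inter> \<pi> -` fst d)"
  have z: "snd c x \<in> ?S" using c d by blast
  have zx: "\<pi>_rep c d (snd c x) = snd d (\<pi> x)" by (simp add: \<pi>_rep_def chart_inv_left[OF c])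
  let ?E = "frechet_derivative (snd d' \<circ> chart_inv d) (at (snd d (\<pi> x)))"
  have E: "((snd d' \<circ> chart_inv d) has_derivative ?E) (at (\<pi>_rep c d (snd c x)))"
    unfolding zx by (rule target.transition_has_derivative[OF d(1) d'(1) d(2) d'(2)])
  have "(\<pi>_rep c d' has_derivative (\<lambda>w. ?E (frechet_derivative (\<pi>_rep c d) (at (snd c x)) w))) (at (snd c x))"
  proof (rule has_derivative_transform_within_open[OF
        has_derivative_compose[OF smooth_on_has_derivative[OF \<pi>_rep(2)[OF c(1) d(1)] z] E] \<pi>_rep(1)[OF c(1) d(1)] z])
    fix y assume "y \<in> ?S"
    then obtain x' where "x' \<in> fst c" "\<pi> x' \<in> fst d" "y = snd c x'" by blast
    then show "(snd d' \<circ> chart_inv d) (\<pi>_rep c d y) = \<pi>_rep c d' y"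
      by (simp add: \<pi>_rep_def chart_inv_left[OF c(1)] target.chart_inv_left[OF d(1)])
  qed
  from fun_cong[OF frechet_derivative_at[OF this], of w]
  have "frechet_derivative (\<pi>_rep c d') (at (snd c x)) w = ?E 0" unfolding 0 by simp
  also have "?E 0 = 0" by (rule linear_0[OF has_derivative_linear[OF E]])
  finally show ?thesis .
qed

lemma mderiv_\<pi>_zero_iff:
  assumes c: "c \<in> A" "x \<in> fst c" and d: "d \<in> B" "\<pi> x \<in> fst d"
  shows "mderiv A B \<pi> x v = 0 \<longleftrightarrow>
    frechet_derivative (\<pi>_rep c d) (at (snd c x)) (tangent_map A c x v) = 0"
  unfolding mderiv_\<pi>[OF c]
  using \<pi>_rep_kernel_change[OF c d target.chart_at] \<pi>_rep_kernel_change[OF c target.chart_at d] by blast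

lemma orbit_step_fibre:
  assumes "Y \<in> \<X>" "integral_curve A Y \<gamma> a b" "s \<in> {a<..<b}" "t \<in> {a<..<b}"
  shows "\<pi> (\<gamma> t) = \<pi> (\<gamma> s)"
proof -
  have "(\<gamma> s, \<gamma> t) \<in> orbit_step A \<X>" using assms unfolding orbit_step_def by blast
  then have "\<gamma> t \<in> orbit_of A \<X> (\<gamma> s)" unfolding orbit_of_def by blast
  then show ?thesis unfolding orbit_\<X> using connected_component_subset by fastforce
qed

text \<open>An integral curve through x lies in one fibre because orbits are components of fibres;
  its velocity at x is Y x, so differentiating \<pi> along it gives 0.\<close>

lemma \<X>_tangent:
  assumes Y: "Y \<in> \<X>"
  shows "mderiv A B \<pi> x (Y x) = 0"
proof -
  obtain \<epsilon> \<gamma> where eps: "\<epsilon> > 0" and \<gamma>: "integral_curve A Y \<gamma> (-\<epsilon>) \<epsilon>" "\<gamma> 0 = x"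
    using integral_curve_exists[OF smooth_\<X>[OF Y]] by metis
  let ?c = "chart_at A x" and ?d = "chart_at B (\<pi> x)"
  have 0: "0 \<in> {-\<epsilon><..<\<epsilon>}" "\<gamma> 0 \<in> fst ?c" using eps \<gamma> chart_at by auto
  note ic = integral_curve_chart[OF \<gamma>(1) 0(1) chart_at(1) 0(2)]
  have z: "snd ?c x \<in> snd ?c ` (fst ?c \<inter> \<pi> -` fst ?d)" using chart_at(2) target.chart_at(2) by blast
  have v: "vec_rep A ?c Y (snd ?c x) = Y x"
    using vec_rep_at_point[OF chart_at] tangent_map_chart_at by simp
  have "((\<lambda>s. snd ?c (\<gamma> s)) has_derivative (\<lambda>h. h *\<^sub>R Y x)) (at 0)"
    using ic(1) unfolding \<gamma>(2) v has_vector_derivative_def .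
  moreover have "(\<pi>_rep ?c ?d has_derivative frechet_derivative (\<pi>_rep ?c ?d) (at (snd ?c x))) (at (snd ?c (\<gamma> 0)))"
    unfolding \<gamma>(2) by (rule smooth_on_has_derivative[OF \<pi>_rep(2)[OF chart_at(1) target.chart_at(1)] z])
  ultimately have D1: "((\<lambda>s. \<pi>_rep ?c ?d (snd ?c (\<gamma> s))) has_derivative
      (\<lambda>h. frechet_derivative (\<pi>_rep ?c ?d) (at (snd ?c x)) (h *\<^sub>R Y x))) (at 0)"
    by (rule has_derivative_compose)
  have D2: "((\<lambda>s. \<pi>_rep ?c ?d (snd ?c (\<gamma> s))) has_derivative (\<lambda>h. 0)) (at 0)"
  proof (rule has_derivative_transform_within_open[OF has_derivative_const ic(2)])
    show "0 \<in> {s \<in> {-\<epsilon><..<\<epsilon>}. \<gamma> s \<in> fst ?c}" using 0 by blast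
    fix s assume s: "s \<in> {s \<in> {-\<epsilon><..<\<epsilon>}. \<gamma> s \<in> fst ?c}"
    then have "\<pi> (\<gamma> s) = \<pi> x" using orbit_step_fibre[OF Y \<gamma>(1) 0(1), of s] \<gamma>(2) by simp
    then show "snd ?d (\<pi> x) = \<pi>_rep ?c ?d (snd ?c (\<gamma> s))"
      using s by (simp add: \<pi>_rep_def chart_inv_left[OF chart_at(1)])
  qed
  from fun_cong[OF has_derivative_unique[OF D1 D2], of 1] show ?thesis
    using mderiv_\<pi>[OF chart_at, of x "Y x"] by (simp add: tangent_map_chart_at)
qed

text \<open>The value \<open>r\<close> of the Poisson bracket at \<open>x\<close> of two functions with differentials
  \<open>l\<^sub>i \<circ> d\<pi>\<close>. Along a fibre the \<open>l\<^sub>i\<close> are covectors at one point of the base.\<close>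
definition fibre_bracket :: "'m \<Rightarrow> ('f \<Rightarrow> real) \<Rightarrow> ('f \<Rightarrow> real) \<Rightarrow> real \<Rightarrow> bool" where
  "fibre_bracket x l\<^sub>1 l\<^sub>2 r \<longleftrightarrow> (\<exists>v\<^sub>1 v\<^sub>2. (\<forall>w. ext_deriv A \<alpha> x v\<^sub>1 w = - l\<^sub>1 (mderiv A B \<pi> x w)) \<and>
     (\<forall>w. ext_deriv A \<alpha> x v\<^sub>2 w = - l\<^sub>2 (mderiv A B \<pi> x w)) \<and> r = ext_deriv A \<alpha> x v\<^sub>1 v\<^sub>2)"

text \<open>The pairing depends on each of its vectors only through the covector that d\<alpha>
  makes of it, so the vectors can be exchanged one after the other.\<close>

lemma fibre_bracket_unique:
  assumes "fibre_bracket x l\<^sub>1 l\<^sub>2 r" "fibre_bracket x l\<^sub>1 l\<^sub>2 r'"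
  shows "r = r'"
proof -
  let ?\<omega> = "ext_deriv A \<alpha> x" and ?D = "mderiv A B \<pi> x"
  obtain v1 v2 where v: "\<And>w. ?\<omega> v1 w = - l\<^sub>1 (?D w)" "\<And>w. ?\<omega> v2 w = - l\<^sub>2 (?D w)" "r = ?\<omega> v1 v2"
    using assms(1) unfolding fibre_bracket_def by blast
  obtain u1 u2 where u: "\<And>w. ?\<omega> u1 w = - l\<^sub>1 (?D w)" "\<And>w. ?\<omega> u2 w = - l\<^sub>2 (?D w)" "r' = ?\<omega> u1 u2"
    using assms(2) unfolding fibre_bracket_def by blast
  note anti = ext_deriv_linear(3)[OF smooth_\<alpha>, of x]
  have "r = ?\<omega> u1 v2" using v(1)[of v2] v(3) u(1)[of v2] by simp
  also have "\<dots> = - ?\<omega> v2 u1" by (rule anti)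
  also have "\<dots> = - ?\<omega> u2 u1" using v(2)[of u1] u(2)[of u1] by simp
  also have "\<dots> = r'" using anti[of u1 u2] u(3) by simp
  finally show ?thesis .
qed

lemma ext_deriv_nondegenerate:
  assumes "\<alpha> x u = 0" "\<And>w. ext_deriv A \<alpha> x u w = 0"
  shows "u = 0"
proof -
  obtain v where v: "wedge 1 (2 * n) (\<lambda>w. \<alpha> x (w 0))
        (wedge_power 2 (\<lambda>w. ext_deriv A \<alpha> x (w 0) (w 1)) n) v \<noteq> 0"
    using contact unfolding contact_form_def by blast
  have dim: "DIM('e) = 2 * n + 1" using contact unfolding contact_form_def by blast
  show ?thesis
    by (rule contact_nondegenerate[OF dim linear_\<alpha> ext_deriv_linear(2)[OF smooth_\<alpha>]
          ext_deriv_linear(1)[OF smooth_\<alpha>] ext_deriv_linear(3)[OF smooth_\<alpha>] v assms])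
qed

text \<open>The covector l o d\<pi> kills the Reeb field, which is tangent to the fibres. The
  normalisation \<alpha>(v) = 0 singles out one solution, and this uniqueness later gives continuity
  of the lift along curves.\<close>

lemma horizontal_lift_exists:
  assumes l: "linear l"
  obtains v where "\<alpha> x v = 0" "\<And>w. ext_deriv A \<alpha> x v w = - l (mderiv A B \<pi> x w)"
proof -
  obtain Z where Z: "reeb_field A \<alpha> Z" "mderiv A B \<pi> x (Z x) = 0" using reeb by metis
  have Zx: "\<alpha> x (Z x) = 1" "\<And>w. ext_deriv A \<alpha> x (Z x) w = 0"
    using Z(1) unfolding reeb_field_def by blast+
  have lin: "linear (\<lambda>w. - l (mderiv A B \<pi> x w))"
    using linear_compose_neg[OF linear_compose[OF linear_mderiv_\<pi> l]] by (simp add: o_def)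
  have "- l (mderiv A B \<pi> x (Z x)) = 0" using Z(2) linear_0[OF l] by simp
  show thesis
  proof (rule contact_solve[OF linear_\<alpha>[of x] ext_deriv_linear(2)[OF smooth_\<alpha>]
      ext_deriv_linear(1)[OF smooth_\<alpha>] ext_deriv_linear(3)[OF smooth_\<alpha>] _ Zx lin \<open>- l _ = 0\<close>])
    show "u = 0" if "\<alpha> x u = 0" "\<And>w. ext_deriv A \<alpha> x u w = 0" for u
      by (rule ext_deriv_nondegenerate[OF that])
  qed (rule that)
qed

text \<open>In a chart around \<gamma> s, with D the derivative of Y there, L_Y d\<alpha> = 0 gives
  the derivative of \<omega>, and d\<pi>(Y) = 0 gives those of the two covectors, as
  \<open>pairing_derivative_zero\<close> wants them. Continuity of V1 remains. The lifts come from a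
  choice without regularity, but with \<alpha>(v_1) = 0 they are the unique solutions of a linear
  system with continuous coefficients.\<close>

lemma integral_curve_bracket_derivative:
  assumes Y: "Y \<in> \<X>" and \<gamma>: "integral_curve A Y \<gamma> a b" and s: "s \<in> {a<..<b}"
    and l1: "linear l\<^sub>1" and l2: "linear l\<^sub>2"
    and v1: "\<And>y. \<alpha> y (v\<^sub>1 y) = 0" "\<And>y w. ext_deriv A \<alpha> y (v\<^sub>1 y) w = - l\<^sub>1 (mderiv A B \<pi> y w)"
    and v2: "\<And>y w. ext_deriv A \<alpha> y (v\<^sub>2 y) w = - l\<^sub>2 (mderiv A B \<pi> y w)"
  shows "((\<lambda>t. ext_deriv A \<alpha> (\<gamma> t) (v\<^sub>1 (\<gamma> t)) (v\<^sub>2 (\<gamma> t))) has_real_derivative 0) (at s)"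
proof -
  define k where "k = chart_at A (\<gamma> s)"
  define d where "d = chart_at B (\<pi> (\<gamma> s))"
  have k: "k \<in> A" "\<gamma> s \<in> fst k" unfolding k_def by (rule chart_at)+
  have d: "d \<in> B" "\<pi> (\<gamma> s) \<in> fst d" unfolding d_def by (rule target.chart_at)+
  have Ts: "tangent_map A k (\<gamma> s) w = w" for w unfolding k_def by (rule tangent_map_chart_at)
  define I where "I = {t \<in> {a<..<b}. \<gamma> t \<in> fst k}"
  note ic = integral_curve_chart[OF \<gamma> s k]
  have I: "open I" "s \<in> I" unfolding I_def using ic(2) s k by auto
  define z where "z = (\<lambda>t. snd k (\<gamma> t))"
  define S where "S = snd k ` fst k"
  define S' where "S' = snd k ` (fst k \<inter> \<pi> -` fst d)"
  define f where "f = form_rep A k \<alpha>"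
  define P where "P = \<pi>_rep k d"
  define y where "y = vec_rep A k Y"
  have \<pi>I: "\<pi> (\<gamma> t) = \<pi> (\<gamma> s)" if "t \<in> I" for t
    using orbit_step_fibre[OF Y \<gamma> s] that unfolding I_def by blast
  have zI: "z t \<in> S" "z t \<in> S'" if "t \<in> I" for t
    using \<pi>I[OF that] that d(2) unfolding I_def z_def S_def S'_def by auto
  have fs: "smooth_form_on S f" unfolding f_def S_def by (rule smooth_form_rep[OF smooth_\<alpha> k(1)])
  have opS: "open S" unfolding S_def by (rule open_chart(2)[OF k(1)])
  have S': "S' \<subseteq> S" unfolding S_def S'_def by blast
  have Ps: "open S'" "smooth_on S' P" unfolding S'_def P_def by (rule \<pi>_rep[OF k(1) d(1)])+
  have ys: "smooth_on S y"
    using smooth_vector_fieldD(2)[OF smooth_\<X>[OF Y] k(1)] unfolding y_def S_def by simp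
  have dz: "(z has_derivative (\<lambda>h. h *\<^sub>R y (z s))) (at s)"
    using ic(1) unfolding z_def y_def has_vector_derivative_def .
  define D where "D = frechet_derivative y (at (z s))"
  have linD: "linear D" unfolding D_def by (rule smooth_on_linear_derivative[OF ys zI(1)[OF I(2)]])
  have lie: "frechet_derivative (\<lambda>q. f q w) (at q) (y q) + f q (frechet_derivative y (at q) w) = 0"
    if q: "q \<in> S" for q w
  proof -
    obtain x where x: "x \<in> fst k" "q = snd k x" using q unfolding S_def by blast
    obtain v where "w = tangent_map A k x v" using tangent_map_surj[OF k(1) x(1)] .
    then show ?thesis
      using lie_deriv_chart[OF smooth_\<alpha> smooth_\<X>[OF Y] k(1) x(1), of v] lie_\<X>[OF Y, of x v]
      unfolding f_def y_def x(2) by simp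
  qed
  have Py: "frechet_derivative P (at q) (y q) = 0" if q: "q \<in> S'" for q
  proof -
    obtain x where x: "x \<in> fst k" "\<pi> x \<in> fst d" "q = snd k x" using q unfolding S'_def by blast
    have "y q = tangent_map A k x (Y x)"
      unfolding x(3) y_def by (rule vec_rep_at_point[OF k(1) x(1)])
    then show ?thesis
      using mderiv_\<pi>_zero_iff[OF k(1) x(1) d(1) x(2), of "Y x"] \<X>_tangent[OF Y, of x]
      unfolding P_def x(3) by simp
  qed
  have zs: "z s \<in> S" "z s \<in> S'" using zI[OF I(2)] by blast+
  \<comment> \<open>Differentiating DP(q)(y q) = 0 in direction w and using symmetry of the second
    derivative: d\<pi> is invariant under the flow of Y.\<close>
  have dP: "frechet_derivative (\<lambda>q. frechet_derivative P (at q) w) (at (z s)) (y (z s)) =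
      - frechet_derivative P (at (z s)) (D w)" for w
  proof -
    have E1: "((\<lambda>q. frechet_derivative P (at q) (y q)) has_derivative
       (\<lambda>u. frechet_derivative (\<lambda>q. frechet_derivative P (at q) (y (z s))) (at (z s)) u
          + frechet_derivative P (at (z s)) (D u))) (at (z s))"
    proof (rule has_derivative_linear_field[OF Ps(1) zs(2)])
      show "linear (frechet_derivative P (at q))" if "q \<in> S'" for q
        by (rule smooth_on_linear_derivative[OF Ps(2) that])
      show "(\<lambda>q. frechet_derivative P (at q) v) differentiable (at (z s))" for v
        by (rule smooth_on_differentiable[OF smooth_on_derivative[OF Ps(2)] zs(2)])
      show "(y has_derivative D) (at (z s))" unfolding D_def by (rule smooth_on_has_derivative[OF ys zs(1)])
    qed
    have E2: "((\<lambda>q. frechet_derivative P (at q) (y q)) has_derivative (\<lambda>u. 0)) (at (z s))"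
      by (rule has_derivative_transform_within_open[OF has_derivative_const Ps(1) zs(2)]) (simp add: Py)
    from fun_cong[OF has_derivative_unique[OF E1 E2], of w] show ?thesis
      using second_derivative_symmetric[OF Ps zs(2), of "y (z s)" w] by (simp add: add_eq_0_iff)
  qed
  define \<omega> where "\<omega> = (\<lambda>t u v. form_deriv f (z t) u v)"
  define \<beta>1 where "\<beta>1 = (\<lambda>t w. l\<^sub>1 (frechet_derivative P (at (z t)) w))"
  define \<beta>2 where "\<beta>2 = (\<lambda>t w. l\<^sub>2 (frechet_derivative P (at (z t)) w))"
  define V1 where "V1 = (\<lambda>t. tangent_map A k (\<gamma> t) (v\<^sub>1 (\<gamma> t)))"
  define V2 where "V2 = (\<lambda>t. tangent_map A k (\<gamma> t) (v\<^sub>2 (\<gamma> t)))"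
  have along: "((\<lambda>t. g (z t)) has_real_derivative frechet_derivative g (at (z s)) (y (z s))) (at s)"
    if g: "(g has_derivative frechet_derivative g (at (z s))) (at (z s))" for g :: "'e \<Rightarrow> real"
    using has_derivative_compose[OF dz g] linear_cmul[OF has_derivative_linear[OF g]]
    by (simp add: has_field_derivative_def mult_commute_abs)
  have kI: "\<gamma> t \<in> fst k" if "t \<in> I" for t using that unfolding I_def by blast
  have ext: "ext_deriv A \<alpha> (\<gamma> t) u w = \<omega> t (tangent_map A k (\<gamma> t) u) (tangent_map A k (\<gamma> t) w)"
    if "t \<in> I" for t u w
    unfolding \<omega>_def f_def z_def by (rule ext_deriv_chart[OF smooth_\<alpha> k(1) kI[OF that]])
  \<comment> \<open>The values of \<open>mderiv\<close> refer to the chart at \<pi> (\<gamma> t).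
    This is d for every t in I, as \<pi> is constant along \<gamma>, so the same covectors act at
    all these times.\<close>
  have mP: "mderiv A B \<pi> (\<gamma> t) w = frechet_derivative P (at (z t)) (tangent_map A k (\<gamma> t) w)"
    if "t \<in> I" for t w
    using mderiv_\<pi>[OF k(1) kI[OF that], of w] unfolding P_def z_def d_def \<pi>I[OF that] .
  have solve: "\<omega> t (tangent_map A k (\<gamma> t) (v (\<gamma> t))) w = - l (frechet_derivative P (at (z t)) w)"
    if t: "t \<in> I" and v: "\<And>y w. ext_deriv A \<alpha> y (v y) w = - l (mderiv A B \<pi> y w)" for t w v l
  proof -
    obtain w0 where w0: "w = tangent_map A k (\<gamma> t) w0" using tangent_map_surj[OF k(1) kI[OF t]] .
    show ?thesis unfolding w0 using v[of "\<gamma> t" w0] ext[OF t] mP[OF t] by simp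
  qed
  have V1eq: "\<omega> t (V1 t) w = - \<beta>1 t w" if "t \<in> I" for t w
    unfolding V1_def \<beta>1_def by (rule solve[OF that v1(2)])
  have V2eq: "\<omega> t (V2 t) w = - \<beta>2 t w" if "t \<in> I" for t w
    unfolding V2_def \<beta>2_def by (rule solve[OF that v2])
  have lin\<omega>: "linear (\<lambda>u. \<omega> t u v)" "linear (\<omega> t u)" if "t \<in> I" for t u v
    unfolding \<omega>_def using form_deriv_linear[OF fs zI(1)[OF that]] by blast+
  have d\<omega>: "((\<lambda>t. \<omega> t u v) has_real_derivative - \<omega> s (D u) v - \<omega> s u (D v)) (at s)" for u v
    using along[OF smooth_on_has_derivative[OF smooth_on_form_deriv[OF fs] zs(1)], of u v]
      lie_transport_form_deriv[OF fs ys zs(1) lie, of u v]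
    unfolding \<omega>_def D_def by simp
  have d\<beta>: "((\<lambda>t. l (frechet_derivative P (at (z t)) w)) has_real_derivative
      - l (frechet_derivative P (at (z s)) (D w))) (at s)" if l: "linear l" for l :: "'f \<Rightarrow> real" and w
  proof -
    have bl: "bounded_linear l" using l by (simp add: linear_conv_bounded_linear)
    have "((\<lambda>q. l (frechet_derivative P (at q) w)) has_derivative
       (\<lambda>u. l (frechet_derivative (\<lambda>q. frechet_derivative P (at q) w) (at (z s)) u))) (at (z s))"
      by (rule bounded_linear.has_derivative[OF bl smooth_on_has_derivative[OF smooth_on_derivative[OF Ps(2)] zs(2)]])
    note E = this frechet_derivative_at[OF this]
    have "((\<lambda>t. l (frechet_derivative P (at (z t)) w)) has_real_derivative
        frechet_derivative (\<lambda>q. l (frechet_derivative P (at q) w)) (at (z s)) (y (z s))) (at s)"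
      by (rule along) (use E in simp)
    then show ?thesis unfolding E(2)[symmetric] dP linear_neg[OF l] .
  qed
  have lin\<beta>: "linear (\<beta>2 t)" if "t \<in> I" for t
    unfolding \<beta>2_def using linear_compose[OF smooth_on_linear_derivative[OF Ps(2) zI(2)[OF that]] l2]
    by (simp add: o_def)
  \<comment> \<open>The map u -> i_u \<omega> + f(u) f of \<open>contact_solve\<close> at time t; it
    joins the equation for V1 and its normalisation into one system. Outside I the time is frozen at
    s, so that linearity holds for every t.\<close>
  define M where "M = (\<lambda>t u. \<Sum>i\<in>Basis. (\<omega> (if t \<in> I then t else s) u i +
      f (z (if t \<in> I then t else s)) u * f (z (if t \<in> I then t else s)) i) *\<^sub>R i)"
  define q where "q = (\<lambda>t. \<Sum>i\<in>Basis. (- \<beta>1 t i) *\<^sub>R i)"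
  have evI: "\<forall>\<^sub>F t in at s. t \<in> I" using eventually_at_in_open'[OF I] .
  have linf: "linear (f (z t))" if "t \<in> I" for t by (rule smooth_form_onD(2)[OF fs zI(1)[OF that]])
  have fV: "f (z t) (V1 t) = 0" if "t \<in> I" for t
    unfolding f_def z_def V1_def using form_rep_tangent_map[OF k(1) kI[OF that]] v1(1) by simp
  have MV: "M t (V1 t) = q t" if "t \<in> I" for t
    unfolding M_def q_def using that by (simp add: V1eq fV)
  have "(V1 \<longlongrightarrow> V1 s) (at s)"
  proof (rule linear_solution_tendsto[where M = M and c = q])
    fix t
    have "(if t \<in> I then t else s) \<in> I" using I by simp
    note linI = lin\<omega>(1)[OF this] linf[OF this]
    show "linear (M t)"
      unfolding M_def
      by (rule linearI) (simp_all add: linear_add[OF linI(1)] linear_add[OF linI(2)] linear_cmul[OF linI(1)]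
          linear_cmul[OF linI(2)] algebra_simps sum.distrib scaleR_sum_right)
  next
    fix u assume 0: "M s u = 0"
    have "M s u \<bullet> i = \<omega> s u i + f (z s) u * f (z s) i" if "i \<in> Basis" for i
      unfolding M_def inner_sum_left_Basis[OF that] using I(2) by simp
    then have "\<omega> s u i + f (z s) u * f (z s) i = 0" if "i \<in> Basis" for i
      using that 0 by force
    moreover have "linear (\<lambda>w. \<omega> s u w + f (z s) u * f (z s) w)"
      by (rule linearI) (simp_all add: linear_add[OF lin\<omega>(2)[OF I(2)]] linear_cmul[OF lin\<omega>(2)[OF I(2)]]
          linear_add[OF linf[OF I(2)]] linear_cmul[OF linf[OF I(2)]] algebra_simps)
    ultimately have eq: "\<omega> s u w + f (z s) u * f (z s) w = 0" for w
      using linear_basis_expansion[of "\<lambda>w. \<omega> s u w + f (z s) u * f (z s) w" w] by simp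
    have f\<alpha>: "f (z s) w = \<alpha> (\<gamma> s) w" for w
      using form_rep_tangent_map[OF k, of \<alpha> w] by (simp add: f_def z_def Ts)
    have \<omega>e: "\<omega> s u w = ext_deriv A \<alpha> (\<gamma> s) u w" for w using ext[OF I(2), of u w] by (simp add: Ts)
    obtain Z where "reeb_field A \<alpha> Z" using reeb by metis
    then have Z: "\<alpha> (\<gamma> s) (Z (\<gamma> s)) = 1" "ext_deriv A \<alpha> (\<gamma> s) (Z (\<gamma> s)) u = 0"
      unfolding reeb_field_def by blast+
    then have "ext_deriv A \<alpha> (\<gamma> s) u (Z (\<gamma> s)) = 0" using ext_deriv_linear(3)[OF smooth_\<alpha>, of "\<gamma> s" u] by simp
    then have "\<alpha> (\<gamma> s) u = 0" using eq[of "Z (\<gamma> s)"] Z(1) by (simp add: f\<alpha> \<omega>e)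
    then show "u = 0" using eq by (intro ext_deriv_nondegenerate) (simp_all add: f\<alpha> \<omega>e)
  next
    fix u
    have cf: "((\<lambda>t. f (z t) w) \<longlongrightarrow> f (z s) w) (at s)" for w
      using DERIV_isCont[OF along[OF smooth_form_on_derivative(1)[OF fs zs(1)]]] by (simp add: isCont_def)
    have c\<omega>: "((\<lambda>t. \<omega> t u w) \<longlongrightarrow> \<omega> s u w) (at s)" for w
      using DERIV_isCont[OF d\<omega>] by (simp add: isCont_def)
    have L: "((\<lambda>t. \<Sum>i\<in>Basis. (\<omega> t u i + f (z t) u * f (z t) i) *\<^sub>R i) \<longlongrightarrow>
       (\<Sum>i\<in>Basis. (\<omega> s u i + f (z s) u * f (z s) i) *\<^sub>R i)) (at s)"
      by (intro tendsto_intros cf c\<omega>)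
    have "\<forall>\<^sub>F t in at s. (\<Sum>i\<in>Basis. (\<omega> t u i + f (z t) u * f (z t) i) *\<^sub>R i) = M t u"
      using evI by eventually_elim (simp add: M_def)
    from Lim_transform_eventually[OF L this] show "((\<lambda>t. M t u) \<longlongrightarrow> M s u) (at s)"
      unfolding M_def using I(2) by simp
  next
    show "\<forall>\<^sub>F t in at s. M t (V1 t) = q t" using evI by eventually_elim (rule MV)
    show "M s (V1 s) = q s" by (rule MV[OF I(2)])
    have "((\<lambda>t. \<beta>1 t w) \<longlongrightarrow> \<beta>1 s w) (at s)" for w
      using DERIV_isCont[OF d\<beta>[OF l1]] unfolding \<beta>1_def isCont_def .
    then show "(q \<longlongrightarrow> q s) (at s)" unfolding q_def by (intro tendsto_intros)
  qed
  then have "((\<lambda>t. \<omega> t (V1 t) (V2 t)) has_real_derivative 0) (at s)"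
  proof (rule pairing_derivative_zero[OF I lin\<omega>(1) lin\<beta> linD _ V1eq V2eq d\<omega>, rotated -1])
    show "((\<lambda>t. \<beta>1 t w) has_real_derivative - \<beta>1 s (D w)) (at s)" for w unfolding \<beta>1_def by (rule d\<beta>[OF l1])
    show "((\<lambda>t. \<beta>2 t w) has_real_derivative - \<beta>2 s (D w)) (at s)" for w unfolding \<beta>2_def by (rule d\<beta>[OF l2])
    show "\<omega> t u v = - \<omega> t v u" for t u v unfolding \<omega>_def by (rule form_deriv_antisym)
  qed
  then have "((\<lambda>t. \<omega> t (V1 t) (V2 t)) has_derivative (*) 0) (at s)" by (simp add: has_field_derivative_def)
  then have "((\<lambda>t. ext_deriv A \<alpha> (\<gamma> t) (v\<^sub>1 (\<gamma> t)) (v\<^sub>2 (\<gamma> t))) has_derivative (*) 0) (at s)"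
    by (rule has_derivative_transform_within_open[OF _ I]) (simp add: ext V1_def V2_def)
  then show ?thesis by (simp add: has_field_derivative_def)
qed

section \<open>Constancy of the bracket along fibres\<close>

text \<open>Lifts are chosen at all points of M at once, which makes the pairing a function on the
  whole integral curve. It is constant there, and uniqueness of the bracket identifies its value at
  x with r.\<close>

lemma fibre_bracket_orbit_step:
  assumes l: "linear l\<^sub>1" "linear l\<^sub>2" and xy: "(x, y) \<in> orbit_step A \<X>" and r: "fibre_bracket x l\<^sub>1 l\<^sub>2 r"
  shows "fibre_bracket y l\<^sub>1 l\<^sub>2 r"
proof -
  obtain Y \<gamma> a b s t where Y: "Y \<in> \<X>" and \<gamma>: "integral_curve A Y \<gamma> a b"
    and st: "s \<in> {a<..<b}" "t \<in> {a<..<b}" "\<gamma> s = x" "\<gamma> t = y"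
    using xy unfolding orbit_step_def by blast
  have "\<forall>y. \<exists>v. \<alpha> y v = 0 \<and> (\<forall>w. ext_deriv A \<alpha> y v w = - l (mderiv A B \<pi> y w))" if "linear l" for l
    using horizontal_lift_exists[OF that] by metis
  note lift = choice[OF this]
  obtain v1 where v1: "\<And>y. \<alpha> y (v1 y) = 0" "\<And>y w. ext_deriv A \<alpha> y (v1 y) w = - l\<^sub>1 (mderiv A B \<pi> y w)"
    using lift[OF l(1)] by blast
  obtain v2 where v2: "\<And>y w. ext_deriv A \<alpha> y (v2 y) w = - l\<^sub>2 (mderiv A B \<pi> y w)"
    using lift[OF l(2)] by blast
  let ?H = "\<lambda>t. ext_deriv A \<alpha> (\<gamma> t) (v1 (\<gamma> t)) (v2 (\<gamma> t))"
  have H: "fibre_bracket (\<gamma> t) l\<^sub>1 l\<^sub>2 (?H t)" for t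
    using v1(2) v2 unfolding fibre_bracket_def by blast
  have "(?H has_real_derivative 0) (at t)" if "t \<in> {a<..<b}" for t
    by (rule integral_curve_bracket_derivative[OF Y \<gamma> that l v1 v2])
  then have "?H constant_on {a<..<b}"
    by (rule has_field_derivative_0_imp_constant_on) auto
  then have "?H t = ?H s" using st(1,2) unfolding constant_on_def by metis
  moreover have "?H s = r" using fibre_bracket_unique[OF H[of s]] r unfolding st(3) by blast
  ultimately show ?thesis using H[of t] st(4) by simp
qed

lemma fibre_bracket_component:
  assumes l: "linear l\<^sub>1" "linear l\<^sub>2" and y: "y \<in> connected_component_set (\<pi> -` {\<pi> x}) x"
    and r: "fibre_bracket x l\<^sub>1 l\<^sub>2 r"
  shows "fibre_bracket y l\<^sub>1 l\<^sub>2 r"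
proof -
  have "(x, y) \<in> (orbit_step A \<X>)\<^sup>*" using y unfolding orbit_\<X>[symmetric] orbit_of_def by simp
  then show ?thesis
    by (induction rule: rtrancl_induct) (use r fibre_bracket_orbit_step[OF l] in blast)+
qed

lemma bracket_first_integral:
  assumes f1: "first_integral A (ker_dist A B \<pi>) U f\<^sub>1" and f2: "first_integral A (ker_dist A B \<pi>) U f\<^sub>2"
    and h: "jacobi_bracket A \<alpha> U f\<^sub>1 f\<^sub>2 h"
  shows "first_integral A (ker_dist A B \<pi>) U h"
proof -
  obtain X Y where X: "contact_field A \<alpha> U f\<^sub>1 X" and Y: "contact_field A \<alpha> U f\<^sub>2 Y"
    and hXY: "\<And>x. x \<in> U \<Longrightarrow> h x = \<alpha> x (lie_bracket A X Y x)"
    using h unfolding jacobi_bracket_def by blast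
  obtain Z where Z: "reeb_field A \<alpha> Z" "\<And>x. mderiv A B \<pi> x (Z x) = 0" using reeb by metis
  have f1s: "smooth_map A std_atlas U f\<^sub>1" and f1k: "\<And>x v. x \<in> U \<Longrightarrow> mderiv A B \<pi> x v = 0 \<Longrightarrow> mderiv A std_atlas f\<^sub>1 x v = 0"
    using f1 unfolding first_integral_def ker_dist_def by blast+
  have f2s: "smooth_map A std_atlas U f\<^sub>2" and f2k: "\<And>x v. x \<in> U \<Longrightarrow> mderiv A B \<pi> x v = 0 \<Longrightarrow> mderiv A std_atlas f\<^sub>2 x v = 0"
    using f2 unfolding first_integral_def ker_dist_def by blast+
  have Xs: "smooth_vector_field A U X" using X unfolding contact_field_def by blast
  have opU: "open U" using f1s unfolding smooth_map_def by blast
  have d1: "ext_deriv A \<alpha> x (X x) v = - mderiv A std_atlas f\<^sub>1 x v" if "x \<in> U" for x v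
    using contact_field_differential[OF smooth_\<alpha> Z(1) X that f1s f1k[OF that Z(2)], of v] by simp
  have d2: "ext_deriv A \<alpha> x (Y x) v = - mderiv A std_atlas f\<^sub>2 x v" if "x \<in> U" for x v
    using contact_field_differential[OF smooth_\<alpha> Z(1) Y that f2s f2k[OF that Z(2)], of v] by simp
  have h\<omega>: "h x = ext_deriv A \<alpha> x (X x) (Y x)" if "x \<in> U" for x
    unfolding hXY[OF that]
    by (rule bracket_eq_ext_deriv[OF smooth_\<alpha> Z(1) that X f1s f1k[OF that Z(2)] Y f2s f2k[OF that Z(2)]])
  \<comment> \<open>In this form smoothness of h can be read off in charts: the derivative of f_2
    applied to a smooth vector field.\<close>
  have hX: "h x = mderiv A std_atlas f\<^sub>2 x (X x)" if "x \<in> U" for x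
    using h\<omega>[OF that] d2[OF that, of "X x"] ext_deriv_linear(3)[OF smooth_\<alpha>, of x "X x" "Y x"] by simp
  have hs: "smooth_map A std_atlas U h"
  proof (rule smooth_mapI_std[OF opU])
    fix c assume c: "c \<in> A"
    let ?S = "snd c ` (U \<inter> fst c)" and ?g = "f\<^sub>2 \<circ> chart_inv c"
    note g = smooth_function_chart(1,2)[OF f2s c]
    have "smooth_on ?S (\<lambda>y. frechet_derivative ?g (at y) (vec_rep A c X y))"
      by (rule smooth_on_linear_field[OF g(1) smooth_on_linear_derivative[OF g(2)]
            smooth_on_derivative[OF g(2)] smooth_vector_fieldD(2)[OF Xs c]])
    then show "smooth_on ?S (h \<circ> chart_inv c)"
    proof (rule smooth_on_cong[OF _ g(1)])
      fix y assume "y \<in> ?S"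
      then obtain x where x: "x \<in> U" "x \<in> fst c" "y = snd c x" by blast
      show "frechet_derivative ?g (at y) (vec_rep A c X y) = (h \<circ> chart_inv c) y"
        using smooth_function_chart(3)[OF f2s c x(1,2)] hX[OF x(1)]
        by (simp add: x(3) vec_rep_at_point[OF c x(2)] chart_inv_left[OF c x(2)])
    qed
  qed
  have "mderiv A std_atlas h x v = 0" if x: "x \<in> U" and v: "mderiv A B \<pi> x v = 0" for x v
  proof -
    define k where "k = chart_at A x"
    define d where "d = chart_at B (\<pi> x)"
    have k: "k \<in> A" "x \<in> fst k" unfolding k_def by (rule chart_at)+
    have d: "d \<in> B" "\<pi> x \<in> fst d" unfolding d_def by (rule target.chart_at)+
    have T: "tangent_map A k x w = w" for w unfolding k_def by (rule tangent_map_chart_at)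
    \<comment> \<open>Within U, one chart of M and one of W, so that \<pi>, f_1 and f_2 all have
      coordinate expressions on S.\<close>
    define S where "S = snd k ` (U \<inter> fst k \<inter> \<pi> -` fst d)"
    have S: "S = snd k ` (U \<inter> fst k) \<inter> snd k ` (fst k \<inter> \<pi> -` fst d)"
      unfolding S_def by (auto dest!: arg_cong[of _ _ "chart_inv k"] simp: chart_inv_left[OF k(1)])
    have opS: "open S" unfolding S
      using open_chart_image[OF k(1) opU] \<pi>_rep(1)[OF k(1) d(1)] by (rule open_Int)
    define P where "P = \<pi>_rep k d"
    have Ps: "smooth_on S P" unfolding P_def S by (rule smooth_on_subset[OF \<pi>_rep(2)[OF k(1) d(1)]]) blast
    have z: "snd k x \<in> S" unfolding S_def using x k d by blast
    have DP: "mderiv A B \<pi> x = frechet_derivative P (at (snd k x))"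
      using mderiv_\<pi>[OF k] unfolding P_def T d_def by (rule ext)
    have surj: "surj (frechet_derivative P (at (snd k x)))" using surj_mderiv_\<pi>[of x] unfolding DP .
    have v0: "frechet_derivative P (at (snd k x)) v = 0" using v unfolding DP .
    obtain \<epsilon> \<gamma> where eps: "\<epsilon> > 0" and \<gamma>0: "\<gamma> 0 = snd k x" and \<gamma>c: "continuous_on {-\<epsilon><..<\<epsilon>} \<gamma>"
      and \<gamma>: "\<And>s. s \<in> {-\<epsilon><..<\<epsilon>} \<Longrightarrow> \<gamma> s \<in> S \<and> P (\<gamma> s) = P (snd k x)"
      and \<gamma>v: "(\<gamma> has_vector_derivative v) (at 0)"
      and \<gamma>l: "\<And>f :: 'e \<Rightarrow> real. (\<And>y. y \<in> S \<Longrightarrow> f differentiable (at y)) \<Longrightarrow>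
       (\<And>y w. y \<in> S \<Longrightarrow> frechet_derivative P (at y) w = 0 \<Longrightarrow> frechet_derivative f (at y) w = 0) \<Longrightarrow>
       \<exists>l. linear l \<and> (\<forall>s\<in>{-\<epsilon><..<\<epsilon>}. \<forall>w.
          frechet_derivative f (at (\<gamma> s)) w = l (frechet_derivative P (at (\<gamma> s)) w))"
    proof (rule submersion_fibre_curve[OF opS Ps z surj v0], goal_cases)
      case (1 \<epsilon> \<gamma>)
      show ?case by (rule that; fact 1)
    qed
    let ?I = "{-\<epsilon><..<\<epsilon>}"
    define c where "c = (\<lambda>s. chart_inv k (\<gamma> s))"
    have c: "c s \<in> U" "c s \<in> fst k" "snd k (c s) = \<gamma> s" "\<pi> (c s) = \<pi> x" if s: "s \<in> ?I" for s
    proof -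
      obtain y where y: "y \<in> U" "y \<in> fst k" "\<pi> y \<in> fst d" "\<gamma> s = snd k y"
        using \<gamma>[OF s] unfolding S_def by blast
      have cs: "c s = y" unfolding c_def y(4) by (rule chart_inv_left[OF k(1) y(2)])
      show "c s \<in> U" "c s \<in> fst k" "snd k (c s) = \<gamma> s" unfolding cs y(4) using y by auto
      have "snd d (\<pi> y) = snd d (\<pi> x)"
        using \<gamma>[OF s] unfolding P_def \<pi>_rep_def y(4) by (simp add: chart_inv_left[OF k(1)] y k)
      then show "\<pi> (c s) = \<pi> x"
        unfolding cs using target.chart_inv_left[OF d(1)] y(3) d(2) by metis
    qed
    \<comment> \<open>One covector l represents df at all points of the curve. Both chart changes
      are harmless: k is fixed, and the chart of W is that at \<pi> x throughout.\<close>
    have lift: "\<exists>l. linear l \<and> (\<forall>s\<in>?I. \<forall>w. mderiv A std_atlas f (c s) w = l (mderiv A B \<pi> (c s) w))"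
      if f: "smooth_map A std_atlas U f"
        and fk: "\<And>x v. x \<in> U \<Longrightarrow> mderiv A B \<pi> x v = 0 \<Longrightarrow> mderiv A std_atlas f x v = 0" for f :: "'m \<Rightarrow> real"
    proof -
      have "\<exists>l. linear l \<and> (\<forall>s\<in>?I. \<forall>w.
          frechet_derivative (f \<circ> chart_inv k) (at (\<gamma> s)) w = l (frechet_derivative P (at (\<gamma> s)) w))"
      proof (rule \<gamma>l)
        show "f \<circ> chart_inv k differentiable (at y)" if "y \<in> S" for y
          using that unfolding S by (intro smooth_on_differentiable[OF smooth_function_chart(2)[OF f k(1)]]) blast
        fix y w assume y: "y \<in> S" and w: "frechet_derivative P (at y) w = 0"
        obtain x' where x': "x' \<in> U" "x' \<in> fst k" "\<pi> x' \<in> fst d" "y = snd k x'" using y unfolding S_def by blast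
        obtain w0 where w0: "w = tangent_map A k x' w0" using tangent_map_surj[OF k(1) x'(2)] .
        have "mderiv A B \<pi> x' w0 = 0"
          using w unfolding mderiv_\<pi>_zero_iff[OF k(1) x'(2) d(1) x'(3)] P_def x'(4) w0 .
        then show "frechet_derivative (f \<circ> chart_inv k) (at y) w = 0"
          using fk[OF x'(1)] smooth_function_chart(3)[OF f k(1) x'(1,2), of w0] unfolding x'(4) w0 by simp
      qed
      then obtain l where l: "linear l" "\<And>s w. s \<in> ?I \<Longrightarrow>
          frechet_derivative (f \<circ> chart_inv k) (at (\<gamma> s)) w = l (frechet_derivative P (at (\<gamma> s)) w)" by blast
      have "mderiv A std_atlas f (c s) w = l (mderiv A B \<pi> (c s) w)" if s: "s \<in> ?I" for s w
        using smooth_function_chart(3)[OF f k(1) c(1,2)[OF s], of w] mderiv_\<pi>[OF k(1) c(2)[OF s], of w]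
          l(2)[OF s] unfolding c(3)[OF s] c(4)[OF s] P_def d_def by simp
      then show ?thesis using l(1) by blast
    qed
    obtain l1 where l1: "linear l1" "\<And>s w. s \<in> ?I \<Longrightarrow> mderiv A std_atlas f\<^sub>1 (c s) w = l1 (mderiv A B \<pi> (c s) w)"
      using lift[OF f1s f1k] by blast
    obtain l2 where l2: "linear l2" "\<And>s w. s \<in> ?I \<Longrightarrow> mderiv A std_atlas f\<^sub>2 (c s) w = l2 (mderiv A B \<pi> (c s) w)"
      using lift[OF f2s f2k] by blast
    \<comment> \<open>The contact fields themselves are vectors for the covectors l1 and l2, so h is
      the fibre bracket at each point of the curve, with the same l1 and l2.\<close>
    have br: "fibre_bracket (c s) l1 l2 (h (c s))" if s: "s \<in> ?I" for s
      unfolding fibre_bracket_def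
      by (intro exI[of _ "X (c s)"] exI[of _ "Y (c s)"] conjI allI)
        (simp_all only: d1[OF c(1)[OF s]] d2[OF c(1)[OF s]] l1(2)[OF s] l2(2)[OF s] h\<omega>[OF c(1)[OF s]])
    have c0: "c 0 = x" unfolding c_def \<gamma>0 by (rule chart_inv_left[OF k])
    have I0: "0 \<in> ?I" using eps by simp
    have "continuous_on ?I c" unfolding c_def
      by (rule continuous_on_compose2[OF continuous_on_chart(2)[OF k(1)] \<gamma>c]) (use \<gamma> S in blast)
    then have conn: "connected (c ` ?I)" by (rule connected_continuous_image) simp
    have "c ` ?I \<subseteq> \<pi> -` {\<pi> x}" using c(4) by blast
    \<comment> \<open>The curve is connected and contains x, so it lies in the component of x in the
      whole fibre, which is an orbit. Integral curves joining x to c s may leave U; the fibre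
      bracket is defined there as well.\<close>
    from connected_component_maximal[OF imageI[OF I0, of c, unfolded c0] conn this]
    have comp: "c ` ?I \<subseteq> connected_component_set (\<pi> -` {\<pi> x}) x" .
    have hc: "h (c s) = h x" if "s \<in> ?I" for s
    proof -
      have "fibre_bracket (c s) l1 l2 (h x)"
        using subsetD[OF comp imageI[OF that]] br[OF I0] unfolding c0
        by (rule fibre_bracket_component[OF l1(1) l2(1)])
      then show ?thesis by (rule fibre_bracket_unique[OF br[OF that]])
    qed
    let ?g = "h \<circ> chart_inv k"
    have "snd k x \<in> snd k ` (U \<inter> fst k)" using x k by blast
    then have Dg: "(?g has_derivative frechet_derivative ?g (at (snd k x))) (at (\<gamma> 0))"
      unfolding \<gamma>0 by (rule smooth_on_has_derivative[OF smooth_function_chart(2)[OF hs k(1)]])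
    have E1: "((\<lambda>s. ?g (\<gamma> s)) has_derivative (\<lambda>r. frechet_derivative ?g (at (snd k x)) (r *\<^sub>R v))) (at 0)"
      using \<gamma>v Dg unfolding has_vector_derivative_def by (rule has_derivative_compose)
    have E2: "((\<lambda>s. ?g (\<gamma> s)) has_derivative (\<lambda>r. 0)) (at 0)"
      by (rule has_derivative_transform_within_open[OF has_derivative_const open_greaterThanLessThan I0])
        (use hc in \<open>simp add: c_def\<close>)
    from fun_cong[OF has_derivative_unique[OF E1 E2], of 1] show ?thesis
      using smooth_function_chart(3)[OF hs k(1) x k(2), of v] by (simp add: T)
  qed
  then show ?thesis using hs unfolding first_integral_def ker_dist_def by blast
qed

end

theorem proposition2:
  fixes A :: "('m::{t2_space,second_countable_topology}, 'e::euclidean_space) chart set"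
    and B :: "('w::{t2_space,second_countable_topology}, 'f::euclidean_space) chart set"
    and \<alpha> :: "'m \<Rightarrow> 'e \<Rightarrow> real"
    and \<X> :: "('m \<Rightarrow> 'e) set"
    and \<pi> :: "'m \<Rightarrow> 'w"
    and n p :: nat
  assumes "smooth_manifold A" and "connected (UNIV :: 'm set)"
    and "contact_form A n \<alpha>"
    and "smooth_manifold B" and "DIM('f) = p" and "p \<ge> n"
    and "proper_submersion_onto A B \<pi>"
    and "complete_pre_isotropic_reeb A B \<pi> \<alpha> \<X>"
  shows "alpha_complete A \<alpha> (ker_dist A B \<pi>)"
proof -
  interpret pre_isotropic_reeb A B \<alpha> \<X> \<pi> n
    using assms by unfold_locales
  show ?thesis unfolding alpha_complete_def using bracket_first_integral by blast
qed

end
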